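(* Let $\Phi = \{f_t\}$ be a special contact Anosov flow on a closed Riemannian 3-manifold $M$, with Riemannian metric $g$ and global $g$-orthonormal frame $(X,Y,Z)$ as in the definition of a special contact Anosov flow. Then there exists a $\delta > 0$ such that for all $x \in M$ and all $t \in \mathbb{R}$ with $|t| < \delta$, every $su$-subriemannian geodesic connecting $x$ and $f_t(x)$ is $su$-balanced.
   Context: Anosov flow: a non-singular smooth flow $\Phi=\{f_t\}$ on a closed (compact, without boundary), connected Riemannian manifold $M$ is an Anosov flow if there is a $Tf_t$-invariant splitting $TM = E^{ss}\oplus E^c\oplus E^{uu}$ such that $E^c$ is spanned by the infinitesimal generator of the flow and there exist constants $c>0$, $0<\mu_-\le\mu_+<1$ and $\lambda_+\ge\lambda_->1$ such that for all $v\in E^{ss}$, $w\in E^{uu}$ and $t\ge 0$, $$\tfrac1c\mu_-^t\|v\|\le\|Tf_t(v)\|\le c\mu_+^t\|v\|,\qquad \tfrac1c\lambda_-^t\|w\|\le\|Tf_t(w)\|\le c\lambda_+^t\|w\|.$$ $E^{ss}$, $E^{uu}$, $E^c$ are called the strong stable, strong unstable and center bundles, and $E^{su}=E^{ss}\oplus E^{uu}$. Special contact Anosov flow: an Anosov flow $\Phi$ on a closed 3-manifold $M$, with infinitesimal generator $X$, is called a special contact Anosov flow if there exist a $C^1$ Riemannian metric $g$ and a $C^1$ global frame $(X,Y,Z)$ of $TM$, orthonormal relative to $g$, such that (a) $E^c=\mathbb{R}X$, $E^{ss}=\mathbb{R}Y$, $E^{uu}=\mathbb{R}Z$; and (b)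 $[X,Y]=Y$, $[Y,Z]=X$, $[Z,X]=Z$. Subriemannian notions (all lengths and norms are with respect to $g$): a horizontal path is an absolutely continuous path $\gamma:[a,b]\to M$ with $\dot\gamma(s)\in E^{su}$ for almost every $s$; its length is $|\gamma|=\int_a^b\|\dot\gamma(s)\|\,ds$. An $su$-subriemannian geodesic from $x$ to $y$ is a horizontal path from $x$ to $y$ which minimizes length among all horizontal paths connecting $x$ and $y$. $su$-balanced: geodesics are parametrized by unit speed, $\gamma:[0,\ell]\to M$ with $\ell=|\gamma|>0$. Write $\dot\gamma(s)=w_s(s)+w_u(s)$ with $w_s(s)\in E^{ss}$, $w_u(s)\in E^{uu}$, and set $\mathcal{E}_s(\gamma)=\frac1\ell\int_0^\ell\|w_s(s)\|^2ds$ and $\mathcal{E}_u(\gamma)=\frac1\ell\int_0^\ell\|w_u(s)\|^2ds$. The geodesic $\gamma$ is $su$-balanced if $\mathcal{E}_s(\gamma)=\mathcal{E}_u(\gamma)$. *)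

theory Defs
  imports "HOL-Analysis.Analysis" "HOL-Library.Function_Algebras"
begin

section \<open>Maps of class $C^k$\<close>

text \<open>
  Only used for \<open>S\<close> open: all iterated directional derivatives up to order \<open>k\<close> exist and are
  continuous on \<open>S\<close>.
\<close>

primrec Ck_on :: "nat \<Rightarrow> ('b::euclidean_space \<Rightarrow> 'c::real_normed_vector) \<Rightarrow> 'b set \<Rightarrow> bool" where
  "Ck_on 0 f S \<longleftrightarrow> continuous_on S f"
| "Ck_on (Suc k) f S \<longleftrightarrow>
     (\<forall>x\<in>S. f differentiable (at x)) \<and> (\<forall>v. Ck_on k (\<lambda>x. frechet_derivative f (at x) v) S)"

definition smooth_map_on :: "('b::euclidean_space \<Rightarrow> 'c::real_normed_vector) \<Rightarrow> 'b set \<Rightarrow> bool" where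
  "smooth_map_on f S \<longleftrightarrow> (\<forall>k. Ck_on k f S)"


section \<open>Smooth manifolds\<close>

text \<open>
  The manifold is the whole type \<open>'a\<close>. A chart is a pair of an open domain and a coordinate map
  (only the values of the map on the domain matter).
\<close>

type_synonym ('a, 'b) chart = "'a set \<times> ('a \<Rightarrow> 'b)"

definition chart_inv :: "('a, 'b) chart \<Rightarrow> 'b \<Rightarrow> 'a" where
  "chart_inv c = inv_into (fst c) (snd c)"

definition charts_at :: "('a, 'b) chart set \<Rightarrow> 'a \<Rightarrow> ('a, 'b) chart set" where
  "charts_at A p = {c \<in> A. p \<in> fst c}"

definition smooth_atlas ::
  "('a::{t2_space,second_countable_topology}, 'b::euclidean_space) chart set \<Rightarrow> bool" where
  "smooth_atlas A \<longleftrightarrow>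
     (\<forall>c\<in>A. open (fst c) \<and> open (snd c ` fst c) \<and>
            homeomorphism (fst c) (snd c ` fst c) (snd c) (chart_inv c)) \<and>
     (\<Union>c\<in>A. fst c) = UNIV \<and>
     (\<forall>c\<in>A. \<forall>c'\<in>A. smooth_map_on (snd c' \<circ> chart_inv c) (snd c ` (fst c \<inter> fst c')))"

definition closed_connected_manifold ::
  "('a::{t2_space,second_countable_topology}, 'b::euclidean_space) chart set \<Rightarrow> bool" where
  "closed_connected_manifold A \<longleftrightarrow>
     smooth_atlas A \<and> compact (UNIV :: 'a set) \<and> connected (UNIV :: 'a set)"


section \<open>Tangent vectors\<close>

text \<open>
  A tangent vector at \<open>p\<close> is the family of its coordinate representations in all charts around
  \<open>p\<close>, related by the derivatives of the transition maps (and set to 0 for all other pairs).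
  The vector space structure is pointwise.
\<close>

instantiation "fun" :: (type, real_vector) real_vector
begin

definition scaleR_fun :: "real \<Rightarrow> ('a \<Rightarrow> 'b) \<Rightarrow> 'a \<Rightarrow> 'b" where
  "scaleR_fun r f = (\<lambda>x. r *\<^sub>R f x)"

instance
  by standard (auto simp: scaleR_fun_def plus_fun_def scaleR_add_right scaleR_add_left)

end

type_synonym ('a, 'b) tvec = "('a, 'b) chart \<Rightarrow> 'b"

definition tangent_space ::
  "('a, 'b::euclidean_space) chart set \<Rightarrow> 'a \<Rightarrow> ('a, 'b) tvec set" where
  "tangent_space A p =
     {v. (\<forall>c\<in>charts_at A p. \<forall>c'\<in>charts_at A p.
            v c' = frechet_derivative (snd c' \<circ> chart_inv c) (at (snd c p)) (v c)) \<and>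
         (\<forall>c. c \<notin> charts_at A p \<longrightarrow> v c = 0)}"

text \<open>The tangent vector at \<open>p\<close> represented by \<open>w\<close> in the chart \<open>c\<close>.\<close>

definition coord_tvec ::
  "('a, 'b::euclidean_space) chart set \<Rightarrow> ('a, 'b) chart \<Rightarrow> 'a \<Rightarrow> 'b \<Rightarrow> ('a, 'b) tvec" where
  "coord_tvec A c p w = (\<lambda>c'. if c' \<in> charts_at A p
     then frechet_derivative (snd c' \<circ> chart_inv c) (at (snd c p)) w else 0)"

text \<open>For \<open>v\<close> tangent at \<open>p\<close> the choice of the chart \<open>c\<close> around \<open>p\<close> is immaterial.\<close>

definition tangent_map ::
  "('a, 'b::euclidean_space) chart set \<Rightarrow> ('a \<Rightarrow> 'a) \<Rightarrow> 'a \<Rightarrow> ('a, 'b) tvec \<Rightarrow> ('a, 'b) tvec" where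
  "tangent_map A F p v = (\<lambda>c'. if c' \<in> charts_at A (F p)
     then let c = (SOME c. c \<in> charts_at A p)
          in frechet_derivative (snd c' \<circ> F \<circ> chart_inv c) (at (snd c p)) (v c)
     else 0)"

definition Ck_vector_field ::
  "('a, 'b::euclidean_space) chart set \<Rightarrow> nat \<Rightarrow> ('a \<Rightarrow> ('a, 'b) tvec) \<Rightarrow> bool" where
  "Ck_vector_field A k V \<longleftrightarrow>
     (\<forall>p. V p \<in> tangent_space A p) \<and>
     (\<forall>c\<in>A. Ck_on k (\<lambda>u. V (chart_inv c u) c) (snd c ` fst c))"

text \<open>
  $[V,W] = VW - WV$ as derivations, i.e. in coordinates
  $[V,W]^i = \sum_j V^j \partial_j W^i - W^j \partial_j V^i$.
\<close>

definition lie_bracket ::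
  "('a, 'b::euclidean_space) chart set \<Rightarrow> ('a \<Rightarrow> ('a, 'b) tvec) \<Rightarrow> ('a \<Rightarrow> ('a, 'b) tvec)
     \<Rightarrow> 'a \<Rightarrow> ('a, 'b) tvec" where
  "lie_bracket A V W p = (\<lambda>c. if c \<in> charts_at A p
     then frechet_derivative (\<lambda>u. W (chart_inv c u) c) (at (snd c p)) (V p c)
        - frechet_derivative (\<lambda>u. V (chart_inv c u) c) (at (snd c p)) (W p c)
     else 0)"

definition global_frame3 ::
  "('a, 'b::euclidean_space) chart set \<Rightarrow> ('a \<Rightarrow> ('a, 'b) tvec) \<Rightarrow> ('a \<Rightarrow> ('a, 'b) tvec)
     \<Rightarrow> ('a \<Rightarrow> ('a, 'b) tvec) \<Rightarrow> bool" where
  "global_frame3 A X Y Z \<longleftrightarrow>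
     (\<forall>p. distinct [X p, Y p, Z p] \<and> independent {X p, Y p, Z p} \<and>
          span {X p, Y p, Z p} = tangent_space A p)"


section \<open>Riemannian metrics\<close>

type_synonym ('a, 'b) metric = "'a \<Rightarrow> ('a, 'b) tvec \<Rightarrow> ('a, 'b) tvec \<Rightarrow> real"

definition Ck_riemannian_metric ::
  "('a, 'b::euclidean_space) chart set \<Rightarrow> nat \<Rightarrow> ('a, 'b) metric \<Rightarrow> bool" where
  "Ck_riemannian_metric A k g \<longleftrightarrow>
     (\<forall>p. \<forall>u\<in>tangent_space A p. \<forall>v\<in>tangent_space A p.
        g p u v = g p v u \<and>
        (\<forall>w\<in>tangent_space A p. g p (u + v) w = g p u w + g p v w) \<and>
        (\<forall>r. g p (r *\<^sub>R u) v = r * g p u v) \<and>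
        (u \<noteq> 0 \<longrightarrow> g p u u > 0)) \<and>
     (\<forall>c\<in>A. \<forall>v w. Ck_on k
        (\<lambda>x. g (chart_inv c x) (coord_tvec A c (chart_inv c x) v) (coord_tvec A c (chart_inv c x) w))
        (snd c ` fst c))"

definition smooth_riemannian_metric ::
  "('a, 'b::euclidean_space) chart set \<Rightarrow> ('a, 'b) metric \<Rightarrow> bool" where
  "smooth_riemannian_metric A g \<longleftrightarrow> (\<forall>k. Ck_riemannian_metric A k g)"

definition tnorm :: "('a, 'b) metric \<Rightarrow> 'a \<Rightarrow> ('a, 'b) tvec \<Rightarrow> real" where
  "tnorm g p v = sqrt (g p v v)"

definition orthonormal3 ::
  "('a, 'b) metric \<Rightarrow> ('a \<Rightarrow> ('a, 'b) tvec) \<Rightarrow> ('a \<Rightarrow> ('a, 'b) tvec)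
     \<Rightarrow> ('a \<Rightarrow> ('a, 'b) tvec) \<Rightarrow> bool" where
  "orthonormal3 g X Y Z \<longleftrightarrow>
     (\<forall>p. g p (X p) (X p) = 1 \<and> g p (Y p) (Y p) = 1 \<and> g p (Z p) (Z p) = 1 \<and>
          g p (X p) (Y p) = 0 \<and> g p (Y p) (Z p) = 0 \<and> g p (Z p) (X p) = 0)"


section \<open>Paths and their velocities\<close>

text \<open>
  The usual $\varepsilon$-$\delta$ definition; \<open>D\<close> runs over the finite families of
  non-overlapping closed subintervals of \<open>{a..b}\<close>.
\<close>

definition abs_continuous_on :: "real \<Rightarrow> real \<Rightarrow> (real \<Rightarrow> 'b::real_normed_vector) \<Rightarrow> bool" where
  "abs_continuous_on a b h \<longleftrightarrow>
     (\<forall>\<epsilon>>0. \<exists>\<delta>>0. \<forall>D T. D division_of T \<and> T \<subseteq> {a..b} \<and> (\<Sum>I\<in>D. Sup I - Inf I) < \<delta> \<longrightarrow>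
        (\<Sum>I\<in>D. norm (h (Sup I) - h (Inf I))) < \<epsilon>)"

definition abs_continuous_path ::
  "('a::{t2_space,second_countable_topology}, 'b::euclidean_space) chart set
     \<Rightarrow> real \<Rightarrow> real \<Rightarrow> (real \<Rightarrow> 'a) \<Rightarrow> bool" where
  "abs_continuous_path A a b \<gamma> \<longleftrightarrow>
     continuous_on {a..b} \<gamma> \<and>
     (\<forall>c\<in>A. \<forall>a' b'. {a'..b'} \<subseteq> {a..b} \<and> \<gamma> ` {a'..b'} \<subseteq> fst c \<longrightarrow>
        abs_continuous_on a' b' (snd c \<circ> \<gamma>))"

definition path_differentiable ::
  "('a, 'b::euclidean_space) chart set \<Rightarrow> real set \<Rightarrow> (real \<Rightarrow> 'a) \<Rightarrow> real \<Rightarrow> bool" where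
  "path_differentiable A S \<gamma> s \<longleftrightarrow>
     (\<forall>c\<in>charts_at A (\<gamma> s). (snd c \<circ> \<gamma>) differentiable (at s within S))"

definition velocity ::
  "('a, 'b::euclidean_space) chart set \<Rightarrow> real set \<Rightarrow> (real \<Rightarrow> 'a) \<Rightarrow> real \<Rightarrow> ('a, 'b) tvec" where
  "velocity A S \<gamma> s = (\<lambda>c. if c \<in> charts_at A (\<gamma> s)
     then vector_derivative (snd c \<circ> \<gamma>) (at s within S) else 0)"

definition path_len ::
  "('a, 'b::euclidean_space) chart set \<Rightarrow> ('a, 'b) metric \<Rightarrow> real \<Rightarrow> real \<Rightarrow> (real \<Rightarrow> 'a) \<Rightarrow> real" where
  "path_len A g a b \<gamma> = integral {a..b} (\<lambda>s. tnorm g (\<gamma> s) (velocity A {a..b} \<gamma> s))"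


section \<open>Anosov flows\<close>

definition smooth_flow ::
  "('a::{t2_space,second_countable_topology}, 'b::euclidean_space) chart set
     \<Rightarrow> (real \<Rightarrow> 'a \<Rightarrow> 'a) \<Rightarrow> bool" where
  "smooth_flow A f \<longleftrightarrow>
     (\<forall>p. f 0 p = p) \<and> (\<forall>s t p. f (s + t) p = f s (f t p)) \<and>
     continuous_on UNIV (\<lambda>(t, p). f t p) \<and>
     (\<forall>c\<in>A. \<forall>c'\<in>A. smooth_map_on (\<lambda>(t, u). snd c' (f t (chart_inv c u)))
        {(t, u). u \<in> snd c ` fst c \<and> f t (chart_inv c u) \<in> fst c'})"

definition flow_generator ::
  "('a, 'b::euclidean_space) chart set \<Rightarrow> (real \<Rightarrow> 'a \<Rightarrow> 'a) \<Rightarrow> 'a \<Rightarrow> ('a, 'b) tvec" where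
  "flow_generator A f p = velocity A UNIV (\<lambda>t. f t p) 0"

type_synonym ('a, 'b) tbundle = "'a \<Rightarrow> ('a, 'b) tvec set"

definition tangent_splitting ::
  "('a, 'b::euclidean_space) chart set
     \<Rightarrow> ('a, 'b) tbundle \<Rightarrow> ('a, 'b) tbundle \<Rightarrow> ('a, 'b) tbundle \<Rightarrow> bool" where
  "tangent_splitting A Ess Ec Euu \<longleftrightarrow>
     (\<forall>p. subspace (Ess p) \<and> subspace (Ec p) \<and> subspace (Euu p) \<and>
          Ess p \<subseteq> tangent_space A p \<and> Ec p \<subseteq> tangent_space A p \<and> Euu p \<subseteq> tangent_space A p \<and>
          (\<forall>v\<in>tangent_space A p. \<exists>!w. w \<in> Ess p \<times> Ec p \<times> Euu p \<and>
             v = fst w + fst (snd w) + snd (snd w)))"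

definition invariant_bundle ::
  "('a, 'b::euclidean_space) chart set \<Rightarrow> (real \<Rightarrow> 'a \<Rightarrow> 'a) \<Rightarrow> ('a, 'b) tbundle \<Rightarrow> bool" where
  "invariant_bundle A f E \<longleftrightarrow> (\<forall>t p. tangent_map A (f t) p ` E p = E (f t p))"

text \<open>
  \<open>f\<close> is an Anosov flow on the manifold with metric \<open>g\<^sub>0\<close>, with strong stable, center and strong
  unstable bundles \<open>Ess\<close>, \<open>Ec\<close>, \<open>Euu\<close>.
\<close>

definition anosov_flow ::
  "('a::{t2_space,second_countable_topology}, 'b::euclidean_space) chart set
     \<Rightarrow> ('a, 'b) metric \<Rightarrow> (real \<Rightarrow> 'a \<Rightarrow> 'a)
     \<Rightarrow> ('a, 'b) tbundle \<Rightarrow> ('a, 'b) tbundle \<Rightarrow> ('a, 'b) tbundle \<Rightarrow> bool" where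
  "anosov_flow A g\<^sub>0 f Ess Ec Euu \<longleftrightarrow>
     smooth_flow A f \<and> (\<forall>p. flow_generator A f p \<noteq> 0) \<and>
     tangent_splitting A Ess Ec Euu \<and>
     invariant_bundle A f Ess \<and> invariant_bundle A f Ec \<and> invariant_bundle A f Euu \<and>
     (\<forall>p. Ec p = span {flow_generator A f p}) \<and>
     (\<exists>C \<mu>\<^sub>m \<mu>\<^sub>p \<nu>\<^sub>m \<nu>\<^sub>p :: real.
        0 < C \<and> 0 < \<mu>\<^sub>m \<and> \<mu>\<^sub>m \<le> \<mu>\<^sub>p \<and> \<mu>\<^sub>p < 1 \<and> \<nu>\<^sub>m \<le> \<nu>\<^sub>p \<and> 1 < \<nu>\<^sub>m \<and>
        (\<forall>p. \<forall>t\<ge>0.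
          (\<forall>v\<in>Ess p.
             1 / C * \<mu>\<^sub>m powr t * tnorm g\<^sub>0 p v \<le> tnorm g\<^sub>0 (f t p) (tangent_map A (f t) p v) \<and>
             tnorm g\<^sub>0 (f t p) (tangent_map A (f t) p v) \<le> C * \<mu>\<^sub>p powr t * tnorm g\<^sub>0 p v) \<and>
          (\<forall>w\<in>Euu p.
             1 / C * \<nu>\<^sub>m powr t * tnorm g\<^sub>0 p w \<le> tnorm g\<^sub>0 (f t p) (tangent_map A (f t) p w) \<and>
             tnorm g\<^sub>0 (f t p) (tangent_map A (f t) p w) \<le> C * \<nu>\<^sub>p powr t * tnorm g\<^sub>0 p w)))"

text \<open>
  \<open>g\<^sub>0\<close> is the ambient metric of the Riemannian manifold, \<open>g\<close> the $C^1$ metric for which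
  \<open>(X, Y, Z)\<close> is orthonormal.
\<close>

definition special_contact_anosov_flow ::
  "('a::{t2_space,second_countable_topology}, real^3) chart set
     \<Rightarrow> ('a, real^3) metric \<Rightarrow> (real \<Rightarrow> 'a \<Rightarrow> 'a)
     \<Rightarrow> ('a, real^3) tbundle \<Rightarrow> ('a, real^3) tbundle \<Rightarrow> ('a, real^3) tbundle
     \<Rightarrow> ('a, real^3) metric
     \<Rightarrow> ('a \<Rightarrow> ('a, real^3) tvec) \<Rightarrow> ('a \<Rightarrow> ('a, real^3) tvec) \<Rightarrow> ('a \<Rightarrow> ('a, real^3) tvec)
     \<Rightarrow> bool" where
  "special_contact_anosov_flow A g\<^sub>0 f Ess Ec Euu g X Y Z \<longleftrightarrow>
     anosov_flow A g\<^sub>0 f Ess Ec Euu \<and>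
     X = flow_generator A f \<and>
     Ck_riemannian_metric A 1 g \<and>
     Ck_vector_field A 1 X \<and> Ck_vector_field A 1 Y \<and> Ck_vector_field A 1 Z \<and>
     global_frame3 A X Y Z \<and> orthonormal3 g X Y Z \<and>
     (\<forall>p. Ec p = span {X p} \<and> Ess p = span {Y p} \<and> Euu p = span {Z p}) \<and>
     (\<forall>p. lie_bracket A X Y p = Y p \<and> lie_bracket A Y Z p = X p \<and> lie_bracket A Z X p = Z p)"


section \<open>Subriemannian geodesics\<close>

definition su_bundle :: "('a, 'b::real_vector) tbundle \<Rightarrow> ('a, 'b) tbundle \<Rightarrow> ('a, 'b) tbundle" where
  "su_bundle Ess Euu p = {v + w |v w. v \<in> Ess p \<and> w \<in> Euu p}"

definition horizontal_path ::
  "('a::{t2_space,second_countable_topology}, 'b::euclidean_space) chart set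
     \<Rightarrow> ('a, 'b) tbundle \<Rightarrow> ('a, 'b) tbundle \<Rightarrow> real \<Rightarrow> real \<Rightarrow> (real \<Rightarrow> 'a) \<Rightarrow> bool" where
  "horizontal_path A Ess Euu a b \<gamma> \<longleftrightarrow>
     a \<le> b \<and> abs_continuous_path A a b \<gamma> \<and>
     (AE s in lebesgue_on {a..b}. path_differentiable A {a..b} \<gamma> s \<and>
        velocity A {a..b} \<gamma> s \<in> su_bundle Ess Euu (\<gamma> s))"

definition su_geodesic ::
  "('a::{t2_space,second_countable_topology}, 'b::euclidean_space) chart set
     \<Rightarrow> ('a, 'b) metric \<Rightarrow> ('a, 'b) tbundle \<Rightarrow> ('a, 'b) tbundle
     \<Rightarrow> 'a \<Rightarrow> 'a \<Rightarrow> real \<Rightarrow> real \<Rightarrow> (real \<Rightarrow> 'a) \<Rightarrow> bool" where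
  "su_geodesic A g Ess Euu x y a b \<gamma> \<longleftrightarrow>
     horizontal_path A Ess Euu a b \<gamma> \<and> \<gamma> a = x \<and> \<gamma> b = y \<and>
     (\<forall>a' b' \<eta>. horizontal_path A Ess Euu a' b' \<eta> \<and> \<eta> a' = x \<and> \<eta> b' = y \<longrightarrow>
        path_len A g a b \<gamma> \<le> path_len A g a' b' \<eta>)"

definition unit_speed ::
  "('a, 'b::euclidean_space) chart set \<Rightarrow> ('a, 'b) metric \<Rightarrow> real \<Rightarrow> (real \<Rightarrow> 'a) \<Rightarrow> bool" where
  "unit_speed A g l \<gamma> \<longleftrightarrow>
     0 < l \<and> path_len A g 0 l \<gamma> = l \<and>
     (AE s in lebesgue_on {0..l}. tnorm g (\<gamma> s) (velocity A {0..l} \<gamma> s) = 1)"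

text \<open>The component in \<open>E p\<close> of \<open>v\<close> with respect to \<open>E p \<oplus> E' p\<close>.\<close>

definition component_along ::
  "('a, 'b::euclidean_space) tbundle \<Rightarrow> ('a, 'b) tbundle \<Rightarrow> 'a \<Rightarrow> ('a, 'b) tvec \<Rightarrow> ('a, 'b) tvec" where
  "component_along E E' p v = (THE w. w \<in> E p \<and> (\<exists>w'\<in>E' p. v = w + w'))"

definition component_energy ::
  "('a, 'b::euclidean_space) chart set \<Rightarrow> ('a, 'b) metric \<Rightarrow> ('a, 'b) tbundle \<Rightarrow> ('a, 'b) tbundle
     \<Rightarrow> real \<Rightarrow> (real \<Rightarrow> 'a) \<Rightarrow> real" where
  "component_energy A g E E' l \<gamma> =
     1 / l * integral {0..l}
       (\<lambda>s. (tnorm g (\<gamma> s) (component_along E E' (\<gamma> s) (velocity A {0..l} \<gamma> s)))\<^sup>2)"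

definition su_balanced ::
  "('a, 'b::euclidean_space) chart set \<Rightarrow> ('a, 'b) metric \<Rightarrow> ('a, 'b) tbundle \<Rightarrow> ('a, 'b) tbundle
     \<Rightarrow> real \<Rightarrow> (real \<Rightarrow> 'a) \<Rightarrow> bool" where
  "su_balanced A g Ess Euu l \<gamma> \<longleftrightarrow>
     component_energy A g Ess Euu l \<gamma> = component_energy A g Euu Ess l \<gamma>"

end

theory Submission
  imports Defs
begin

text \<open>
  The frame \<open>(X, Y, Z)\<close> has the structure constants of $\mathfrak{sl}_2$, so \<open>M\<close> is locally modelled on
  the group $SL_2$: near every point there is a developing map \<open>D\<close> with values in the unimodular
  matrices which turns \<open>X\<close>, \<open>Y\<close>, \<open>Z\<close> into left-invariant fields. In this picture \<open>f\<^sub>t\<close> is right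
  multiplication by \<open>diag2 t\<close>, the diagonal matrix with entries $e^{t/2}$ and $e^{-t/2}$.

  Let \<open>\<gamma>\<close> be a short unit speed geodesic from \<open>x\<close> to \<open>f\<^sub>t x\<close> with velocity \<open>\<alpha> Y + \<beta> Z\<close>. Normalize
  \<open>D x = 1\<close>. Conjugating \<open>D \<circ> \<gamma>\<close> by \<open>diag2 \<tau>\<close> fixes both end points \<open>1\<close> and \<open>diag2 t\<close> and gives a
  horizontal path with velocity $e^{\tau} \alpha Y + e^{-\tau} \beta Z$, at least as long as \<open>\<gamma>\<close>. The derivative
  of its length at \<open>\<tau> = 0\<close> is $\int \alpha^2 - \beta^2$, which must therefore vanish. An explicit
  horizontal path in $SL_2$ from \<open>1\<close> to \<open>diag2 t\<close> shows that \<open>\<gamma>\<close> is indeed short, hence stays in the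
  domain of \<open>D\<close>, if \<open>t\<close> is small.
\<close>

section \<open>Flat linear connections\<close>

text \<open>Right multiplication by \<open>diag2 (- \<tau>)\<close> is the flow and moves both end
  points; left multiplication by \<open>diag2 \<tau>\<close> moves them back because 1 and
  \<open>diag2 t\<close> lie in the same one-parameter group as \<open>diag2 \<tau>\<close>. This is
  where it matters that the geodesic ends on the orbit of its starting point. Left multiplication
  preserves the frame but need not come from any global map of M, so the variation has to take place
  inside one development: the geodesic must be short and \<tau> small. No regularity theory of
  geodesics enters. They are merely absolutely continuous with controls defined almost everywhere,
  and only minimality against this one explicit family is exploited. The frame is only C^1, so D
  comes from a Frobenius argument that differentiates the coefficients of the connection once. SL_2
  is given no manifold structure: the inverse of D is a C^1 map on an open set of all 2 x 2
  matrices, with determinant 1 as a side condition. Since \<delta> must not depend on x, the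
  constants are chosen uniformly near each point and made global by compactness of M.\<close>

lemma has_derivative_radial_primitive:
  fixes \<alpha> :: "'a::euclidean_space \<Rightarrow> 'a \<Rightarrow>\<^sub>L 'w::euclidean_space"
    and \<alpha>' :: "'a \<Rightarrow> 'a \<Rightarrow>\<^sub>L 'a \<Rightarrow>\<^sub>L 'w"
  assumes B: "B = ball u0 \<epsilon>"
    and der: "\<And>u. u \<in> B \<Longrightarrow> (\<alpha> has_derivative blinfun_apply (\<alpha>' u)) (at u)"
    and cont: "continuous_on B \<alpha>'"
  obtains H' where
    "\<And>u. u \<in> B \<Longrightarrow>
      ((\<lambda>u. integral {0..1} (\<lambda>s. \<alpha> (u0 + s *\<^sub>R (u - u0)) (u - u0))) has_derivative blinfun_apply (H' u)) (at u)"
    "continuous_on B H'"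
    "\<And>u v K. \<lbrakk>u \<in> B;
        \<And>w. w \<in> B \<Longrightarrow> norm (\<alpha>' w v (u - u0) - \<alpha>' w (u - u0) v) \<le> K\<rbrakk>
      \<Longrightarrow> norm (H' u v - \<alpha> u v) \<le> K"
proof -
  define us where "us = (\<lambda>u s. u0 + s *\<^sub>R (u - u0))"
  \<comment> \<open>Derivative in \<open>u\<close> of the integrand
    \<open>\<alpha> (us u s) (u - u0)\<close>: the first summand moves the base point along with the
    ray, the second moves the vector.\<close>
  define fx where "fx = (\<lambda>u s. s *\<^sub>R (blinfun.prod_left (u - u0) o\<^sub>L \<alpha>' (us u s)) + \<alpha> (us u s))"
  have us_B: "us u s \<in> B" if "u \<in> B" "s \<in> {0..1}" for u s
  proof -
    have "norm (s *\<^sub>R (u - u0)) \<le> norm (u - u0)"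
      using that by (auto intro: mult_left_le_one_le)
    then show ?thesis using that unfolding B us_def
      by (auto simp: dist_norm norm_minus_commute)
  qed
  have cont\<alpha>: "continuous_on B \<alpha>"
    using der by (meson has_derivative_continuous continuous_at_imp_continuous_on)
  have convB: "convex B" and openB: "open B" by (auto simp: B)
  have cus: "continuous_on (B \<times> {0..1}) (\<lambda>(u, s). us u s)"
    unfolding us_def split_def by (intro continuous_intros)
  have c\<alpha>: "continuous_on (B \<times> {0..1}) (\<lambda>(u, s). \<alpha> (us u s))"
    using continuous_on_compose2[OF cont\<alpha> cus] us_B by (simp add: split_def image_subset_iff)
  have c\<alpha>': "continuous_on (B \<times> {0..1}) (\<lambda>(u, s). \<alpha>' (us u s))"
    using continuous_on_compose2[OF cont cus] us_B by (simp add: split_def image_subset_iff)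
  have cfx: "continuous_on (B \<times> {0..1}) (\<lambda>(u, s). fx u s)"
    using c\<alpha> c\<alpha>' unfolding fx_def split_def
    by (intro continuous_intros bounded_linear.continuous_on[OF blinfun.bounded_linear_prod_left]
          bounded_bilinear.continuous_on[OF bounded_bilinear_blinfun_compose]) auto
  have slice: "continuous_on {0..1} (F u)" if "continuous_on (B \<times> {0..1}) (\<lambda>(u, s). F u s)" "u \<in> B"
    for F :: "'a \<Rightarrow> real \<Rightarrow> 'z::topological_space" and u
  proof -
    have "continuous_on {0..1} (\<lambda>s. (\<lambda>(u, s). F u s) (u, s))"
      by (rule continuous_on_compose2[OF that(1)]) (auto intro!: continuous_intros simp: that)
    then show ?thesis by simp
  qed
  have D: "((\<lambda>u. integral (cbox 0 1) (\<lambda>s. \<alpha> (us u s) (u - u0))) has_derivative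
        blinfun_apply (integral (cbox 0 1) (fx u))) (at u within B)" if u: "u \<in> B" for u
  proof (rule leibniz_rule)
    fix x t assume x: "x \<in> B" and t: "t \<in> cbox 0 (1::real)"
    have t': "t \<in> {0..1}" using t by simp
    have usd: "((\<lambda>x. us x t) has_derivative (\<lambda>h. t *\<^sub>R h)) (at x)"
      unfolding us_def by (auto intro!: derivative_eq_intros)
    have "((\<lambda>x. \<alpha> (us x t)) has_derivative (\<lambda>h. \<alpha>' (us x t) (t *\<^sub>R h))) (at x)"
      using has_derivative_compose[OF usd der[OF us_B[OF x t']]] by simp
    from bounded_bilinear.FDERIV[OF bounded_bilinear_blinfun_apply this
        has_derivative_diff[OF has_derivative_ident has_derivative_const[of u0]]]
    have "((\<lambda>x. \<alpha> (us x t) (x - u0)) has_derivative blinfun_apply (fx x t)) (at x)"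
      by (rule has_derivative_eq_rhs)
        (auto simp: fx_def fun_eq_iff blinfun.bilinear_simps scaleR_diff_right)
    then show "((\<lambda>x. \<alpha> (us x t) (x - u0)) has_derivative blinfun_apply (fx x t)) (at x within B)"
      by (rule has_derivative_at_withinI)
  next
    fix x assume x: "x \<in> B"
    show "(\<lambda>s. \<alpha> (us x s) (x - u0)) integrable_on cbox 0 1"
      by (auto intro!: integrable_continuous_interval continuous_intros slice[OF c\<alpha> x] simp: box_real)
  qed (use u convB cfx in \<open>auto simp: box_real\<close>)
  have D': "((\<lambda>u. integral {0..1} (\<lambda>s. \<alpha> (us u s) (u - u0))) has_derivative
        blinfun_apply (integral {0..1} (fx u))) (at u)" if u: "u \<in> B" for u
    using D[OF u] at_within_open[OF u openB] by (simp add: box_real)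
  \<comment> \<open>Homotopy formula with remainder: \<open>H' u v - \<alpha> u v\<close> is the
    integral along the ray of \<open>s\<close> times the exterior derivative of
    \<open>\<alpha>\<close> at \<open>v\<close> and \<open>u - u0\<close>. It vanishes for closed
    forms; the bound is kept because Picard iterates yield forms that are only nearly
    closed.\<close>
  have main: "norm (blinfun_apply (integral {0..1} (fx u)) v - \<alpha> u v) \<le> K"
    if u: "u \<in> B" and bound: "\<And>w. w \<in> B \<Longrightarrow> norm (\<alpha>' w v (u - u0) - \<alpha>' w (u - u0) v) \<le> K"
    for u v K
  proof -
    let ?e = "u - u0"
    \<comment> \<open>\<open>s *\<^sub>R \<alpha> (us u s) v\<close> is \<open>\<alpha> u v\<close>
      at the end of the ray and 0 at its start, so \<open>\<alpha> u v\<close> becomes an integral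
      that can be subtracted from \<open>H' u v\<close> under one integral sign.\<close>
    have P: "((\<lambda>s. s *\<^sub>R \<alpha>' (us u s) ?e v + \<alpha> (us u s) v) has_integral
        (1 *\<^sub>R \<alpha> (us u 1) v - 0 *\<^sub>R \<alpha> (us u 0) v)) {0..1}"
    proof (rule fundamental_theorem_of_calculus)
      fix t :: real assume t: "t \<in> {0..1}"
      have usd: "(us u has_derivative (\<lambda>h. h *\<^sub>R ?e)) (at t within {0..1})"
        unfolding us_def by (auto intro!: derivative_eq_intros)
      have "((\<lambda>x. \<alpha> (us u x)) has_derivative (\<lambda>h. \<alpha>' (us u t) (h *\<^sub>R ?e))) (at t within {0..1})"
        using has_derivative_compose[OF usd der[OF us_B[OF u t]]] by simp
      from bounded_bilinear.FDERIV[OF bounded_bilinear_scaleR has_derivative_ident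
         bounded_bilinear.FDERIV[OF bounded_bilinear_blinfun_apply this has_derivative_const[of v]]]
      show "((\<lambda>s. s *\<^sub>R \<alpha> (us u s) v) has_vector_derivative
          t *\<^sub>R \<alpha>' (us u t) ?e v + \<alpha> (us u t) v) (at t within {0..1})"
        unfolding has_vector_derivative_def
        by (rule has_derivative_eq_rhs)
          (auto simp: fun_eq_iff blinfun.bilinear_simps algebra_simps)
    qed simp
    have "((\<lambda>s. fx u s v) has_integral blinfun_apply (integral {0..1} (fx u)) v) {0..1}"
      using has_integral_linear[OF integrable_integral[OF integrable_continuous_interval[OF slice[OF cfx u]]]
        bounded_linear_apply_blinfun, of v]
      by (simp add: o_def)
    from has_integral_diff[OF this P]
    have "((\<lambda>s. s *\<^sub>R (\<alpha>' (us u s) v ?e - \<alpha>' (us u s) ?e v)) has_integral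
        (blinfun_apply (integral {0..1} (fx u)) v - \<alpha> u v)) {0..1}"
      by (simp add: fx_def blinfun.bilinear_simps us_def algebra_simps)
    moreover have "norm (s *\<^sub>R (\<alpha>' (us u s) v ?e - \<alpha>' (us u s) ?e v)) \<le> K"
      if s: "s \<in> {0..1}" for s
    proof -
      have "norm (s *\<^sub>R (\<alpha>' (us u s) v ?e - \<alpha>' (us u s) ?e v))
          \<le> norm (\<alpha>' (us u s) v ?e - \<alpha>' (us u s) ?e v)"
        using s by (auto intro: mult_left_le_one_le)
      also have "\<dots> \<le> K" by (rule bound[OF us_B[OF u s]])
      finally show ?thesis .
    qed
    moreover have "0 \<le> K"
      using bound[OF u] norm_ge_zero order_trans by blast
    ultimately have "norm (blinfun_apply (integral {0..1} (fx u)) v - \<alpha> u v)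
        \<le> K * measure lborel (cbox 0 (1::real))"
      by (intro has_integral_bound) (auto simp: box_real)
    then show ?thesis by simp
  qed
  have cont_int: "continuous_on B (\<lambda>u. integral {0..1} (fx u))"
    using integral_continuous_on_param[of B 0 1 fx] cfx by (simp add: box_real)
  show ?thesis
    by (rule that[OF _ cont_int main]) (use D' in \<open>simp add: us_def\<close>)
qed

text \<open>
  Picard iteration along the rays through \<open>u0\<close>. By the homotopy formula of the Poincare lemma and
  flatness, the defect $dr_n - \theta r_n$ of the iterates tends to 0 uniformly, so the limit solves the
  equation in all directions and not only in the radial one.
\<close>

theorem flat_connection_local_solution:
  fixes \<theta> :: "'a::euclidean_space \<Rightarrow> 'a \<Rightarrow>\<^sub>L 'w::euclidean_space \<Rightarrow>\<^sub>L 'w"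
    and \<theta>' :: "'a \<Rightarrow> 'a \<Rightarrow>\<^sub>L 'a \<Rightarrow>\<^sub>L 'w \<Rightarrow>\<^sub>L 'w"
  assumes "open U" "u0 \<in> U"
    and der: "\<And>u. u \<in> U \<Longrightarrow> (\<theta> has_derivative blinfun_apply (\<theta>' u)) (at u)"
    and cont: "continuous_on U \<theta>'"
    and flat: "\<And>u h v w. u \<in> U \<Longrightarrow>
      \<theta>' u h v w + \<theta> u v (\<theta> u h w) = \<theta>' u v h w + \<theta> u h (\<theta> u v w)"
  obtains \<epsilon> r where "0 < \<epsilon>" "ball u0 \<epsilon> \<subseteq> U" "r u0 = r0"
    "\<And>u. u \<in> ball u0 \<epsilon> \<Longrightarrow> (r has_derivative (\<lambda>v. \<theta> u v (r u))) (at u)"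
proof -
  obtain R where R: "R > 0" "cball u0 R \<subseteq> U"
    using \<open>open U\<close> \<open>u0 \<in> U\<close> open_contains_cball by blast
  have cont\<theta>: "continuous_on U \<theta>"
    using der by (meson has_derivative_continuous continuous_at_imp_continuous_on)
  have "compact (\<theta> ` cball u0 R)"
    by (intro compact_continuous_image continuous_on_subset[OF cont\<theta> R(2)] compact_cball)
  then obtain C where C: "C > 0" "\<And>u. u \<in> cball u0 R \<Longrightarrow> norm (\<theta> u) \<le> C"
    using compact_imp_bounded[of "\<theta> ` cball u0 R"] unfolding bounded_pos by auto
  \<comment> \<open>This radius gives \<open>C * norm (u - u0) \<le> 1/4\<close> on
    \<open>B\<close>. The defect estimate has two such terms, so a Picard step halves the defect,
    while the distance of two maps shrinks by 1/4.\<close>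
  define \<epsilon> where "\<epsilon> = min R (1 / (4 * C))"
  define B where "B = ball u0 \<epsilon>"
  have \<epsilon>: "\<epsilon> > 0" "C * \<epsilon> \<le> 1/4"
    using R C mult_left_mono[of \<epsilon> "1 / (4*C)" C] by (auto simp: \<epsilon>_def)
  have BU: "B \<subseteq> U" and BR: "B \<subseteq> cball u0 R"
    using R by (auto simp: B_def \<epsilon>_def)
  have convB: "convex B" and openB: "open B" and u0B: "u0 \<in> B" using \<epsilon> by (auto simp: B_def)
  have \<theta>_le: "norm (\<theta> u v w) \<le> C * norm v * norm w" if "u \<in> B" for u v w
  proof -
    have "norm (\<theta> u v w) \<le> norm (\<theta> u v) * norm w" by (rule norm_blinfun)
    also have "\<dots> \<le> (norm (\<theta> u) * norm v) * norm w"
      by (intro mult_right_mono norm_blinfun) auto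
    also have "\<dots> \<le> C * norm v * norm w"
      using C(2) that BR by (intro mult_right_mono) auto
    finally show ?thesis .
  qed
  have e_le: "C * norm (u - u0) \<le> 1/4" if "u \<in> B" for u
  proof -
    have "C * norm (u - u0) \<le> C * \<epsilon>"
      using that C(1) by (intro mult_left_mono) (auto simp: B_def dist_norm norm_minus_commute)
    with \<epsilon>(2) show ?thesis by linarith
  qed
  have us_B: "u0 + s *\<^sub>R (u - u0) \<in> B" if "u \<in> B" "s \<in> {0..1}" for u s
    using convexD_alt[OF convB u0B that(1), of s] that(2) by (simp add: algebra_simps)

  define Pic where "Pic = (\<lambda>r u. r0 + integral {0..1}
      (\<lambda>s. \<theta> (u0 + s *\<^sub>R (u - u0)) (u - u0) (r (u0 + s *\<^sub>R (u - u0)))))"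
  have step: "\<exists>q'. (\<forall>u\<in>B. (Pic r has_derivative blinfun_apply (q' u)) (at u)) \<and> continuous_on B q' \<and>
      (\<forall>u\<in>B. \<forall>v. norm (q' u v - \<theta> u v (r u)) \<le> M / 2 * norm v)"
    if r: "\<And>u. u \<in> B \<Longrightarrow> (r has_derivative blinfun_apply (r' u)) (at u)"
      and r': "continuous_on B r'"
      and M: "\<And>u v. u \<in> B \<Longrightarrow> norm (r' u v - \<theta> u v (r u)) \<le> M * norm v"
    for r :: "'a \<Rightarrow> 'w" and r' :: "'a \<Rightarrow> 'a \<Rightarrow>\<^sub>L 'w" and M
  proof -
    have M0: "0 \<le> M"
    proof -
      obtain b :: 'a where "b \<in> Basis" using nonempty_Basis by blast
      then show ?thesis using order_trans[OF norm_ge_zero M[OF u0B, of b]] by simp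
    qed
    \<comment> \<open>\<open>eval w\<close> is evaluation of operators at \<open>w\<close>. It turns
      \<open>\<lambda>v. \<theta> u v (r u)\<close> into a composition of operator-valued maps, to
      which the bilinear product rule applies.\<close>
    define eval where "eval = Blinfun (\<lambda>w::'w. (blinfun.prod_left w :: ('w \<Rightarrow>\<^sub>L 'w) \<Rightarrow>\<^sub>L 'w))"
    have eval[simp]: "blinfun_apply eval = blinfun.prod_left"
      unfolding eval_def by (rule bounded_linear_Blinfun_apply[OF blinfun.bounded_linear_prod_left])
    interpret co: bounded_bilinear "(o\<^sub>L) :: (('w \<Rightarrow>\<^sub>L 'w) \<Rightarrow>\<^sub>L 'w) \<Rightarrow> ('a \<Rightarrow>\<^sub>L 'w \<Rightarrow>\<^sub>L 'w) \<Rightarrow> 'a \<Rightarrow>\<^sub>L 'w"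
      by (rule bounded_bilinear_blinfun_compose)
    define \<alpha> where "\<alpha> = (\<lambda>u. blinfun.prod_left (r u) o\<^sub>L \<theta> u)"
    define \<alpha>' where "\<alpha>' = (\<lambda>u. (co.prod_left (\<theta> u) o\<^sub>L (eval o\<^sub>L r' u))
        + (co.prod_right (blinfun.prod_left (r u)) o\<^sub>L \<theta>' u))"
    have \<alpha>'_apply: "\<alpha>' u h v = \<theta> u v (r' u h) + \<theta>' u h v (r u)" for u h v
      by (simp add: \<alpha>'_def blinfun.bilinear_simps)
    have contr: "continuous_on B r"
      using r by (meson has_derivative_continuous continuous_at_imp_continuous_on)
    obtain H' where H': "\<And>u. u \<in> B \<Longrightarrow>
      ((\<lambda>u. integral {0..1} (\<lambda>s. \<alpha> (u0 + s *\<^sub>R (u - u0)) (u - u0))) has_derivative blinfun_apply (H' u)) (at u)"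
      and contH': "continuous_on B H'"
      and bound: "\<And>u v K. \<lbrakk>u \<in> B;
        \<And>w. w \<in> B \<Longrightarrow> norm (\<alpha>' w v (u - u0) - \<alpha>' w (u - u0) v) \<le> K\<rbrakk>
      \<Longrightarrow> norm (H' u v - \<alpha> u v) \<le> K"
    proof (rule has_derivative_radial_primitive[OF B_def, of \<alpha> \<alpha>'])
      fix u assume u: "u \<in> B"
      have "((\<lambda>u. eval (r u)) has_derivative (\<lambda>h. eval (r' u h))) (at u)"
        by (rule bounded_linear.has_derivative[OF blinfun.bounded_linear_right r[OF u]])
      from bounded_bilinear.FDERIV[OF bounded_bilinear_blinfun_compose this der] u BU
      have "((\<lambda>x. eval (r x) o\<^sub>L \<theta> x) has_derivative (\<lambda>h. (eval (r u) o\<^sub>L \<theta>' u h) +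
          (eval (r' u h) o\<^sub>L \<theta> u))) (at u)" by blast
      then show "(\<alpha> has_derivative blinfun_apply (\<alpha>' u)) (at u)"
        unfolding \<alpha>_def
        by (simp add: \<alpha>'_def fun_eq_iff blinfun.bilinear_simps has_derivative_eq_rhs add.commute)
    next
      show "continuous_on B \<alpha>'"
        unfolding \<alpha>'_def
        by (intro continuous_intros continuous_on_subset[OF cont BU] continuous_on_subset[OF cont\<theta> BU] r' contr
          bounded_linear.continuous_on[OF blinfun.bounded_linear_prod_left]
          bounded_linear.continuous_on[OF co.bounded_linear_prod_left]
          bounded_linear.continuous_on[OF co.bounded_linear_prod_right]
          bounded_bilinear.continuous_on[OF bounded_bilinear_blinfun_compose])
    qed blast
    have Pic_eq: "Pic r = (\<lambda>u. r0 + integral {0..1} (\<lambda>s. \<alpha> (u0 + s *\<^sub>R (u - u0)) (u - u0)))"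
      by (simp add: Pic_def \<alpha>_def)
    have "norm (H' u v - \<theta> u v (r u)) \<le> M / 2 * norm v" if u: "u \<in> B" for u v
    proof -
      have "norm (\<alpha>' w v (u - u0) - \<alpha>' w (u - u0) v) \<le> M / 2 * norm v" if w: "w \<in> B" for w
      proof -
        let ?e = "u - u0" and ?\<rho> = "\<lambda>v. r' w v - \<theta> w v (r w)"
        \<comment> \<open>After splitting the derivative of \<open>r\<close> as \<theta> applied to
          \<open>r\<close> plus the defect \<open>?\<rho>\<close>, all terms without
          \<open>?\<rho>\<close> cancel by flatness. So the exterior derivative is controlled by the
          old defect.\<close>
        have "\<alpha>' w v ?e - \<alpha>' w ?e v = \<theta> w ?e (?\<rho> v) - \<theta> w v (?\<rho> ?e)"
          using flat[of w v ?e "r w"] w BU by (auto simp: \<alpha>'_apply blinfun.bilinear_simps algebra_simps)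
        also have "norm \<dots> \<le> norm (\<theta> w ?e (?\<rho> v)) + norm (\<theta> w v (?\<rho> ?e))"
          by (rule norm_triangle_ineq4)
        also have "\<dots> \<le> C * norm ?e * (M * norm v) + C * norm v * (M * norm ?e)"
          using C(1) by (intro add_mono order_trans[OF \<theta>_le[OF w]] mult_left_mono M w) auto
        also have "\<dots> = 2 * (C * norm ?e) * (M * norm v)" by simp
        also have "\<dots> \<le> 2 * (1/4) * (M * norm v)"
          using e_le[OF u] M0 by (intro mult_right_mono mult_left_mono) auto
        finally show ?thesis by simp
      qed
      from bound[OF u this] show ?thesis by (simp add: \<alpha>_def)
    qed
    moreover have "(Pic r has_derivative blinfun_apply (H' u)) (at u)" if "u \<in> B" for u
      using has_derivative_add[OF has_derivative_const[of r0] H'[OF that]] unfolding Pic_eq by simp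
    ultimately show ?thesis using contH' by blast
  qed

  have Pic_diff: "norm (Pic r u - Pic q u) \<le> K / 4"
    if "continuous_on B r" "continuous_on B q" "\<And>u. u \<in> B \<Longrightarrow> norm (r u - q u) \<le> K" "u \<in> B" for r q K u
  proof -
    have us: "continuous_on {0..1} (\<lambda>s. u0 + s *\<^sub>R (u - u0))" by (intro continuous_intros)
    have int: "(\<lambda>s. \<theta> (u0 + s *\<^sub>R (u - u0)) (u - u0) (r (u0 + s *\<^sub>R (u - u0)))) integrable_on {0..1}"
      if "continuous_on B r" for r
      by (intro integrable_continuous_interval continuous_intros
        continuous_on_compose2[OF that us] continuous_on_compose2[OF continuous_on_subset[OF cont\<theta> BU] us])
       (use us_B \<open>u \<in> B\<close> in auto)
    have "Pic r u - Pic q u = integral {0..1} (\<lambda>s. \<theta> (u0 + s *\<^sub>R (u - u0)) (u - u0)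
        (r (u0 + s *\<^sub>R (u - u0)) - q (u0 + s *\<^sub>R (u - u0))))"
      unfolding Pic_def using that int by (simp add: integral_diff blinfun.bilinear_simps)
    also have "norm \<dots> \<le> K / 4 * (1 - 0)"
    proof (rule integral_bound)
      fix s :: real assume s: "s \<in> {0..1}"
      let ?us = "u0 + s *\<^sub>R (u - u0)"
      have "norm (\<theta> ?us (u - u0) (r ?us - q ?us)) \<le> C * norm (u - u0) * norm (r ?us - q ?us)"
        by (rule \<theta>_le[OF us_B[OF \<open>u \<in> B\<close> s]])
      also have "\<dots> \<le> 1/4 * K"
        using C(1) by (intro mult_mono e_le that us_B s) auto
      finally show "norm (\<theta> ?us (u - u0) (r ?us - q ?us)) \<le> K / 4" by simp
    qed (auto intro!: continuous_intros continuous_on_compose2[OF that(1) us]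
        continuous_on_compose2[OF that(2) us] continuous_on_compose2[OF continuous_on_subset[OF cont\<theta> BU] us]
        us_B \<open>u \<in> B\<close>)
    finally show ?thesis by simp
  qed

  define rn where "rn = (\<lambda>n. (Pic ^^ n) (\<lambda>_. r0))"
  have rn_Suc: "rn (Suc n) = Pic (rn n)" for n by (simp add: rn_def)
  define K where "K = norm r0"
  \<comment> \<open>A Picard step turns the defect bound \<open>M * (n + 1) / 2 ^ n\<close> into its
    half plus \<open>C * K / 2 ^ n\<close>; for \<open>M = 2 * C * K\<close> the sum is exactly
    \<open>M * (n + 2) / 2 ^ (n + 1)\<close>. The linear factor does not prevent convergence to
    0.\<close>
  define M where "M = 2 * C * K"
  have K: "K \<ge> 0" by (simp add: K_def)
  have "\<exists>r'. (\<forall>u\<in>B. (rn n has_derivative blinfun_apply (r' u)) (at u)) \<and> continuous_on B r' \<and>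
      (\<forall>u\<in>B. \<forall>v. norm (r' u v - \<theta> u v (rn n u)) \<le> M * (n + 1) / 2 ^ n * norm v) \<and>
      (\<forall>u\<in>B. norm (rn (Suc n) u - rn n u) \<le> K / 2 ^ n)" for n
  proof (induction n)
    case 0
    have "norm (rn (Suc 0) u - rn 0 u) \<le> K / 2 ^ 0" if u: "u \<in> B" for u
    proof -
      have "Pic (\<lambda>_. 0) = (\<lambda>_. r0)" by (simp add: Pic_def blinfun.bilinear_simps)
      then have "rn (Suc 0) u - rn 0 u = Pic (\<lambda>_. r0) u - Pic (\<lambda>_. 0) u" by (simp add: rn_def)
      also have "norm \<dots> \<le> K / 4" by (rule Pic_diff[OF _ _ _ u]) (auto simp: K_def)
      finally show ?thesis using K by simp
    qed
    moreover have "norm (\<theta> u v r0) \<le> M * norm v" if "u \<in> B" for u v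
    proof -
      have "norm (\<theta> u v r0) \<le> C * norm v * K" using \<theta>_le[OF that] by (simp add: K_def)
      also have "\<dots> \<le> M * norm v" using C(1) K unfolding M_def by (simp add: mult_ac)
      finally show ?thesis .
    qed
    ultimately show ?case
      by (intro exI[of _ "\<lambda>_. 0"]) (auto simp: rn_def blinfun.bilinear_simps)
  next
    case (Suc n)
    then obtain r' where r': "\<And>u. u \<in> B \<Longrightarrow> (rn n has_derivative blinfun_apply (r' u)) (at u)"
      "continuous_on B r'"
      "\<And>u v. u \<in> B \<Longrightarrow> norm (r' u v - \<theta> u v (rn n u)) \<le> M * (n + 1) / 2 ^ n * norm v"
      "\<And>u. u \<in> B \<Longrightarrow> norm (rn (Suc n) u - rn n u) \<le> K / 2 ^ n" by blast
    from step[OF r'(1-3)] obtain q' where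
      q': "\<And>u. u \<in> B \<Longrightarrow> (rn (Suc n) has_derivative blinfun_apply (q' u)) (at u)" "continuous_on B q'"
        "\<And>u v. u \<in> B \<Longrightarrow> norm (q' u v - \<theta> u v (rn n u)) \<le> M * (n + 1) / 2 ^ n / 2 * norm v"
      unfolding rn_Suc by blast
    have "norm (q' u v - \<theta> u v (rn (Suc n) u)) \<le> M * real (Suc n + 1) / 2 ^ Suc n * norm v"
      if u: "u \<in> B" for u v
    proof -
      have "q' u v - \<theta> u v (rn (Suc n) u)
          = (q' u v - \<theta> u v (rn n u)) - \<theta> u v (rn (Suc n) u - rn n u)"
        by (simp add: blinfun.bilinear_simps)
      also have "norm \<dots> \<le> norm (q' u v - \<theta> u v (rn n u)) + norm (\<theta> u v (rn (Suc n) u - rn n u))"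
        by (rule norm_triangle_ineq4)
      also have "\<dots> \<le> M * (n + 1) / 2 ^ n / 2 * norm v + C * norm v * (K / 2 ^ n)"
        using C(1) by (intro add_mono q'(3) u order_trans[OF \<theta>_le[OF u]] mult_left_mono r'(4)) auto
      also have "\<dots> = M * real (Suc n + 1) / 2 ^ Suc n * norm v"
        by (simp add: M_def field_simps)
      finally show ?thesis .
    qed
    moreover have "norm (rn (Suc (Suc n)) u - rn (Suc n) u) \<le> K / 2 ^ Suc n" if u: "u \<in> B" for u
    proof -
      have "continuous_on B (rn n)" "continuous_on B (rn (Suc n))"
        using r'(1) q'(1) by (meson has_derivative_continuous continuous_at_imp_continuous_on)+
      from Pic_diff[OF this(2,1) r'(4) u] have "norm (rn (Suc (Suc n)) u - rn (Suc n) u) \<le> K / 2 ^ n / 4"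
        by (simp add: rn_Suc)
      also have "\<dots> \<le> K / 2 ^ Suc n" using K by (simp add: divide_simps)
      finally show ?thesis .
    qed
    ultimately show ?case using q'(1,2) by (intro exI[of _ q'] conjI ballI allI)
  qed
  then obtain r' where r'_all: "\<And>n. (\<forall>u\<in>B. (rn n has_derivative blinfun_apply (r' n u)) (at u)) \<and> continuous_on B (r' n) \<and>
      (\<forall>u\<in>B. \<forall>v. norm (r' n u v - \<theta> u v (rn n u)) \<le> M * (n + 1) / 2 ^ n * norm v) \<and>
      (\<forall>u\<in>B. norm (rn (Suc n) u - rn n u) \<le> K / 2 ^ n)"
    by (atomize_elim, intro choice allI)
  then have r': "\<And>n u. u \<in> B \<Longrightarrow> (rn n has_derivative blinfun_apply (r' n u)) (at u)"
      and defect: "\<And>n u v. u \<in> B \<Longrightarrow> norm (r' n u v - \<theta> u v (rn n u)) \<le> M * (n + 1) / 2 ^ n * norm v"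
      and diff: "\<And>n u. u \<in> B \<Longrightarrow> norm (rn (Suc n) u - rn n u) \<le> K / 2 ^ n"
    by blast+
  define r where "r = (\<lambda>u. r0 + (\<Sum>n. rn (Suc n) u - rn n u))"
  have tele: "r0 + (\<Sum>i<n. rn (Suc i) u - rn i u) = rn n u" for n u
    by (subst sum_lessThan_telescope) (simp add: rn_def)
  have "uniform_limit B (\<lambda>n u. \<Sum>i<n. rn (Suc i) u - rn i u) (\<lambda>u. \<Sum>n. rn (Suc n) u - rn n u) sequentially"
  proof (rule Weierstrass_m_test)
    show "norm (rn (Suc n) u - rn n u) \<le> K * (1/2) ^ n" if "u \<in> B" for n u
      using diff[OF that, of n] by (simp add: power_divide)
  qed (auto intro!: summable_mult)
  from uniform_limit_add[OF uniform_limit_const this, of "\<lambda>_. r0"]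
  have lim: "uniform_limit B rn r sequentially"
    by (simp add: tele r_def[abs_def])
  \<comment> \<open>The hypothesis for differentiating the limit: the derivatives of the iterates
    converge uniformly, to a limit expressed through \<open>r\<close> itself, as both the defect and
    \<open>rn n - r\<close> tend to 0 uniformly.\<close>
  have ev: "\<forall>\<^sub>F n in sequentially. \<forall>u\<in>B. \<forall>h. norm (r' n u h - \<theta> u h (r u)) \<le> e * norm h" if "e > 0" for e
  proof -
    have "(\<lambda>n. M * real (n + 1) / 2 ^ n) \<longlonglongrightarrow> 0"
    proof -
      have "(\<lambda>n. real n / 2 ^ n) \<longlonglongrightarrow> 0" using lim_n_over_pown[of "2::real"] by simp
      moreover have "(\<lambda>n. 1 / 2 ^ n :: real) \<longlonglongrightarrow> 0"
        using LIMSEQ_divide_realpow_zero[of 2 1] by simp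
      ultimately have "(\<lambda>n. M * (real n / 2 ^ n + 1 / 2 ^ n)) \<longlonglongrightarrow> M * (0 + 0)"
        by (intro tendsto_intros)
      then show ?thesis by (simp add: field_simps)
    qed
    then have "\<forall>\<^sub>F n in sequentially. M * real (n + 1) / 2 ^ n < e / 2"
      by (rule order_tendstoD) (use that in simp)
    moreover have "\<forall>\<^sub>F n in sequentially. \<forall>u\<in>B. dist (rn n u) (r u) < e / (2 * C)"
      using uniform_limitD[OF lim, of "e / (2 * C)"] that C(1) by simp
    ultimately show ?thesis
    proof eventually_elim
      case (elim n)
      show ?case
      proof (intro ballI allI)
        fix u h assume u: "u \<in> B"
        have "r' n u h - \<theta> u h (r u) = (r' n u h - \<theta> u h (rn n u)) + \<theta> u h (rn n u - r u)"
          by (simp add: blinfun.bilinear_simps)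
        also have "norm \<dots> \<le> norm (r' n u h - \<theta> u h (rn n u)) + norm (\<theta> u h (rn n u - r u))"
          by (rule norm_triangle_ineq)
        also have "\<dots> \<le> e / 2 * norm h + C * norm h * (e / (2 * C))"
          using elim u C(1)
          by (intro add_mono order_trans[OF defect[OF u]] order_trans[OF \<theta>_le[OF u]] mult_left_mono
              mult_right_mono) (auto simp: dist_norm less_imp_le)
        also have "\<dots> = e * norm h" using C(1) by (simp add: field_simps)
        finally show "norm (r' n u h - \<theta> u h (r u)) \<le> e * norm h" .
      qed
    qed
  qed
  have "rn n u0 = r0" for n
    by (cases n) (auto simp: rn_Suc Pic_def blinfun.bilinear_simps, simp add: rn_def)
  then have lim0: "(\<lambda>n. rn n u0) \<longlonglongrightarrow> r0" by simp
  obtain g where g: "\<And>u. u \<in> B \<Longrightarrow> (\<lambda>n. rn n u) \<longlonglongrightarrow> g u"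
    "\<And>u. u \<in> B \<Longrightarrow> (g has_derivative (\<lambda>v. \<theta> u v (r u))) (at u within B)"
    using has_derivative_sequence[OF convB has_derivative_at_withinI[OF r'] ev u0B lim0] by blast
  have gr: "g u = r u" if "u \<in> B" for u
    using LIMSEQ_unique[OF g(1)[OF that] tendsto_uniform_limitI[OF lim that]] .
  show ?thesis
  proof (rule that[OF \<epsilon>(1), of g])
    show "g u0 = r0" using LIMSEQ_unique[OF g(1)[OF u0B] lim0] .
  qed (use BU g(2) gr at_within_open[OF _ openB] in \<open>auto simp: B_def\<close>)
qed

section \<open>Developing maps of frames with the brackets of $\mathfrak{sl}_2$\<close>

text \<open>In the product rule the derivative of \<open>G\<close> would be paired with
  \<open>H u = 0\<close>. Continuity of \<open>G\<close> is enough, since \<open>H x\<close> is of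
  order \<open>x - u\<close> and \<open>G x - G u\<close> tends to 0. This allows an inverse to be
  differentiated before it is known to be differentiable.\<close>

lemma (in bounded_bilinear) has_derivative_prod_vanishing:
  assumes G: "isCont G u" and H: "(H has_derivative H') (at u)" and 0: "H u = 0"
  shows "((\<lambda>x. prod (G x) (H x)) has_derivative (\<lambda>h. prod (G u) (H' h))) (at u)"
proof -
  obtain K where K: "K > 0" "\<And>a b. norm (prod a b) \<le> norm a * norm b * K"
    using pos_bounded by blast
  interpret H': bounded_linear H' by (rule has_derivative_bounded_linear[OF H])
  obtain C where C: "\<And>h. norm (H' h) \<le> norm h * C" using H'.bounded by blast
  have lin: "((\<lambda>x. prod (G u) (H x)) has_derivative (\<lambda>h. prod (G u) (H' h))) (at u)"
    by (rule bounded_linear.has_derivative[OF bounded_linear_right H])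
  have "((\<lambda>x. prod (G x - G u) (H x)) has_derivative (\<lambda>h. 0)) (at u)"
    unfolding has_derivative_iff_norm
  proof (intro conjI)
    have "((\<lambda>x. norm (G x - G u) * (norm (H x - H u - H' (x - u)) / norm (x - u) + C) * K)
        \<longlongrightarrow> norm (G u - G u) * (0 + C) * K) (at u)"
      using G H unfolding isCont_def has_derivative_iff_norm by (intro tendsto_intros) auto
    then have lim: "((\<lambda>x. norm (G x - G u) * (norm (H x - H u - H' (x - u)) / norm (x - u) + C) * K)
        \<longlongrightarrow> 0) (at u)" by simp
    show "((\<lambda>x. norm (prod (G x - G u) (H x) - prod (G u - G u) (H u) - 0) / norm (x - u)) \<longlongrightarrow> 0) (at u)"
    proof (rule Lim_null_comparison[OF _ lim])
      show "\<forall>\<^sub>F x in at u. norm (norm (prod (G x - G u) (H x) - prod (G u - G u) (H u) - 0) / norm (x - u))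
          \<le> norm (G x - G u) * (norm (H x - H u - H' (x - u)) / norm (x - u) + C) * K"
      proof (rule eventually_mono[OF eventually_neq_at_within[of u u UNIV]])
        fix x assume x: "x \<noteq> u"
        have "norm (H x) \<le> norm (H x - H u - H' (x - u)) + norm (H' (x - u))"
          using norm_triangle_ineq[of "H x - H u - H' (x - u)" "H' (x - u)"] 0 by simp
        also have "\<dots> \<le> norm (H x - H u - H' (x - u)) + norm (x - u) * C" using C by simp
        finally have "norm (H x) / norm (x - u) \<le> norm (H x - H u - H' (x - u)) / norm (x - u) + C"
          using x by (simp add: field_simps)
        then have "norm (G x - G u) * (norm (H x) / norm (x - u)) * K
            \<le> norm (G x - G u) * (norm (H x - H u - H' (x - u)) / norm (x - u) + C) * K"
          using K(1) by (intro mult_right_mono mult_left_mono) auto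
        moreover have "norm (prod (G x - G u) (H x)) / norm (x - u)
            \<le> norm (G x - G u) * (norm (H x) / norm (x - u)) * K"
          using K(2)[of "G x - G u" "H x"] x by (simp add: field_simps)
        ultimately show "norm (norm (prod (G x - G u) (H x) - prod (G u - G u) (H u) - 0) / norm (x - u))
          \<le> norm (G x - G u) * (norm (H x - H u - H' (x - u)) / norm (x - u) + C) * K"
          by (simp add: 0 zero_right)
      qed
    qed
  qed simp
  from has_derivative_add[OF lin this] show ?thesis by (simp add: diff_left)
qed

text \<open>Resolvent identity with \<open>G x\<close> kept on the right-hand side: a local bound on
  it yields continuity of the inverse, and continuity then yields its derivative.\<close>

lemma blinfun_inverse_diff:
  assumes "G x o\<^sub>L F x = id_blinfun" "F u o\<^sub>L G u = id_blinfun"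
  shows "G x = G u - ((G x o\<^sub>L (F x - F u)) o\<^sub>L G u)"
proof (rule blinfun_eqI)
  fix a
  have "G x (F x b) = b" for b using assms(1) by (metis blinfun_apply_blinfun_compose blinfun_apply_id_blinfun)
  moreover have "F u (G u b) = b" for b using assms(2) by (metis blinfun_apply_blinfun_compose blinfun_apply_id_blinfun)
  ultimately show "G x a = (G u - ((G x o\<^sub>L (F x - F u)) o\<^sub>L G u)) a"
    by (simp add: blinfun.bilinear_simps)
qed

lemma isCont_blinfun_inverse:
  fixes F :: "'a::metric_space \<Rightarrow> 'b::real_normed_vector \<Rightarrow>\<^sub>L 'c::real_normed_vector"
  assumes F: "isCont F u" and U: "open U" "u \<in> U"
    and GF: "\<And>x. x \<in> U \<Longrightarrow> G x o\<^sub>L F x = id_blinfun"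
    and FG: "F u o\<^sub>L G u = id_blinfun"
  shows "isCont G u"
proof -
  define d where "d = (\<lambda>x. norm (F x - F u) * norm (G u))"
  have "(d \<longlongrightarrow> norm (F u - F u) * norm (G u)) (at u)"
    using F unfolding d_def isCont_def by (intro tendsto_intros)
  then have d: "(d \<longlongrightarrow> 0) (at u)" by simp
  have bd: "norm (G x - G u) \<le> norm (G x) * d x" if "x \<in> U" for x
  proof -
    have "norm (G x - G u) = norm ((G x o\<^sub>L (F x - F u)) o\<^sub>L G u)"
      using blinfun_inverse_diff[of G x F u, OF GF[OF that] FG]
      by (metis add_diff_cancel_left' diff_add_cancel norm_minus_commute)
    also have "\<dots> \<le> norm (G x o\<^sub>L (F x - F u)) * norm (G u)" by (rule norm_blinfun_compose)
    also have "\<dots> \<le> (norm (G x) * norm (F x - F u)) * norm (G u)"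
      by (intro mult_right_mono norm_blinfun_compose) auto
    finally show ?thesis by (simp add: d_def mult_ac)
  qed
  have evU: "\<forall>\<^sub>F x in at u. x \<in> U" using U by (rule eventually_at_in_open')
  have "\<forall>\<^sub>F x in at u. d x < 1/2" using d by (rule order_tendstoD) simp
  with evU have ev: "\<forall>\<^sub>F x in at u. norm (G x - G u) \<le> 2 * norm (G u) * d x"
  proof eventually_elim
    case (elim x)
    have d0: "0 \<le> d x" by (simp add: d_def)
    \<comment> \<open>No bound on \<open>G\<close> near \<open>u\<close> is given. Once
      \<open>d x < 1/2\<close>, the term \<open>norm (G x) * d x\<close> is absorbed into the
      left-hand side, which produces one.\<close>
    have "norm (G x) \<le> norm (G u) + norm (G x - G u)" by (simp add: norm_triangle_sub)
    also have "\<dots> \<le> norm (G u) + norm (G x) * d x" using bd[OF elim(1)] by simp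
    also have "\<dots> \<le> norm (G u) + norm (G x) * (1/2)"
      using elim(2) by (intro add_left_mono mult_left_mono) auto
    finally have "norm (G x) \<le> 2 * norm (G u)" by simp
    then show ?case using bd[OF elim(1)] mult_right_mono[OF _ d0] by fastforce
  qed
  have "((\<lambda>x. 2 * norm (G u) * d x) \<longlongrightarrow> 2 * norm (G u) * 0) (at u)" by (intro tendsto_intros d)
  then have "((\<lambda>x. G x - G u) \<longlongrightarrow> 0) (at u)"
    using ev by (intro Lim_null_comparison[of "\<lambda>x. G x - G u"]) auto
  then show ?thesis unfolding isCont_def using LIM_zero_cancel by blast
qed

lemma has_derivative_blinfun_inverse:
  fixes F :: "'a::real_normed_vector \<Rightarrow> 'b::real_normed_vector \<Rightarrow>\<^sub>L 'c::real_normed_vector"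
  assumes F: "(F has_derivative F') (at u)" and U: "open U" "u \<in> U"
    and GF: "\<And>x. x \<in> U \<Longrightarrow> G x o\<^sub>L F x = id_blinfun"
    and FG: "F u o\<^sub>L G u = id_blinfun"
  shows "(G has_derivative (\<lambda>h. - ((G u o\<^sub>L F' h) o\<^sub>L G u))) (at u)"
proof -
  have G: "isCont G u"
    using isCont_blinfun_inverse[OF has_derivative_continuous[OF F] U GF FG] .
  have "((\<lambda>x. F x - F u) has_derivative F') (at u)"
    using has_derivative_diff[OF F has_derivative_const[of "F u"]] by simp
  from bounded_bilinear.has_derivative_prod_vanishing[OF bounded_bilinear_blinfun_compose G this]
  have "((\<lambda>x. G x o\<^sub>L (F x - F u)) has_derivative (\<lambda>h. G u o\<^sub>L F' h)) (at u)" by simp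
  from has_derivative_diff[OF has_derivative_const[of "G u"]
      bounded_linear.has_derivative[OF bounded_bilinear.bounded_linear_left[OF bounded_bilinear_blinfun_compose] this]]
  have *: "((\<lambda>x. G u - ((G x o\<^sub>L (F x - F u)) o\<^sub>L G u)) has_derivative (\<lambda>h. - ((G u o\<^sub>L F' h) o\<^sub>L G u))) (at u)"
    by simp
  show ?thesis
    by (rule has_derivative_transform_within_open[OF * U])
      (metis blinfun_inverse_diff GF FG)
qed

section \<open>Two-by-two matrices and the Lie algebra sl_2\<close>

definition mat2 :: "real \<Rightarrow> real \<Rightarrow> real \<Rightarrow> real \<Rightarrow> real^2^2" where
  "mat2 a b c d = vector [vector [a, b], vector [c, d]]"

lemma mat2_nth [simp]:
  "mat2 a b c d $ 1 $ 1 = a" "mat2 a b c d $ 1 $ 2 = b" "mat2 a b c d $ 2 $ 1 = c" "mat2 a b c d $ 2 $ 2 = d"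
  by (simp_all add: mat2_def)

lemma mat2_eq_iff:
  fixes M N :: "real^2^2"
  shows "M = N \<longleftrightarrow> M$1$1 = N$1$1 \<and> M$1$2 = N$1$2 \<and> M$2$1 = N$2$1 \<and> M$2$2 = N$2$2"
  by (auto simp: vec_eq_iff forall_2)

lemma matrix_mult2_nth [simp]: "((M::real^2^2) ** N) $ i $ j = M$i$1 * N$1$j + M$i$2 * N$2$j"
  by (simp add: matrix_matrix_mult_def sum_2)

lemma mat_1_nth2 [simp]:
  "(mat 1 :: real^2^2) $ 1 $ 1 = 1" "(mat 1 :: real^2^2) $ 1 $ 2 = 0"
  "(mat 1 :: real^2^2) $ 2 $ 1 = 0" "(mat 1 :: real^2^2) $ 2 $ 2 = 1"
  by (simp_all add: mat_def)

lemma bounded_bilinear_matrix_mult2: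
  "bounded_bilinear ((**) :: real^2^2 \<Rightarrow> real^2^2 \<Rightarrow> real^2^2)"
  unfolding bilinear_conv_bounded_bilinear[symmetric] bilinear_def
  by (auto intro!: linearI simp: mat2_eq_iff algebra_simps)

interpretation matmul2: bounded_bilinear "(**) :: real^2^2 \<Rightarrow> real^2^2 \<Rightarrow> real^2^2"
  by (rule bounded_bilinear_matrix_mult2)

text \<open>The coordinates refer to X, Y, Z: X is diag(1/2, -1/2), Y is the matrix unit E_12 and Z
  is E_21 / 2. The two halves are forced by [X,Y] = Y, [Y,Z] = X and [E_12, E_21] = diag(1,
  -1).\<close>

definition sl2_elem :: "real^3 \<Rightarrow> real^2^2" where
  "sl2_elem a = mat2 (a$1 / 2) (a$2) (a$3 / 2) (- a$1 / 2)"

definition sl2_bracket :: "real^3 \<Rightarrow> real^3 \<Rightarrow> real^3" where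
  "sl2_bracket a b = vector [a$2 * b$3 - a$3 * b$2, a$1 * b$2 - a$2 * b$1, a$3 * b$1 - a$1 * b$3]"

lemma sl2_elem_bracket:
  "sl2_elem a ** sl2_elem b - sl2_elem b ** sl2_elem a = sl2_elem (sl2_bracket a b)"
  by (simp add: mat2_eq_iff sl2_elem_def sl2_bracket_def algebra_simps)

lemma bounded_linear_sl2_elem: "bounded_linear sl2_elem"
  unfolding linear_conv_bounded_linear[symmetric]
  by (auto intro!: linearI simp: sl2_elem_def mat2_eq_iff field_simps)

lemma blinfun_inverse_exists:
  fixes f :: "'a::euclidean_space \<Rightarrow>\<^sub>L 'a"
  assumes "inj f"
  obtains g where "g o\<^sub>L f = id_blinfun" "f o\<^sub>L g = id_blinfun"
proof -
  have lin: "linear (blinfun_apply f)" by (rule bounded_linear.linear[OF blinfun.bounded_linear_right])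
  have "surj f" using lin assms by (simp add: linear_injective_imp_surjective)
  then have bij: "bij f" using assms by (simp add: bij_def)
  have "bounded_linear (inv f)"
    using bij_is_surj[OF bij] assms lin
    by (simp add: inj_linear_imp_inv_bounded_linear blinfun.bounded_linear_right)
  then have [simp]: "blinfun_apply (Blinfun (inv f)) = inv f" by (rule bounded_linear_Blinfun_apply)
  show ?thesis
    by (rule that[of "Blinfun (inv f)"])
      (auto intro!: blinfun_eqI simp: inv_f_f[OF assms] surj_f_inv_f[OF \<open>surj f\<close>])
qed

section \<open>Frames with sl_2 brackets on open sets of R^3\<close>

locale sl2_frame =
  fixes U :: "(real^3) set" and X Y Z :: "real^3 \<Rightarrow> real^3"
    and X' Y' Z' :: "real^3 \<Rightarrow> (real^3) \<Rightarrow>\<^sub>L (real^3)"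
  assumes open_U: "open U"
    and X: "\<And>u. u \<in> U \<Longrightarrow> (X has_derivative X' u) (at u)" "continuous_on U X'"
    and Y: "\<And>u. u \<in> U \<Longrightarrow> (Y has_derivative Y' u) (at u)" "continuous_on U Y'"
    and Z: "\<And>u. u \<in> U \<Longrightarrow> (Z has_derivative Z' u) (at u)" "continuous_on U Z'"
    and indep: "\<And>u a b c. \<lbrakk>u \<in> U; a *\<^sub>R X u + b *\<^sub>R Y u + c *\<^sub>R Z u = 0\<rbrakk> \<Longrightarrow> a = 0 \<and> b = 0 \<and> c = 0"
    and bracket_XY: "\<And>u. u \<in> U \<Longrightarrow> Y' u (X u) - X' u (Y u) = Y u"
    and bracket_YZ: "\<And>u. u \<in> U \<Longrightarrow> Z' u (Y u) - Y' u (Z u) = X u"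
    and bracket_ZX: "\<And>u. u \<in> U \<Longrightarrow> X' u (Z u) - Z' u (X u) = Z u"
begin

definition frame :: "real^3 \<Rightarrow> (real^3) \<Rightarrow>\<^sub>L (real^3)" where
  "frame u = (blinfun_scaleR_left (X u) o\<^sub>L Blinfun (\<lambda>a. a$1)) +
     (blinfun_scaleR_left (Y u) o\<^sub>L Blinfun (\<lambda>a. a$2)) +
     (blinfun_scaleR_left (Z u) o\<^sub>L Blinfun (\<lambda>a. a$3))"

definition frame' :: "real^3 \<Rightarrow> real^3 \<Rightarrow> (real^3) \<Rightarrow>\<^sub>L (real^3)" where
  "frame' u h = (blinfun_scaleR_left (X' u h) o\<^sub>L Blinfun (\<lambda>a. a$1)) +
     (blinfun_scaleR_left (Y' u h) o\<^sub>L Blinfun (\<lambda>a. a$2)) +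
     (blinfun_scaleR_left (Z' u h) o\<^sub>L Blinfun (\<lambda>a. a$3))"

definition coframe :: "real^3 \<Rightarrow> (real^3) \<Rightarrow>\<^sub>L (real^3)" where
  "coframe u = (SOME g. g o\<^sub>L frame u = id_blinfun \<and> frame u o\<^sub>L g = id_blinfun)"

lemma Blinfun_vec_nth [simp]: "blinfun_apply (Blinfun (\<lambda>a::real^3. a$i)) = (\<lambda>a. a$i)"
  by (rule bounded_linear_Blinfun_apply) (rule bounded_linear_vec_nth)

lemma frame_apply: "frame u a = a$1 *\<^sub>R X u + a$2 *\<^sub>R Y u + a$3 *\<^sub>R Z u"
  and frame'_apply: "frame' u h a = a$1 *\<^sub>R X' u h + a$2 *\<^sub>R Y' u h + a$3 *\<^sub>R Z' u h"
  by (simp_all add: frame_def frame'_def blinfun.bilinear_simps)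

lemma coframe:
  assumes "u \<in> U"
  shows "coframe u o\<^sub>L frame u = id_blinfun" "frame u o\<^sub>L coframe u = id_blinfun"
proof -
  have "a = 0" if "frame u a = 0" for a
    using indep[OF assms that[unfolded frame_apply]] by (simp add: vec_eq_iff forall_3)
  then have "inj (frame u)"
    using linear_injective_0[OF bounded_linear.linear[OF blinfun.bounded_linear_right]] by blast
  then obtain g where "g o\<^sub>L frame u = id_blinfun \<and> frame u o\<^sub>L g = id_blinfun"
    using blinfun_inverse_exists by blast
  then have "coframe u o\<^sub>L frame u = id_blinfun \<and> frame u o\<^sub>L coframe u = id_blinfun"
    unfolding coframe_def by (rule someI)
  then show "coframe u o\<^sub>L frame u = id_blinfun" "frame u o\<^sub>L coframe u = id_blinfun" by auto
qed

lemma coframe_frame [simp]: "u \<in> U \<Longrightarrow> coframe u (frame u a) = a"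
  and frame_coframe [simp]: "u \<in> U \<Longrightarrow> frame u (coframe u v) = v"
  by (metis coframe blinfun_apply_blinfun_compose blinfun_apply_id_blinfun)+

lemma frame_has_derivative: "u \<in> U \<Longrightarrow> (frame has_derivative frame' u) (at u)"
  unfolding frame_def frame'_def
  by (intro has_derivative_add
      bounded_linear.has_derivative[OF bounded_bilinear.bounded_linear_left[OF bounded_bilinear_blinfun_compose]]
      bounded_linear.has_derivative[OF bounded_linear_blinfun_scaleR_left] X Y Z)

lemma frame'_continuous: "continuous_on U (\<lambda>u. frame' u h)"
  unfolding frame'_def
  by (intro continuous_intros bounded_linear.continuous_on[OF bounded_bilinear.bounded_linear_left[OF bounded_bilinear_blinfun_compose]]
    bounded_linear.continuous_on[OF bounded_linear_blinfun_scaleR_left] X Y Z)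

text \<open>Bilinear extension of the three brackets to combinations of X, Y, Z with constant
  coefficients. Read through the coframe this is the Maurer-Cartan equation, which becomes the
  flatness of the connection below.\<close>

lemma frame'_bracket:
  assumes "u \<in> U"
  shows "frame' u (frame u a) b - frame' u (frame u b) a = frame u (sl2_bracket a b)"
proof -
  have "Y' u (X u) = X' u (Y u) + Y u" "Z' u (Y u) = Y' u (Z u) + X u" "X' u (Z u) = Z' u (X u) + Z u"
    using bracket_XY[OF assms] bracket_YZ[OF assms] bracket_ZX[OF assms] by (simp_all add: algebra_simps)
  then show ?thesis
    by (simp add: frame_apply frame'_apply sl2_bracket_def blinfun.bilinear_simps algebra_simps)
qed

text \<open>\<open>D\<close> is the parallel section with value 1 at \<open>u0\<close> of the
  connection \<theta> that sends \<open>m\<close> to \<open>m ** sl2_elem (coframe u v)\<close>.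
  Multiplying on the right makes the images of the frame fields left-invariant.\<close>

lemma developing_map:
  assumes u0: "u0 \<in> U"
  obtains \<epsilon> D D' where "0 < \<epsilon>" "ball u0 \<epsilon> \<subseteq> U" "D u0 = mat 1"
    "\<And>u. u \<in> ball u0 \<epsilon> \<Longrightarrow> (D has_derivative blinfun_apply (D' u)) (at u)"
    "continuous_on (ball u0 \<epsilon>) D'"
    "\<And>u a. u \<in> ball u0 \<epsilon> \<Longrightarrow> D' u (frame u a) = D u ** sl2_elem a"
    "\<And>u. u \<in> ball u0 \<epsilon> \<Longrightarrow> det (D u) = 1"
proof -
  define \<kappa> where "\<kappa> = Blinfun sl2_elem"
  have \<kappa> [simp]: "blinfun_apply \<kappa> = sl2_elem"
    unfolding \<kappa>_def by (rule bounded_linear_Blinfun_apply[OF bounded_linear_sl2_elem])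
  define R where "R = Blinfun (\<lambda>K. matmul2.prod_left K)"
  have R [simp]: "blinfun_apply R = matmul2.prod_left"
    unfolding R_def by (rule bounded_linear_Blinfun_apply[OF matmul2.bounded_linear_prod_left])
  define \<theta> where "\<theta> = (\<lambda>u. (R o\<^sub>L \<kappa>) o\<^sub>L coframe u)"
  define \<theta>1 where "\<theta>1 = (\<lambda>u h. (R o\<^sub>L \<kappa>) o\<^sub>L (- ((coframe u o\<^sub>L frame' u h) o\<^sub>L coframe u)))"
  define \<theta>' where "\<theta>' = (\<lambda>u. Blinfun (\<theta>1 u))"
  have comp_left: "bounded_linear (\<lambda>f :: (real^3) \<Rightarrow>\<^sub>L (real^3). (R o\<^sub>L \<kappa>) o\<^sub>L f)"
    by (rule bounded_bilinear.bounded_linear_right[OF bounded_bilinear_blinfun_compose])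
  have \<theta>_apply: "\<theta> u v m = m ** sl2_elem (coframe u v)" for u v m by (simp add: \<theta>_def)
  have der1: "(\<theta> has_derivative \<theta>1 u) (at u)" if u: "u \<in> U" for u
  proof -
    have "(coframe has_derivative (\<lambda>h. - ((coframe u o\<^sub>L frame' u h) o\<^sub>L coframe u))) (at u)"
      by (rule has_derivative_blinfun_inverse[OF frame_has_derivative[OF u] open_U u])
        (simp_all add: coframe u)
    from bounded_linear.has_derivative[OF comp_left this]
    show ?thesis by (simp only: \<theta>_def \<theta>1_def)
  qed
  have \<theta>' [simp]: "blinfun_apply (\<theta>' u) = \<theta>1 u" if "u \<in> U" for u
    unfolding \<theta>'_def by (rule bounded_linear_Blinfun_apply[OF has_derivative_bounded_linear[OF der1[OF that]]])
  have cont_coframe: "continuous_on U coframe"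
  proof (intro continuous_at_imp_continuous_on ballI)
    fix u assume u: "u \<in> U"
    show "isCont coframe u"
      by (rule isCont_blinfun_inverse[OF has_derivative_continuous[OF frame_has_derivative[OF u]] open_U u])
        (simp_all add: coframe u)
  qed
  have cont_\<theta>': "continuous_on U \<theta>'"
  proof (rule continuous_on_blinfun_componentwise)
    fix i :: "real^3"
    have "continuous_on U (\<lambda>u. \<theta>1 u i)"
      unfolding \<theta>1_def
      by (intro bounded_linear.continuous_on[OF comp_left] continuous_intros
         bounded_bilinear.continuous_on[OF bounded_bilinear_blinfun_compose] cont_coframe frame'_continuous)
    then show "continuous_on U (\<lambda>u. \<theta>' u i)"
      by (rule continuous_on_eq) simp
  qed
  have "\<theta>' u h v m + \<theta> u v (\<theta> u h m) = \<theta>' u v h m + \<theta> u h (\<theta> u v m)" if u: "u \<in> U" for u h v m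
  proof -
    let ?a = "coframe u h" and ?b = "coframe u v"
    have "frame' u h ?b - frame' u v ?a = frame u (sl2_bracket ?a ?b)"
      using frame'_bracket[OF u, of ?a ?b] u by simp
    then have "coframe u (frame' u h ?b) - coframe u (frame' u v ?a) = sl2_bracket ?a ?b"
      by (simp add: u flip: blinfun.diff_right)
    then have "sl2_elem (coframe u (frame' u h ?b)) - sl2_elem (coframe u (frame' u v ?a))
       = sl2_elem ?a ** sl2_elem ?b - sl2_elem ?b ** sl2_elem ?a"
      by (simp add: sl2_elem_bracket flip: linear_diff[OF bounded_linear.linear[OF bounded_linear_sl2_elem]])
    then have "m ** (sl2_elem (coframe u (frame' u h ?b)) - sl2_elem (coframe u (frame' u v ?a)))
       = m ** (sl2_elem ?a ** sl2_elem ?b - sl2_elem ?b ** sl2_elem ?a)" by simp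
    then show ?thesis using u
      by (simp add: \<theta>_apply \<theta>1_def blinfun.bilinear_simps matmul2.diff_right matmul2.minus_right matrix_mul_assoc
        linear_neg[OF bounded_linear.linear[OF bounded_linear_sl2_elem]] algebra_simps)
  qed
  note flat = this
  have der: "(\<theta> has_derivative blinfun_apply (\<theta>' u)) (at u)" if "u \<in> U" for u
    using der1[OF that] that by simp
  obtain \<epsilon> D where \<epsilon>: "0 < \<epsilon>" "ball u0 \<epsilon> \<subseteq> U" "D u0 = mat 1"
    and D: "\<And>u. u \<in> ball u0 \<epsilon> \<Longrightarrow> (D has_derivative (\<lambda>v. \<theta> u v (D u))) (at u)"
    by (rule flat_connection_local_solution[OF open_U u0 der cont_\<theta>' flat, where ?r0.0 = "mat 1"]) (assumption | rule that)+
  have u0_ball: "u0 \<in> ball u0 \<epsilon>" using \<epsilon>(1) by (rule centre_in_ball[THEN iffD2])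
  define D' where "D' = (\<lambda>u. blinfun.prod_left (D u) o\<^sub>L \<theta> u)"
  have D'_apply: "D' u v = \<theta> u v (D u)" for u v by (simp add: D'_def)
  have D'_frame: "D' u (frame u a) = D u ** sl2_elem a" if "u \<in> ball u0 \<epsilon>" for u a
    using that \<epsilon>(2) by (simp add: D'_apply \<theta>_apply subset_iff)
  have DD': "(D has_derivative blinfun_apply (D' u)) (at u)" if "u \<in> ball u0 \<epsilon>" for u
    using D[OF that] by (simp add: D'_apply[abs_def])
  have contD: "continuous_on (ball u0 \<epsilon>) D"
    by (intro continuous_at_imp_continuous_on ballI has_derivative_continuous[OF DD'])
  have cD': "continuous_on (ball u0 \<epsilon>) D'"
    unfolding D'_def \<theta>_def
    by (rule bounded_bilinear.continuous_on[OF bounded_bilinear_blinfun_compose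
        bounded_linear.continuous_on[OF blinfun.bounded_linear_prod_left contD]
        bounded_linear.continuous_on[OF comp_left continuous_on_subset[OF cont_coframe \<epsilon>(2)]]])
  \<comment> \<open>Along the connection the derivative of \<open>det D\<close> is
    \<open>det D\<close> times the trace of an \<open>sl2_elem\<close>, which is zero.\<close>
  have detD: "det (D u) = 1" if u: "u \<in> ball u0 \<epsilon>" for u
  proof -
    have d0: "((\<lambda>u. det (D u)) has_derivative (\<lambda>h. 0)) (at u within ball u0 \<epsilon>)" if u: "u \<in> ball u0 \<epsilon>" for u
    proof -
      have nth: "((\<lambda>u. D u $ i $ j) has_derivative (\<lambda>h. D' u h $ i $ j)) (at u)" for i j
        by (intro bounded_linear.has_derivative[OF bounded_linear_vec_nth] DD' u)
      have "((\<lambda>u. D u $ 1 $ 1 * D u $ 2 $ 2 - D u $ 1 $ 2 * D u $ 2 $ 1) has_derivative (\<lambda>h. 0)) (at u)"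
      proof (rule has_derivative_eq_rhs)
        show "((\<lambda>u. D u $ 1 $ 1 * D u $ 2 $ 2 - D u $ 1 $ 2 * D u $ 2 $ 1) has_derivative
          (\<lambda>h. (D u $ 1 $ 1 * D' u h $ 2 $ 2 + D' u h $ 1 $ 1 * D u $ 2 $ 2)
             - (D u $ 1 $ 2 * D' u h $ 2 $ 1 + D' u h $ 1 $ 2 * D u $ 2 $ 1))) (at u)"
          by (intro has_derivative_diff has_derivative_mult nth)
        show "(\<lambda>h. (D u $ 1 $ 1 * D' u h $ 2 $ 2 + D' u h $ 1 $ 1 * D u $ 2 $ 2)
             - (D u $ 1 $ 2 * D' u h $ 2 $ 1 + D' u h $ 1 $ 2 * D u $ 2 $ 1)) = (\<lambda>h. 0)"
          by (rule ext) (simp add: D'_apply \<theta>_apply sl2_elem_def algebra_simps)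
      qed
      then show ?thesis unfolding det_2 by (rule has_derivative_at_withinI)
    qed
    have "det (D u) = det (D u0)"
      by (rule has_derivative_zero_unique[OF convex_ball d0 u u0_ball])
    then show ?thesis using \<epsilon> by simp
  qed
  show ?thesis using \<epsilon> DD' cD' D'_frame detD by (rule that)
qed

text \<open>\<open>D\<close> maps into a hypersurface of the four-dimensional matrix space, so the
  inverse function theorem is applied to the three entries selected by \<open>pr\<close>. The
  inverse \<open>\<Phi>\<close> factors through \<open>pr\<close> and is thereby defined and C^1 on
  an open set of matrices, which lets it be composed with matrix curves; it inverts \<open>D\<close>
  only where the determinant is 1.\<close>

lemma developing_chart:
  assumes u0: "u0 \<in> U"
  obtains W V D D' \<Phi> \<Phi>' where
    "open W" "u0 \<in> W" "W \<subseteq> U" "open V" "D u0 = mat 1"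
    "\<And>u. u \<in> W \<Longrightarrow> (D has_derivative blinfun_apply (D' u)) (at u)"
    "continuous_on W D'"
    "\<And>u a. u \<in> W \<Longrightarrow> D' u (frame u a) = D u ** sl2_elem a"
    "\<And>u. u \<in> W \<Longrightarrow> det (D u) = 1 \<and> D u \<in> V \<and> \<Phi> (D u) = u"
    "\<And>m. m \<in> V \<Longrightarrow> (\<Phi> has_derivative blinfun_apply (\<Phi>' m)) (at m)"
    "continuous_on V \<Phi>'"
    "\<And>m. m \<in> V \<Longrightarrow> \<Phi> m \<in> W"
    "\<And>m. \<lbrakk>m \<in> V; det m = 1\<rbrakk> \<Longrightarrow> D (\<Phi> m) = m"
proof -
  obtain \<epsilon> D D' where \<epsilon>: "0 < \<epsilon>" "ball u0 \<epsilon> \<subseteq> U" and D0: "D u0 = mat 1"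
    and D: "\<And>u. u \<in> ball u0 \<epsilon> \<Longrightarrow> (D has_derivative blinfun_apply (D' u)) (at u)"
    and contD': "continuous_on (ball u0 \<epsilon>) D'"
    and D'_frame: "\<And>u a. u \<in> ball u0 \<epsilon> \<Longrightarrow> D' u (frame u a) = D u ** sl2_elem a"
    and detD: "\<And>u. u \<in> ball u0 \<epsilon> \<Longrightarrow> det (D u) = 1"
    using developing_map[OF u0] by blast
  have u0_ball: "u0 \<in> ball u0 \<epsilon>" using \<epsilon>(1) by (rule centre_in_ball[THEN iffD2])
  define pr :: "real^2^2 \<Rightarrow> real^3" where "pr = (\<lambda>m. vector [m$1$1, m$1$2, m$2$1])"
  have "linear pr" by (auto intro!: linearI simp: pr_def vec_eq_iff forall_3)
  then have blpr: "bounded_linear pr" by (simp add: linear_conv_bounded_linear)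
  define Pr where "Pr = Blinfun pr"
  have Pr [simp]: "blinfun_apply Pr = pr" unfolding Pr_def by (rule bounded_linear_Blinfun_apply[OF blpr])
  define \<Psi>' where "\<Psi>' = (\<lambda>u. Pr o\<^sub>L D' u)"
  have \<Psi>: "((\<lambda>u. pr (D u)) has_derivative blinfun_apply (\<Psi>' u)) (at u)" if "u \<in> ball u0 \<epsilon>" for u
    using bounded_linear.has_derivative[OF blpr D[OF that]]
    by (rule has_derivative_eq_rhs) (simp add: \<Psi>'_def fun_eq_iff)
  have cont\<Psi>': "continuous_on (ball u0 \<epsilon>) \<Psi>'"
    unfolding \<Psi>'_def
    by (rule bounded_bilinear.continuous_on[OF bounded_bilinear_blinfun_compose continuous_on_const contD'])
  \<comment> \<open>At \<open>u0\<close>, where \<open>D\<close> is 1, the derivative of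
    \<open>D\<close> takes values in the traceless matrices, and \<open>pr\<close> is injective on
    these.\<close>
  have "v = 0" if "\<Psi>' u0 v = 0" for v
  proof -
    define a where "a = coframe u0 v"
    have "\<Psi>' u0 v = pr (sl2_elem a)"
      using D'_frame[OF u0_ball, of a] u0 by (simp add: \<Psi>'_def a_def D0)
    with that have "a = 0"
      by (simp add: pr_def sl2_elem_def vec_eq_iff forall_3)
    then show "v = 0" using u0 unfolding a_def by (metis blinfun.zero_right frame_coframe)
  qed
  then have "inj (\<Psi>' u0)"
    using linear_injective_0[OF bounded_linear.linear[OF blinfun.bounded_linear_right]] by blast
  then obtain invf where "invf o\<^sub>L \<Psi>' u0 = id_blinfun"
    using blinfun_inverse_exists by blast
  then obtain U' V g g' where U': "open U'" "U' \<subseteq> ball u0 \<epsilon>" "u0 \<in> U'" and V: "open V"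
    and hom: "homeomorphism U' V (\<lambda>u. pr (D u)) g"
    and g: "\<And>y. y \<in> V \<Longrightarrow> (g has_derivative (g' y)) (at y)"
    and g': "\<And>y. y \<in> V \<Longrightarrow> g' y = inv (blinfun_apply (\<Psi>' (g y)))"
    and bij: "\<And>y. y \<in> V \<Longrightarrow> bij (blinfun_apply (\<Psi>' (g y)))"
    using inverse_function_theorem[OF open_ball \<Psi> cont\<Psi>' u0_ball] by metis
  have gV: "g y \<in> U'" "pr (D (g y)) = y" if "y \<in> V" for y
    using hom that by (auto simp: homeomorphism_def)
  have gD: "g (pr (D u)) = u" "pr (D u) \<in> V" if "u \<in> U'" for u
    using hom that by (auto simp: homeomorphism_def)
  define G where "G = (\<lambda>y. Blinfun (g' y))"
  have G [simp]: "blinfun_apply (G y) = g' y" if "y \<in> V" for y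
    unfolding G_def by (rule bounded_linear_Blinfun_apply[OF has_derivative_bounded_linear[OF g[OF that]]])
  have GF: "G y o\<^sub>L \<Psi>' (g y) = id_blinfun" "\<Psi>' (g y) o\<^sub>L G y = id_blinfun" if "y \<in> V" for y
    using that bij[OF that] by (auto intro!: blinfun_eqI simp: g' bij_is_inj bij_is_surj surj_f_inv_f)
  \<comment> \<open>The derivative of the local inverse \<open>g\<close> is the pointwise inverse of
    \<open>\<Psi>'\<close> along \<open>g\<close>; continuity of operator inversion upgrades
    \<open>g\<close> to C^1.\<close>
  have contG: "continuous_on V G"
  proof (intro continuous_at_imp_continuous_on ballI)
    fix y assume y: "y \<in> V"
    have "isCont \<Psi>' (g y)"
      using cont\<Psi>' gV(1)[OF y] U'(2) continuous_on_eq_continuous_at[OF open_ball] by blast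
    then have "isCont (\<lambda>y. \<Psi>' (g y)) y"
      by (rule isCont_o2[OF has_derivative_continuous[OF g[OF y]]])
    then show "isCont G y"
      by (rule isCont_blinfun_inverse[OF _ V y]) (simp_all add: GF y)
  qed
  \<comment> \<open>The condition on the upper left entry lets \<open>det m = 1\<close> be solved
    for the entry that \<open>pr\<close> forgets.\<close>
  define W where "W = {u \<in> U'. D u $ 1 $ 1 > 0}"
  define N where "N = {m. pr m \<in> V \<and> m $ 1 $ 1 > 0}"
  have contD: "continuous_on U' D"
    by (intro continuous_at_imp_continuous_on ballI has_derivative_continuous[OF D]) (use U'(2) in blast)
  have "open (U' \<inter> (\<lambda>u. D u $ 1 $ 1) -` {0<..})"
    by (rule continuous_open_preimage[OF _ U'(1)]) (auto intro!: continuous_intros contD)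
  also have "U' \<inter> (\<lambda>u. D u $ 1 $ 1) -` {0<..} = W" by (auto simp: W_def)
  finally have openW: "open W" .
  have contpr: "continuous_on UNIV pr"
    by (rule linear_continuous_on[OF blpr])
  have "open (pr -` V \<inter> {m. 0 < m $ 1 $ 1})"
    by (intro open_Int open_vimage[OF V contpr] open_Collect_less continuous_intros)
  also have "pr -` V \<inter> {m. 0 < m $ 1 $ 1} = N" by (auto simp: N_def)
  finally have openN: "open N" .
  show ?thesis
  proof (rule that[of W N D D' "\<lambda>m. g (pr m)" "\<lambda>m. G (pr m) o\<^sub>L Pr"])
    show "u0 \<in> W" using U'(3) D0 by (simp add: W_def)
    show "W \<subseteq> U" using U'(2) \<epsilon>(2) by (auto simp: W_def)
    have W_ball: "u \<in> ball u0 \<epsilon>" if "u \<in> W" for u using that U'(2) by (auto simp: W_def)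
    show "(D has_derivative blinfun_apply (D' u)) (at u)" if "u \<in> W" for u
      using D[OF W_ball[OF that]] .
    show "continuous_on W D'" using contD' by (rule continuous_on_subset) (use W_ball in blast)
    show "D' u (frame u a) = D u ** sl2_elem a" if "u \<in> W" for u a
      using D'_frame[OF W_ball[OF that]] .
    show "det (D u) = 1 \<and> D u \<in> N \<and> g (pr (D u)) = u" if "u \<in> W" for u
      using that detD[OF W_ball[OF that]] gD[of u] by (simp add: W_def N_def)
    show "((\<lambda>m. g (pr m)) has_derivative blinfun_apply (G (pr m) o\<^sub>L Pr)) (at m)" if "m \<in> N" for m
      by (rule has_derivative_eq_rhs[OF has_derivative_compose[OF bounded_linear_imp_has_derivative[OF blpr] g]])
        (use that in \<open>auto simp: N_def\<close>)
    show "continuous_on N (\<lambda>m. G (pr m) o\<^sub>L Pr)"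
      by (intro bounded_bilinear.continuous_on[OF bounded_bilinear_blinfun_compose] continuous_on_const
          continuous_on_compose2[OF contG continuous_on_subset[OF contpr]]) (auto simp: N_def)
    have pr_eq: "D (g (pr m)) $ 1 $ 1 = m $ 1 $ 1" "D (g (pr m)) $ 1 $ 2 = m $ 1 $ 2"
      "D (g (pr m)) $ 2 $ 1 = m $ 2 $ 1" if "m \<in> N" for m
      using gV(2)[of "pr m"] that by (auto simp: N_def pr_def vec_eq_iff forall_3)
    show gW: "g (pr m) \<in> W" if "m \<in> N" for m
      using pr_eq(1)[OF that] gV(1)[of "pr m"] that by (simp add: N_def W_def)
    show "D (g (pr m)) = m" if m: "m \<in> N" and det: "det m = 1" for m
    proof -
      have "det (D (g (pr m))) = det m" using detD[OF W_ball[OF gW[OF m]]] det by simp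
      moreover have "m $ 1 $ 1 \<noteq> 0" using m by (simp add: N_def)
      ultimately show ?thesis by (simp add: mat2_eq_iff pr_eq[OF m] det_2)
    qed
  qed (use openW openN D0 in auto)
qed

end

section \<open>Absolutely continuous and Lipschitz paths\<close>

text \<open>
  On a tagged division that is fine for a suitable gauge, the intervals tagged in \<open>N\<close> lie in an open
  set of small measure and are controlled by absolute continuity, the others by the derivative.
\<close>

lemma abs_continuous_on_increment_le:
  fixes h :: "real \<Rightarrow> 'b::real_normed_vector"
  assumes ab: "a \<le> b" and ac: "abs_continuous_on a b h" and N: "negligible N" and C: "0 \<le> C"
    and der: "\<And>s. s \<in> {a..b} - N \<Longrightarrow> (h has_vector_derivative h' s) (at s within {a..b})"
    and bd: "\<And>s. s \<in> {a..b} - N \<Longrightarrow> norm (h' s) \<le> C"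
  shows "norm (h b - h a) \<le> C * (b - a)"
proof (rule field_le_epsilon)
  fix e :: real assume e: "e > 0"
  \<comment> \<open>The \<open>+ 1\<close> covers the case \<open>a = b\<close>. Intervals tagged
    outside \<open>N\<close> and those tagged in \<open>N\<close> each contribute an error of at
    most \<open>e / 2\<close>.\<close>
  define e2 where "e2 = e / (2 * (b - a + 1))"
  have e2: "e2 > 0" "e2 * (b - a) \<le> e / 2"
    using e ab by (auto simp: e2_def field_simps)
  obtain \<delta> where \<delta>: "\<delta> > 0" "\<And>D T. \<lbrakk>D division_of T; T \<subseteq> {a..b}; (\<Sum>I\<in>D. Sup I - Inf I) < \<delta>\<rbrakk> \<Longrightarrow>
        (\<Sum>I\<in>D. norm (h (Sup I) - h (Inf I))) < e / 2"
    using ac e unfolding abs_continuous_on_def by (metis half_gt_zero)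
  have N_null: "N \<in> null_sets lebesgue" using N by (simp add: negligible_iff_null_sets)
  obtain T where T: "open T" "N \<subseteq> T" "T - N \<in> lmeasurable" "emeasure lebesgue (T - N) < ennreal \<delta>"
    using sets_lebesgue_outer_open[OF null_setsD2[OF N_null] \<delta>(1)] by blast
  have "emeasure lebesgue (T - N) = emeasure lebesgue T"
    using N_null T(1) by (intro emeasure_Diff_null_set) auto
  with T have T_meas: "T \<in> lmeasurable" "measure lebesgue T < \<delta>"
    using \<delta>(1) by (auto simp: fmeasurable_def measure_def intro: order_less_trans
      dest!: less_ennreal.rep_eq[THEN iffD1, of _ "ennreal \<delta>"] simp: enn2real_less_iff)
  have "\<exists>r>0. \<forall>y\<in>{a..b}. norm (y - s) < r \<longrightarrow> norm (h y - h s - (y - s) *\<^sub>R h' s) \<le> e2 * norm (y - s)"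
    if "s \<in> {a..b} - N" for s
    using der[OF that] e2(1) unfolding has_vector_derivative_def has_derivative_within_alt by blast
  then obtain r where r: "\<And>s. s \<in> {a..b} - N \<Longrightarrow> r s > 0 \<and>
      (\<forall>y\<in>{a..b}. norm (y - s) < r s \<longrightarrow> norm (h y - h s - (y - s) *\<^sub>R h' s) \<le> e2 * norm (y - s))"
    by metis
  define \<gamma> where "\<gamma> = (\<lambda>s. if s \<in> N then T else if s \<in> {a..b} then ball s (r s) else ball s 1)"
  have "gauge \<gamma>"
    unfolding gauge_def \<gamma>_def using T r by auto
  then obtain p where p: "p tagged_division_of {a..b}" and fine: "\<gamma> fine p"
    using fine_division_exists_real by blast
  note pD = tagged_division_ofD[OF p]
  define pb where "pb = {(x, K) \<in> p. x \<in> N}"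
  define pg where "pg = {(x, K) \<in> p. x \<notin> N}"
  have split: "p = pg \<union> pb" "pg \<inter> pb = {}" by (auto simp: pg_def pb_def)
  have fin: "finite pg" "finite pb" using pD(1) finite_subset split(1) by auto
  have interval: "\<exists>c d. K = {c..d} \<and> c \<le> x \<and> x \<le> d \<and> a \<le> c \<and> d \<le> b" if xK: "(x, K) \<in> p" for x K
  proof -
    obtain c d where K: "K = {c..d}" using pD(4)[OF xK] by (auto simp: box_real)
    with pD(2,3)[OF xK] have "c \<le> x" "x \<le> d" "{c..d} \<subseteq> {a..b}" by auto
    with K show ?thesis by auto
  qed
  have len: "(\<Sum>(x, K)\<in>p. Sup K - Inf K) = b - a"
    using additive_tagged_division_1[OF ab p, of "\<lambda>x. x"] by simp
  have good: "norm (\<Sum>(x, K)\<in>pg. h (Sup K) - h (Inf K)) \<le> (C + e2) * (b - a)"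
  proof -
    have "norm (\<Sum>(x, K)\<in>pg. h (Sup K) - h (Inf K)) \<le> (\<Sum>(x, K)\<in>pg. (C + e2) * (Sup K - Inf K))"
    proof (rule sum_norm_le, safe)
      fix x K assume xK: "(x, K) \<in> pg"
      then have xp: "(x, K) \<in> p" and xN: "x \<notin> N" by (auto simp: pg_def)
      obtain c d where K: "K = {c..d}" "c \<le> x" "x \<le> d" "a \<le> c" "d \<le> b" using interval[OF xp] by blast
      have x: "x \<in> {a..b} - N" using K xN by auto
      have "K \<subseteq> ball x (r x)" using fine xp x unfolding fine_def \<gamma>_def by fastforce
      from subsetD[OF this, of c] subsetD[OF this, of d] K
      have cd: "norm (c - x) < r x" "norm (d - x) < r x"
        by (simp_all add: dist_norm norm_minus_commute)
      have "c \<in> {a..b}" "d \<in> {a..b}" using K by auto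
      then have inc: "norm (h c - h x - (c - x) *\<^sub>R h' x) \<le> e2 * norm (c - x)"
        "norm (h d - h x - (d - x) *\<^sub>R h' x) \<le> e2 * norm (d - x)"
        using r[OF x] cd by blast+
      have "h d - h c = (h d - h x - (d - x) *\<^sub>R h' x) - (h c - h x - (c - x) *\<^sub>R h' x) + (d - c) *\<^sub>R h' x"
        by (simp add: algebra_simps)
      also have "norm \<dots> \<le> e2 * norm (d - x) + e2 * norm (c - x) + (d - c) * C"
      proof (rule order_trans[OF norm_triangle_ineq add_mono])
        show "norm ((d - c) *\<^sub>R h' x) \<le> (d - c) * C"
          using K mult_left_mono[OF bd[OF x], of "d - c"] by simp
      qed (rule order_trans[OF norm_triangle_ineq4 add_mono[OF inc(2,1)]])
      also have "\<dots> = (C + e2) * (d - c)" using K by (simp add: algebra_simps)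
      finally show "norm (h (Sup K) - h (Inf K)) \<le> (C + e2) * (Sup K - Inf K)" using K by simp
    qed
    also have "\<dots> = (C + e2) * (\<Sum>(x, K)\<in>pg. Sup K - Inf K)"
      by (simp add: sum_distrib_left split_def)
    also have "\<dots> \<le> (C + e2) * (b - a)"
    proof (rule mult_left_mono)
      have "(\<Sum>(x, K)\<in>pg. Sup K - Inf K) \<le> (\<Sum>(x, K)\<in>p. Sup K - Inf K)"
        by (rule sum_mono2) (use pD(1) split interval in fastforce)+
      then show "(\<Sum>(x, K)\<in>pg. Sup K - Inf K) \<le> b - a" using len by simp
    qed (use C e2 in simp)
    finally show ?thesis .
  qed
  have bad: "norm (\<Sum>(x, K)\<in>pb. h (Sup K) - h (Inf K)) \<le> e / 2"
  proof -
    have partial: "pb tagged_partial_division_of {a..b}"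
      using p tagged_partial_division_subset[of p "{a..b}" pb] split(1)
      by (auto simp: tagged_division_of_def)
    note pb = tagged_partial_division_of_Union_self[OF partial]
    note Db = partial_division_of_tagged_division[OF partial]
    \<comment> \<open>Passing from tagged pairs to intervals requires a function vanishing on every
      interval without interior. The case distinction settles the empty set, where
      \<open>Sup\<close> and \<open>Inf\<close> carry no information.\<close>
    define d where "d = (\<lambda>K::real set. if K = {} then 0 else norm (h (Sup K) - h (Inf K)))"
    have ne: "K \<noteq> {}" if "K \<in> snd ` pb" for K
      using that interval split(1) by fastforce
    have "norm (\<Sum>(x, K)\<in>pb. h (Sup K) - h (Inf K)) \<le> (\<Sum>(x, K)\<in>pb. d K)"
      using ne by (intro sum_norm_le) (auto simp: d_def split_beta)
    also have "\<dots> = sum d (snd ` pb)"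
      by (rule sum.over_tagged_division_lemma[OF pb]) (auto simp: d_def box_real)
    also have "\<dots> = (\<Sum>I\<in>snd ` pb. norm (h (Sup I) - h (Inf I)))"
      by (rule sum.cong) (use ne in \<open>auto simp: d_def\<close>)
    also have "\<dots> \<le> e / 2"
    proof (rule less_imp_le, rule \<delta>(2)[OF Db])
      show "\<Union>(snd ` pb) \<subseteq> {a..b}"
      proof (rule Union_least)
        fix K assume "K \<in> snd ` pb"
        then obtain x where "(x, K) \<in> p" by (auto simp: pb_def)
        then show "K \<subseteq> {a..b}" by (rule pD(3))
      qed
      have "(\<Sum>I\<in>snd ` pb. Sup I - Inf I) = (\<Sum>I\<in>snd ` pb. measure lebesgue I)"
      proof (rule sum.cong[OF refl])
        fix I assume "I \<in> snd ` pb"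
        then obtain x where "(x, I) \<in> p" by (auto simp: pb_def)
        from interval[OF this] obtain c d where "I = {c..d}" "c \<le> d" by auto
        then show "Sup I - Inf I = measure lebesgue I" by simp
      qed
      also have "\<dots> = measure lebesgue (\<Union>(snd ` pb))"
        by (rule content_division[OF Db])
      also have "\<dots> \<le> measure lebesgue T"
      proof (rule measure_mono_fmeasurable)
        show "\<Union>(snd ` pb) \<subseteq> T"
        proof (rule Union_least)
          fix K assume "K \<in> snd ` pb"
          then obtain x where "(x, K) \<in> p" "x \<in> N" by (auto simp: pb_def)
          with fine show "K \<subseteq> T" by (force simp: fine_def \<gamma>_def)
        qed
        show "\<Union>(snd ` pb) \<in> sets lebesgue"
          using Db by (simp add: fmeasurableD lmeasurable_division)
      qed (rule T_meas)
      finally show "(\<Sum>I\<in>snd ` pb. Sup I - Inf I) < \<delta>" using T_meas(2) by simp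
    qed
    finally show ?thesis .
  qed
  have "h b - h a = (\<Sum>(x, K)\<in>p. h (Sup K) - h (Inf K))"
    using additive_tagged_division_1[OF ab p, of h] by simp
  also have "\<dots> = (\<Sum>(x, K)\<in>pg. h (Sup K) - h (Inf K)) + (\<Sum>(x, K)\<in>pb. h (Sup K) - h (Inf K))"
    using fin split by (simp add: sum.union_disjoint)
  also have "norm \<dots> \<le> (C + e2) * (b - a) + e / 2"
    by (rule order_trans[OF norm_triangle_ineq add_mono[OF good bad]])
  also have "\<dots> \<le> C * (b - a) + e" using e2(2) by (simp add: algebra_simps)
  finally show "norm (h b - h a) \<le> C * (b - a) + e" .
qed

section \<open>Horizontal paths of unimodular matrices\<close>

lemma norm_matrix2_le: "norm (M::real^2^2) \<le> \<bar>M$1$1\<bar> + \<bar>M$1$2\<bar> + \<bar>M$2$1\<bar> + \<bar>M$2$2\<bar>"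
proof -
  have "norm M \<le> norm (M$1) + norm (M$2)"
    unfolding norm_vec_def[of M] by (rule order_trans[OF L2_set_le_sum]) (auto simp: sum_2)
  moreover have "norm (v::real^2) \<le> \<bar>v$1\<bar> + \<bar>v$2\<bar>" for v
    using norm_le_l1_cart[of v] by (simp add: sum_2)
  ultimately show ?thesis by (smt (verit))
qed

lemma has_vector_derivative_mat2:
  assumes "(a has_vector_derivative a') F" "(b has_vector_derivative b') F"
    "(c has_vector_derivative c') F" "(d has_vector_derivative d') F"
  shows "((\<lambda>s. mat2 (a s) (b s) (c s) (d s)) has_vector_derivative mat2 a' b' c' d') F"
proof -
  have eq: "mat2 a b c d = a *\<^sub>R mat2 1 0 0 0 + b *\<^sub>R mat2 0 1 0 0 + c *\<^sub>R mat2 0 0 1 0 + d *\<^sub>R mat2 0 0 0 1"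
    for a b c d by (simp add: mat2_eq_iff)
  note lin = bounded_linear.has_vector_derivative[OF bounded_linear_scaleR_left]
  show ?thesis
    unfolding eq[of "a _"] eq[of a'] by (intro has_vector_derivative_add lin assms)
qed

definition diag2 :: "real \<Rightarrow> real^2^2" where
  "diag2 t = mat2 (exp (t / 2)) 0 0 (exp (- t / 2))"

lemma diag2_simps: "diag2 s ** diag2 t = diag2 (s + t)" "det (diag2 t) = 1" "diag2 0 = mat 1"
  by (auto simp: diag2_def mat2_eq_iff det_2 exp_add[symmetric] add_divide_distrib diff_divide_distrib)

lemma diag2_has_vector_derivative:
  "(diag2 has_vector_derivative diag2 t ** sl2_elem (vector [1, 0, 0])) (at t within S)"
proof -
  have "((\<lambda>t. exp (t / 2)) has_real_derivative exp (t / 2) / 2) (at t within S)"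
    "((\<lambda>t. exp (- t / 2)) has_real_derivative - exp (- t / 2) / 2) (at t within S)"
    by (auto intro!: derivative_eq_intros)
  then have "(diag2 has_vector_derivative mat2 (exp (t / 2) / 2) 0 0 (- exp (- t / 2) / 2)) (at t within S)"
    unfolding diag2_def[abs_def] has_real_derivative_iff_has_vector_derivative
    by (intro has_vector_derivative_mat2 has_vector_derivative_const)
  also have "mat2 (exp (t / 2) / 2) 0 0 (- exp (- t / 2) / 2) = diag2 t ** sl2_elem (vector [1, 0, 0])"
    by (simp add: mat2_eq_iff diag2_def sl2_elem_def)
  finally show ?thesis .
qed

text \<open>[X,Y] = Y and [X,Z] = -Z make Y and Z eigenvectors of conjugation by the group of X,
  with factors \<open>exp t\<close> and \<open>exp (- t)\<close>. These are the weights of \<alpha>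
  and \<beta> in the variation of the geodesic.\<close>

lemma diag2_conjugate:
  "sl2_elem (vector [0, a, b]) ** diag2 (- t) = diag2 (- t) ** sl2_elem (vector [0, exp t * a, exp (- t) * b])"
  by (simp add: mat2_eq_iff diag2_def sl2_elem_def exp_add[symmetric] mult.assoc[symmetric])

text \<open>
  In the coordinates \<open>p = 1 / m\<^sub>1\<^sub>1\<close>, \<open>q = m\<^sub>1\<^sub>2\<close>, \<open>r = m\<^sub>2\<^sub>1 / m\<^sub>1\<^sub>1\<close> of a unimodular matrix \<open>m\<close> horizontality
  reads \<open>p' = - q r'\<close>, so a polynomial loop in \<open>(r, q)\<close> enclosing the right area does the job.
\<close>

lemma horizontal_matrix_path_to_diag2:
  assumes "e > 0"
  obtains \<delta> where "\<delta> > 0"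
    "\<And>t. \<bar>t\<bar> < \<delta> \<Longrightarrow> \<exists>\<sigma> \<alpha> \<beta>. \<sigma> 0 = mat 1 \<and> \<sigma> 1 = diag2 t \<and>
       continuous_on {0..1} \<alpha> \<and> continuous_on {0..1} \<beta> \<and>
       (\<forall>s\<in>{0..1}. (\<sigma> has_vector_derivative \<sigma> s ** sl2_elem (vector [0, \<alpha> s, \<beta> s])) (at s within {0..1}) \<and>
          det (\<sigma> s) = 1 \<and> norm (\<sigma> s - mat 1) \<le> e \<and> \<bar>\<alpha> s\<bar> \<le> e \<and> \<bar>\<beta> s\<bar> \<le> e)"
proof -
  \<comment> \<open>At s = 1 the first coordinate must be \<open>exp (- t / 2)\<close>, while the
    loop chosen below encloses area \<open>w / 30\<close>; hence
    \<open>w = 30 * (1 - exp (- t / 2))\<close>. The area is a product of two amplitudes, each given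
    size \<open>sqrt \<bar>w\<bar>\<close> so that both controls are small.\<close>
  define k where "k = (\<lambda>t. sqrt \<bar>30 * (1 - exp (- t / 2))\<bar>)"
  have "isCont k 0" unfolding k_def by (intro continuous_intros) auto
  then have "(k \<longlongrightarrow> 0) (at 0)" by (simp add: isCont_def k_def)
  \<comment> \<open>The bound 1/10 keeps \<open>p\<close> between 1/2 and 2. The number 26 covers
    the largest of the estimates at the end, \<open>2 * 13 * k t\<close> for
    \<open>\<alpha>\<close>.\<close>
  moreover have "min (1/10) (e / 26) > 0" using assms by simp
  ultimately have "\<forall>\<^sub>F t in at 0. k t < min (1/10) (e / 26)"
    by (rule order_tendstoD)
  then obtain \<delta> where \<delta>: "\<delta> > 0" "\<And>t. \<lbrakk>t \<noteq> 0; \<bar>t\<bar> < \<delta>\<rbrakk> \<Longrightarrow> k t < min (1/10) (e / 26)"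
    by (auto simp: eventually_at)
  show ?thesis
  proof (rule that[OF \<delta>(1)])
    fix t :: real assume t: "\<bar>t\<bar> < \<delta>"
    define w where "w = 30 * (1 - exp (- t / 2))"
    define \<kappa>1 where "\<kappa>1 = k t"
    define \<kappa>2 where "\<kappa>2 = sgn w * k t"
    have k0: "k t \<ge> 0" by (simp add: k_def)
    have kt: "k t < 1/10" "26 * k t \<le> e"
      using \<delta>(2)[OF _ t] assms by (cases "t = 0"; force simp: k_def)+
    have kk: "k t * k t = \<bar>w\<bar>" by (simp add: k_def w_def)
    have "\<kappa>1 * \<kappa>2 = sgn w * (k t * k t)" by (simp add: \<kappa>1_def \<kappa>2_def)
    then have prod: "\<kappa>1 * \<kappa>2 = w" unfolding kk by (simp add: sgn_mult_abs)
    have ab: "\<bar>\<kappa>1\<bar> \<le> k t" "\<bar>\<kappa>2\<bar> \<le> k t" using k0 by (auto simp: \<kappa>1_def \<kappa>2_def abs_mult abs_sgn_eq)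
    define I where "I = (\<lambda>s::real. s^2 / 2 - 5 * s^3 / 3 + 2 * s^4 - 4 * s^5 / 5)"
    define p where "p = (\<lambda>s. 1 - w * I s)"
    \<comment> \<open>\<open>q\<close> is a multiple of s (1 - s) (1 - 2s) and \<open>r\<close> of s
      (1 - s), so the loop closes up. The factor 1 - 2s also occurs in \<open>r'\<close>, which
      gives \<open>q * r'\<close> a constant sign and a nonzero integral; \<open>I\<close> is its
      primitive up to the factor \<open>w\<close>.\<close>
    define q where "q = (\<lambda>s::real. \<kappa>1 * (s - 3 * s^2 + 2 * s^3))"
    define q' where "q' = (\<lambda>s::real. \<kappa>1 * (1 - 6 * s + 6 * s^2))"
    define r where "r = (\<lambda>s::real. \<kappa>2 * (s - s^2))"
    define r' where "r' = (\<lambda>s::real. \<kappa>2 * (1 - 2 * s))"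
    \<comment> \<open>The controls are read off by comparing entries in \<open>\<sigma>' = \<sigma>
      ** sl2_elem (vector [0, \<alpha>, \<beta>])\<close>. The 2 in \<open>\<beta>\<close>
      compensates the 1/2 in the matrix of Z.\<close>
    define \<alpha> where "\<alpha> = (\<lambda>s. p s * q' s)"
    define \<beta> where "\<beta> = (\<lambda>s. 2 * r' s / (p s)^2)"
    define \<sigma> where "\<sigma> = (\<lambda>s. mat2 (1 / p s) (q s) (r s / p s) (p s + q s * r s))"
    have dq: "(q has_real_derivative q' s) (at s within {0..1})" for s
      unfolding q_def q'_def by (auto intro!: derivative_eq_intros simp: algebra_simps)
    have dr: "(r has_real_derivative r' s) (at s within {0..1})" for s
      unfolding r_def r'_def by (auto intro!: derivative_eq_intros simp: algebra_simps)
    have dI: "(I has_real_derivative (s - 5 * s^2 + 8 * s^3 - 4 * s^4)) (at s within {0..1})" for s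
      unfolding I_def by (auto intro!: derivative_eq_intros simp: field_simps)
    have qr': "q s * r' s = w * (s - 5 * s^2 + 8 * s^3 - 4 * s^4)" for s
      unfolding q_def r'_def prod[symmetric] by (simp add: algebra_simps power2_eq_square power3_eq_cube power4_eq_xxxx)
    have dp: "(p has_real_derivative - q s * r' s) (at s within {0..1})" for s
      using DERIV_diff[OF DERIV_const[of 1] DERIV_cmult[OF dI, of w s]] qr'[of s] by (simp add: p_def[abs_def])
    have pows: "0 \<le> s^n" "s^n \<le> 1" if "s \<in> {0..1}" for s :: real and n
      using that by (auto intro: power_le_one)
    \<comment> \<open>On the unit interval a polynomial is bounded by the sum of the absolute values
      of its coefficients; for \<open>I\<close> this sum is just below 5.\<close>
    have bound: "\<bar>I s\<bar> \<le> 5 \<and> \<bar>s - 3 * s^2 + 2 * s^3\<bar> \<le> 6 \<and> \<bar>1 - 6 * s + 6 * s^2\<bar> \<le> 13 \<and>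
        \<bar>s - s^2\<bar> \<le> 2 \<and> \<bar>1 - 2 * s\<bar> \<le> 3" if s: "s \<in> {0..1}" for s
    proof -
      have "0 \<le> s" "s \<le> 1" using s by auto
      then show ?thesis
        using pows[OF s, of 2] pows[OF s, of 3] pows[OF s, of 4] pows[OF s, of 5]
        unfolding I_def abs_le_iff by (intro conjI; linarith)
    qed
    have mul: "\<bar>\<kappa> * x\<bar> \<le> k t * c" if "\<bar>\<kappa>\<bar> \<le> k t" "\<bar>x\<bar> \<le> c" for \<kappa> x c
      unfolding abs_mult using that k0 by (intro mult_mono) auto
    have ineq: "\<bar>p s - 1\<bar> \<le> k t / 2" "\<bar>q s\<bar> \<le> k t * 6" "\<bar>q' s\<bar> \<le> k t * 13" "\<bar>r s\<bar> \<le> k t * 2" "\<bar>r' s\<bar> \<le> k t * 3"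
      if s: "s \<in> {0..1}" for s
    proof -
      have "\<bar>p s - 1\<bar> = k t * k t * \<bar>I s\<bar>" by (simp add: p_def abs_mult kk)
      also have "\<dots> \<le> k t * k t * 5"
        using bound[OF s] k0 by (intro mult_left_mono) auto
      also have "\<dots> \<le> k t * (1/10) * 5" using kt k0 by (intro mult_right_mono mult_left_mono) auto
      finally show "\<bar>p s - 1\<bar> \<le> k t / 2" by simp
    qed (use bound[OF s] ab mul in \<open>auto simp: q_def q'_def r_def r'_def\<close>)
    have p_bd: "1/2 \<le> p s" "p s \<le> 2" if "s \<in> {0..1}" for s
      using ineq(1)[OF that] kt(1) by linarith+
    have D: "(\<sigma> has_vector_derivative \<sigma> s ** sl2_elem (vector [0, \<alpha> s, \<beta> s])) (at s within {0..1})"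
      if s: "s \<in> {0..1}" for s
    proof -
      have p0: "p s \<noteq> 0" using p_bd(1)[OF s] by auto
      have "((\<lambda>s. 1 / p s) has_real_derivative q s * r' s / (p s)^2) (at s within {0..1})"
        using DERIV_divide[OF DERIV_const[of 1] dp p0] by (simp add: power2_eq_square)
      moreover have "((\<lambda>s. r s / p s) has_real_derivative r' s / (p s)^2 * (p s + q s * r s)) (at s within {0..1})"
        using DERIV_divide[OF dr dp p0]
        by (rule DERIV_cong) (simp add: power2_eq_square algebra_simps)
      moreover have "((\<lambda>s. p s + q s * r s) has_real_derivative q' s * r s) (at s within {0..1})"
        using DERIV_add[OF dp DERIV_mult[OF dq dr, of s]] by (simp add: algebra_simps)
      ultimately have "(\<sigma> has_vector_derivative mat2 (q s * r' s / (p s)^2) (q' s)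
          (r' s / (p s)^2 * (p s + q s * r s)) (q' s * r s)) (at s within {0..1})"
        using dq[of s] unfolding \<sigma>_def has_real_derivative_iff_has_vector_derivative
        by (intro has_vector_derivative_mat2)
      moreover have "mat2 (q s * r' s / (p s)^2) (q' s) (r' s / (p s)^2 * (p s + q s * r s)) (q' s * r s)
          = \<sigma> s ** sl2_elem (vector [0, \<alpha> s, \<beta> s])"
        using p0 by (simp add: mat2_eq_iff \<sigma>_def sl2_elem_def \<alpha>_def \<beta>_def)
      ultimately show ?thesis by simp
    qed
    have det: "det (\<sigma> s) = 1" if "s \<in> {0..1}" for s
      using p_bd(1)[OF that] by (simp add: det_2 \<sigma>_def field_simps)
    have dist: "norm (\<sigma> s - mat 1) \<le> e" if s: "s \<in> {0..1}" for s
    proof -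
      note i = ineq[OF s] and pb = p_bd[OF s]
      have inv_le: "0 \<le> 1 / p s" "1 / p s \<le> 2" using pb(1) by (auto simp: divide_le_eq)
      have "1 / p s - 1 = - (p s - 1) * (1 / p s)" using pb(1) by (simp add: diff_divide_distrib)
      then have "\<bar>1 / p s - 1\<bar> = \<bar>p s - 1\<bar> * (1 / p s)" using inv_le(1) by (simp only: abs_mult abs_minus_cancel abs_of_nonneg)
      also have "\<dots> \<le> k t / 2 * 2" using i(1) inv_le k0 by (intro mult_mono) auto
      finally have 1: "\<bar>1 / p s - 1\<bar> \<le> k t" by simp
      have "\<bar>r s / p s\<bar> = \<bar>r s\<bar> * (1 / p s)" using pb(1) by simp
      also have "\<dots> \<le> k t * 2 * 2" using i(4) inv_le k0 by (intro mult_mono) auto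
      finally have 2: "\<bar>r s / p s\<bar> \<le> 4 * k t" by simp
      have "\<bar>q s * r s\<bar> \<le> (k t * 6) * (k t * 2)" unfolding abs_mult using i k0 by (intro mult_mono) auto
      also have "\<dots> \<le> (1 / 10 * 6) * (k t * 2)" using kt k0 by (intro mult_right_mono) auto
      finally have 3: "\<bar>q s * r s\<bar> \<le> 2 * k t" using k0 by linarith
      have "norm (\<sigma> s - mat 1) \<le> \<bar>1 / p s - 1\<bar> + \<bar>q s\<bar> + \<bar>r s / p s\<bar> + \<bar>p s + q s * r s - 1\<bar>"
        using norm_matrix2_le[of "\<sigma> s - mat 1"] by (simp add: \<sigma>_def)
      also have "\<dots> \<le> 26 * k t" using 1 2 3 i(1,2) k0 by linarith
      finally show ?thesis using kt(2) by simp
    qed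
    have ctrl: "\<bar>\<alpha> s\<bar> \<le> e" "\<bar>\<beta> s\<bar> \<le> e" if s: "s \<in> {0..1}" for s
    proof -
      note i = ineq[OF s] and pb = p_bd[OF s]
      have "\<bar>\<alpha> s\<bar> \<le> 2 * (k t * 13)"
        unfolding \<alpha>_def abs_mult using i pb k0 by (intro mult_mono) auto
      then show "\<bar>\<alpha> s\<bar> \<le> e" using kt(2) by simp
      have "(1/2)^2 \<le> (p s)^2" using pb by (intro power_mono) auto
      then have "\<bar>\<beta> s\<bar> \<le> (2 * \<bar>r' s\<bar>) / (1/2)^2"
        unfolding \<beta>_def abs_divide abs_mult using pb by (intro frac_le) auto
      also have "\<dots> \<le> 26 * k t" using i(5) k0 by (simp add: power2_eq_square)
      finally show "\<bar>\<beta> s\<bar> \<le> e" using kt(2) by simp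
    qed
    have "continuous_on {0..1} \<alpha>" "continuous_on {0..1} \<beta>"
      unfolding \<alpha>_def \<beta>_def p_def q'_def r'_def I_def
      by (intro continuous_intros; use p_bd in \<open>force simp: p_def I_def\<close>)+
    moreover have "\<sigma> 0 = mat 1" by (simp add: \<sigma>_def p_def q_def r_def I_def mat2_eq_iff)
    moreover have "\<sigma> 1 = diag2 t"
      by (simp add: \<sigma>_def p_def q_def r_def I_def mat2_eq_iff diag2_def w_def exp_minus field_simps)
    ultimately show "\<exists>\<sigma> \<alpha> \<beta>. \<sigma> 0 = mat 1 \<and> \<sigma> 1 = diag2 t \<and>
       continuous_on {0..1} \<alpha> \<and> continuous_on {0..1} \<beta> \<and>
       (\<forall>s\<in>{0..1}. (\<sigma> has_vector_derivative \<sigma> s ** sl2_elem (vector [0, \<alpha> s, \<beta> s])) (at s within {0..1}) \<and>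
          det (\<sigma> s) = 1 \<and> norm (\<sigma> s - mat 1) \<le> e \<and> \<bar>\<alpha> s\<bar> \<le> e \<and> \<bar>\<beta> s\<bar> \<le> e)"
      using D det dist ctrl by (intro exI[of _ \<sigma>] exI[of _ \<alpha>] exI[of _ \<beta>]) simp
  qed
qed

section \<open>Paths in manifolds\<close>

lemma AE_lebesgue_on_interval_iff:
  fixes a b :: real
  shows "(AE s in lebesgue_on {a..b}. P s) \<longleftrightarrow> negligible {s \<in> {a..b}. \<not> P s}"
proof -
  have "(AE s in lebesgue_on {a..b}. P s) \<longleftrightarrow> (AE s in lebesgue. s \<in> {a..b} \<longrightarrow> P s)"
    by (rule AE_restrict_space_iff) simp
  also have "\<dots> \<longleftrightarrow> {s \<in> {a..b}. \<not> P s} \<in> null_sets lebesgue"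
  proof
    assume "AE s in lebesgue. s \<in> {a..b} \<longrightarrow> P s"
    then obtain N where "N \<in> null_sets lebesgue" "{s. \<not> (s \<in> {a..b} \<longrightarrow> P s)} \<subseteq> N"
      by (auto simp: eventually_ae_filter)
    then show "{s \<in> {a..b}. \<not> P s} \<in> null_sets lebesgue"
      by (intro completion.complete2[of "{s \<in> {a..b}. \<not> P s}" N lborel]) auto
  next
    assume "{s \<in> {a..b}. \<not> P s} \<in> null_sets lebesgue"
    then show "AE s in lebesgue. s \<in> {a..b} \<longrightarrow> P s"
      by (rule AE_I') auto
  qed
  finally show ?thesis by (simp add: negligible_iff_null_sets)
qed

section \<open>Lipschitz curves and C^1 maps\<close>

lemma lipschitz_on_imp_abs_continuous_on:
  assumes "L-lipschitz_on {a..b} h"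
  shows "abs_continuous_on a b h"
  unfolding abs_continuous_on_def
proof (intro allI impI)
  fix e :: real assume e: "e > 0"
  have L: "L \<ge> 0" using assms by (rule lipschitz_on_nonneg)
  show "\<exists>d>0. \<forall>D T. D division_of T \<and> T \<subseteq> {a..b} \<and> (\<Sum>I\<in>D. Sup I - Inf I) < d \<longrightarrow>
      (\<Sum>I\<in>D. norm (h (Sup I) - h (Inf I))) < e"
  proof (intro exI[of _ "e / (L + 1)"] conjI allI impI)
    fix D T assume D: "D division_of T \<and> T \<subseteq> {a..b} \<and> (\<Sum>I\<in>D. Sup I - Inf I) < e / (L + 1)"
    have int: "\<exists>c d. I = {c..d} \<and> c \<le> d \<and> a \<le> c \<and> d \<le> b" if I: "I \<in> D" for I
    proof -
      obtain c d where "I = {c..d}" "I \<noteq> {}" "I \<subseteq> T"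
        using division_ofD(2-4)[OF conjunct1[OF D] I] by (auto simp: box_real)
      with D show ?thesis by fastforce
    qed
    have "(\<Sum>I\<in>D. norm (h (Sup I) - h (Inf I))) \<le> (\<Sum>I\<in>D. L * (Sup I - Inf I))"
    proof (rule sum_mono)
      fix I assume "I \<in> D"
      then obtain c d where I: "I = {c..d}" "c \<le> d" "a \<le> c" "d \<le> b" using int by blast
      then have "dist (h d) (h c) \<le> L * dist d c" by (intro lipschitz_onD[OF assms]) auto
      then show "norm (h (Sup I) - h (Inf I)) \<le> L * (Sup I - Inf I)" using I by (simp add: dist_norm)
    qed
    also have "\<dots> = L * (\<Sum>I\<in>D. Sup I - Inf I)" by (simp add: sum_distrib_left)
    also have "\<dots> \<le> L * (e / (L + 1))" using D L by (intro mult_left_mono) auto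
    also have "\<dots> < e" using L e by (simp add: field_simps)
    finally show "(\<Sum>I\<in>D. norm (h (Sup I) - h (Inf I))) < e" .
  qed (use e L in auto)
qed

lemma C1_locally_lipschitz:
  fixes T :: "'a::euclidean_space \<Rightarrow> 'b::real_normed_vector"
  assumes "open S" "x \<in> S"
    and T: "\<And>x. x \<in> S \<Longrightarrow> (T has_derivative blinfun_apply (T' x)) (at x)" "continuous_on S T'"
  obtains e C where "e > 0" "ball x e \<subseteq> S" "C-lipschitz_on (ball x e) T"
proof -
  have "isCont T' x" using assms continuous_on_eq_continuous_at by blast
  then obtain d where d: "d > 0" "\<And>y. dist y x < d \<Longrightarrow> dist (T' y) (T' x) < 1"
    unfolding continuous_at_eps_delta by (metis zero_less_one)
  obtain d2 where d2: "d2 > 0" "ball x d2 \<subseteq> S" using assms(1,2) open_contains_ball by blast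
  define e where "e = min d d2"
  have sub: "ball x e \<subseteq> S" using d2 by (auto simp: e_def)
  have "(norm (T' x) + 1)-lipschitz_on (ball x e) T"
  proof (rule lipschitz_onI)
    fix y z assume yz: "y \<in> ball x e" "z \<in> ball x e"
    have "norm (T y - T z) \<le> (norm (T' x) + 1) * norm (y - z)"
    proof (rule differentiable_bound[OF convex_ball _ _ yz])
      fix w assume w: "w \<in> ball x e"
      show "(T has_derivative blinfun_apply (T' w)) (at w within ball x e)"
        by (rule has_derivative_at_withinI[OF T(1)[OF subsetD[OF sub w]]])
      have "norm (T' w) \<le> norm (T' x) + norm (T' w - T' x)" by (rule norm_triangle_sub)
      also have "\<dots> \<le> norm (T' x) + 1"
        using d(2)[of w] w by (simp add: e_def dist_norm dist_commute norm_minus_commute)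
      finally show "onorm (blinfun_apply (T' w)) \<le> norm (T' x) + 1" by (simp add: norm_blinfun.rep_eq)
    qed
    then show "dist (T y) (T z) \<le> (norm (T' x) + 1) * dist y z" by (simp add: dist_norm)
  qed simp
  moreover have "e > 0" using d(1) d2(1) by (simp add: e_def)
  ultimately show ?thesis using that sub by blast
qed

text \<open>\<open>T\<close> is Lipschitz only locally on \<open>S\<close>; compactness of the
  parameter interval yields one constant along the curve. The singleton \<open>{0}\<close> serves as
  a dummy time, since local Lipschitz continuity is phrased for time-dependent maps.\<close>

lemma lipschitz_on_C1_compose:
  fixes \<xi> :: "real \<Rightarrow> 'a::euclidean_space" and T :: "'a \<Rightarrow> 'b::real_normed_vector"
  assumes \<xi>: "L-lipschitz_on {a..b} \<xi>" and S: "open S" "\<xi> ` {a..b} \<subseteq> S"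
    and T: "\<And>x. x \<in> S \<Longrightarrow> (T has_derivative blinfun_apply (T' x)) (at x)" "continuous_on S T'"
  obtains L' where "L'-lipschitz_on {a..b} (\<lambda>s. T (\<xi> s))"
proof -
  have "local_lipschitz {0::real} {a..b} (\<lambda>_ s. T (\<xi> s))"
  proof (rule local_lipschitzI)
    fix t s :: real assume s: "s \<in> {a..b}"
    then have "\<xi> s \<in> S" using S(2) by blast
    obtain e C where e: "e > 0" "C-lipschitz_on (ball (\<xi> s) e) T"
      by (rule C1_locally_lipschitz[OF S(1) \<open>\<xi> s \<in> S\<close> T])
    define u where "u = e / (2 * (L + 1))"
    have L: "L \<ge> 0" using \<xi> by (rule lipschitz_on_nonneg)
    have u: "u > 0" using e L by (simp add: u_def)
    have "\<xi> ` (cball s u \<inter> {a..b}) \<subseteq> ball (\<xi> s) e"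
    proof safe
      fix x assume x: "x \<in> cball s u" "x \<in> {a..b}"
      have "dist (\<xi> s) (\<xi> x) \<le> L * dist s x" using x s by (intro lipschitz_onD[OF \<xi>]) auto
      also have "\<dots> \<le> L * u" using x L by (intro mult_left_mono) auto
      also have "\<dots> < e"
      proof -
        have "L + 1 \<noteq> 0" using L by linarith
        then have "(L + 1) * u = e / 2" by (simp add: u_def field_simps)
        then show ?thesis using u e(1) by (simp add: distrib_right)
      qed
      finally show "\<xi> x \<in> ball (\<xi> s) e" by simp
    qed
    then have "(C * L)-lipschitz_on (cball s u \<inter> {a..b}) (T \<circ> \<xi>)"
      by (intro lipschitz_on_compose lipschitz_on_subset[OF \<xi>] lipschitz_on_subset[OF e(2)]) auto
    then show "\<exists>u>0. \<exists>L. \<forall>t\<in>cball t u \<inter> {0}. L-lipschitz_on (cball s u \<inter> {a..b}) (\<lambda>s. T (\<xi> s))"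
      using u by (auto simp: o_def)
  qed
  then obtain L' where "\<And>t. t \<in> {0::real} \<Longrightarrow> L'-lipschitz_on {a..b} (\<lambda>s. T (\<xi> s))"
    by (rule local_lipschitz_compact_implies_lipschitz) auto
  then show ?thesis using that by blast
qed

text \<open>\<open>Ck_on\<close> asks for continuity of the derivative in each fixed direction. In
  finite dimension this amounts to continuity in operator norm, the form used by the inverse
  function theorem and by the estimates above.\<close>

lemma Ck_on_1_blinfun:
  fixes f :: "'b::euclidean_space \<Rightarrow> 'c::real_normed_vector"
  assumes "Ck_on 1 f S"
  shows "\<And>x. x \<in> S \<Longrightarrow> (f has_derivative blinfun_apply (Blinfun (frechet_derivative f (at x)))) (at x)"
    and "continuous_on S (\<lambda>x. Blinfun (frechet_derivative f (at x)))"
    and "\<And>x. x \<in> S \<Longrightarrow> blinfun_apply (Blinfun (frechet_derivative f (at x))) = frechet_derivative f (at x)"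
proof -
  have diff: "f differentiable (at x)" if "x \<in> S" for x using assms that by simp
  show *: "blinfun_apply (Blinfun (frechet_derivative f (at x))) = frechet_derivative f (at x)" if "x \<in> S" for x
    by (rule bounded_linear_Blinfun_apply)
      (rule has_derivative_bounded_linear[OF frechet_derivative_works[THEN iffD1, OF diff[OF that]]])
  show "(f has_derivative blinfun_apply (Blinfun (frechet_derivative f (at x)))) (at x)" if "x \<in> S" for x
    unfolding *[OF that] using diff[OF that] frechet_derivative_works by blast
  show "continuous_on S (\<lambda>x. Blinfun (frechet_derivative f (at x)))"
  proof (rule continuous_on_blinfun_componentwise)
    fix i :: 'b
    have "continuous_on S (\<lambda>x. frechet_derivative f (at x) i)" using assms by simp
    then show "continuous_on S (\<lambda>x. blinfun_apply (Blinfun (frechet_derivative f (at x))) i)"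
      by (rule continuous_on_eq) (simp add: *)
  qed
qed

section \<open>Charts, tangent vectors and velocities\<close>

locale smooth_manifold =
  fixes A :: "('a::{t2_space,second_countable_topology}, 'b::euclidean_space) chart set"
  assumes atlas: "smooth_atlas A"
begin

lemma chart_open: "c \<in> A \<Longrightarrow> open (fst c)" "c \<in> A \<Longrightarrow> open (snd c ` fst c)"
  using atlas by (auto simp: smooth_atlas_def)

lemma chart_hom: "c \<in> A \<Longrightarrow> homeomorphism (fst c) (snd c ` fst c) (snd c) (chart_inv c)"
  using atlas by (auto simp: smooth_atlas_def)

lemma chart_inv_left [simp]: "\<lbrakk>c \<in> A; p \<in> fst c\<rbrakk> \<Longrightarrow> chart_inv c (snd c p) = p"
  using chart_hom[of c] by (auto simp: homeomorphism_def)

lemma chart_inv_right [simp]: "\<lbrakk>c \<in> A; u \<in> snd c ` fst c\<rbrakk> \<Longrightarrow> snd c (chart_inv c u) = u"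
  using chart_hom[of c] by (auto simp: homeomorphism_def)

lemma chart_inv_in [simp]: "\<lbrakk>c \<in> A; u \<in> snd c ` fst c\<rbrakk> \<Longrightarrow> chart_inv c u \<in> fst c"
  using chart_hom[of c] by (auto simp: homeomorphism_def)

lemma continuous_on_chart: "c \<in> A \<Longrightarrow> continuous_on (fst c) (snd c)"
  using chart_hom[of c] by (auto simp: homeomorphism_def)

lemma continuous_on_chart_inv: "c \<in> A \<Longrightarrow> continuous_on (snd c ` fst c) (chart_inv c)"
  using chart_hom[of c] by (auto simp: homeomorphism_def)

lemma chart_at_exists: obtains c where "c \<in> A" "p \<in> fst c"
  using atlas unfolding smooth_atlas_def by blast

lemma transition_C1:
  assumes "c \<in> A" "c' \<in> A"
  shows "Ck_on 1 (snd c' \<circ> chart_inv c) (snd c ` (fst c \<inter> fst c'))"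
    and "open (snd c ` (fst c \<inter> fst c'))"
proof -
  show "Ck_on 1 (snd c' \<circ> chart_inv c) (snd c ` (fst c \<inter> fst c'))"
    using atlas assms by (simp add: smooth_atlas_def smooth_map_on_def del: One_nat_def Ck_on.simps)
  have "snd c ` (fst c \<inter> fst c') = snd c ` fst c \<inter> chart_inv c -` fst c'"
  proof (intro equalityI subsetI)
    fix u assume u: "u \<in> snd c ` fst c \<inter> chart_inv c -` fst c'"
    then have "u = snd c (chart_inv c u)" "chart_inv c u \<in> fst c \<inter> fst c'" using assms by auto
    then show "u \<in> snd c ` (fst c \<inter> fst c')" by blast
  qed (use assms in auto)
  then show "open (snd c ` (fst c \<inter> fst c'))"
    using continuous_open_preimage[OF continuous_on_chart_inv chart_open(2) chart_open(1)] assms by simp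
qed

lemma tangent_vector_chart:
  assumes "v \<in> tangent_space A p" "c \<in> charts_at A p" "c' \<in> charts_at A p"
  shows "v c' = frechet_derivative (snd c' \<circ> chart_inv c) (at (snd c p)) (v c)"
  using assms unfolding tangent_space_def by blast

lemma velocity_chart:
  assumes "path_differentiable A S \<gamma> s" "c \<in> charts_at A (\<gamma> s)"
  shows "((snd c \<circ> \<gamma>) has_vector_derivative velocity A S \<gamma> s c) (at s within S)"
  using assms by (auto simp: path_differentiable_def velocity_def vector_derivative_works)

text \<open>Differentiability in a single chart suffices: in any other chart the chain rule applies
  the derivative of the transition map, which is how the family \<open>v\<close> transforms. The
  assumption \<open>a < b\<close> makes the derivative within the interval unique, also at its end
  points.\<close>

lemma velocity_eqI:
  assumes ab: "a < b" and s: "s \<in> {a..b}" and c0: "c0 \<in> charts_at A (\<gamma> s)"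
    and cont: "continuous_on {a..b} \<gamma>" and v: "v \<in> tangent_space A (\<gamma> s)"
    and der: "((snd c0 \<circ> \<gamma>) has_vector_derivative v c0) (at s within {a..b})"
  shows "path_differentiable A {a..b} \<gamma> s" "velocity A {a..b} \<gamma> s = v"
proof -
  have c0A: "c0 \<in> A" "\<gamma> s \<in> fst c0" using c0 by (auto simp: charts_at_def)
  have ev: "\<forall>\<^sub>F s' in at s within {a..b}. \<gamma> s' \<in> fst c0"
    using cont s c0A chart_open(1)[OF c0A(1)]
    unfolding continuous_on_def by (blast dest: topological_tendstoD)
  have *: "((snd c \<circ> \<gamma>) has_vector_derivative v c) (at s within {a..b})" if c: "c \<in> charts_at A (\<gamma> s)" for c
  proof -
    let ?T = "snd c \<circ> chart_inv c0" and ?u = "snd c0 (\<gamma> s)"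
    have cA: "c \<in> A" "\<gamma> s \<in> fst c" using c by (auto simp: charts_at_def)
    have "?u \<in> snd c0 ` (fst c0 \<inter> fst c)" using c0A cA by blast
    then have T: "(?T has_derivative frechet_derivative ?T (at ?u)) (at ?u)"
      using Ck_on_1_blinfun(1,3)[OF transition_C1(1)[OF c0A(1) cA(1)], of ?u] by simp
    have "((\<lambda>s. ?T ((snd c0 \<circ> \<gamma>) s)) has_derivative
        (\<lambda>h. frechet_derivative ?T (at ?u) (h *\<^sub>R v c0))) (at s within {a..b})"
      by (rule has_derivative_compose[OF der[unfolded has_vector_derivative_def]]) (simp only: o_apply[of "snd c0"] T)
    also have "(\<lambda>h. frechet_derivative ?T (at ?u) (h *\<^sub>R v c0)) = (\<lambda>h. h *\<^sub>R v c)"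
      using linear_scale[OF has_derivative_linear[OF T]] tangent_vector_chart[OF v c0 c] by simp
    finally show ?thesis
      unfolding has_vector_derivative_def
      by (rule has_derivative_transform_eventually)
        (use ev c0A s in \<open>auto elim!: eventually_mono\<close>)
  qed
  show "path_differentiable A {a..b} \<gamma> s"
    unfolding path_differentiable_def using differentiableI_vector[OF *] by blast
  have "s islimpt {a..b}" using s ab by (simp add: islimpt_Icc)
  then have nt: "at s within {a..b} \<noteq> bot" by (simp add: trivial_limit_within)
  show "velocity A {a..b} \<gamma> s = v"
  proof
    fix c
    show "velocity A {a..b} \<gamma> s c = v c"
    proof (cases "c \<in> charts_at A (\<gamma> s)")
      case True
      then show ?thesis using vector_derivative_within[OF nt *[OF True]] by (simp add: velocity_def)
    next
      case False
      then show ?thesis using v[unfolded tangent_space_def] unfolding velocity_def by (simp del: split_paired_All)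
    qed
  qed
qed

text \<open>In any other chart the path is \<open>\<xi>\<close> followed by a transition map, which
  is C^1 and hence Lipschitz along each compact piece lying in the overlap.\<close>

lemma abs_continuous_path_chart_inv:
  assumes c0: "c0 \<in> A" and \<xi>: "L-lipschitz_on {a..b} \<xi>" and img: "\<xi> ` {a..b} \<subseteq> snd c0 ` fst c0"
  shows "abs_continuous_path A a b (\<lambda>s. chart_inv c0 (\<xi> s))"
  unfolding abs_continuous_path_def
proof (intro conjI ballI allI impI)
  show "continuous_on {a..b} (\<lambda>s. chart_inv c0 (\<xi> s))"
    by (rule continuous_on_compose2[OF continuous_on_chart_inv[OF c0] lipschitz_on_continuous_on[OF \<xi>] img])
  fix c a' b' assume c: "c \<in> A" and sub: "{a'..b'} \<subseteq> {a..b} \<and> (\<lambda>s. chart_inv c0 (\<xi> s)) ` {a'..b'} \<subseteq> fst c"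
  have "\<xi> ` {a'..b'} \<subseteq> snd c0 ` (fst c0 \<inter> fst c)"
  proof safe
    fix s assume s: "s \<in> {a'..b'}"
    have "\<xi> s \<in> snd c0 ` fst c0" "chart_inv c0 (\<xi> s) \<in> fst c" using s sub img by blast+
    then show "\<xi> s \<in> snd c0 ` (fst c0 \<inter> fst c)"
      using c0 by (intro image_eqI[of _ _ "chart_inv c0 (\<xi> s)"]) auto
  qed
  from lipschitz_on_C1_compose[OF lipschitz_on_subset[OF \<xi> conjunct1[OF sub]] transition_C1(2)[OF c0 c] this
      Ck_on_1_blinfun(1,2)[OF transition_C1(1)[OF c0 c]]]
  obtain L' where "L'-lipschitz_on {a'..b'} (\<lambda>s. (snd c \<circ> chart_inv c0) (\<xi> s))" by blast
  then show "abs_continuous_on a' b' (snd c \<circ> (\<lambda>s. chart_inv c0 (\<xi> s)))"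
    by (intro lipschitz_on_imp_abs_continuous_on) (simp add: o_def)
qed

end

section \<open>Balancedness of short geodesics\<close>

text \<open>The length is never differentiated under the integral. It is dominated by a smooth
  function of \<open>\<tau>\<close> with equality at 0, so minimality passes to that function, and
  its derivative at 0 is a multiple of the difference of the two energies.\<close>

lemma equal_energies_of_variation:
  fixes \<alpha> \<beta> :: "real \<Rightarrow> real"
  assumes l: "0 < l" and \<tau>0: "0 < \<tau>0"
    and unit: "\<And>s. s \<in> {0..l} \<Longrightarrow> (\<alpha> s)\<^sup>2 + (\<beta> s)\<^sup>2 = 1"
    and min: "\<And>\<tau>. \<bar>\<tau>\<bar> < \<tau>0 \<Longrightarrow> l \<le> integral {0..l} (\<lambda>s. sqrt ((exp \<tau> * \<alpha> s)\<^sup>2 + (exp (- \<tau>) * \<beta> s)\<^sup>2))"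
  shows "integral {0..l} (\<lambda>s. (\<alpha> s)\<^sup>2) = integral {0..l} (\<lambda>s. (\<beta> s)\<^sup>2)"
proof -
  define h2 where "h2 = (\<lambda>\<tau> s. (exp \<tau> * \<alpha> s)\<^sup>2 + (exp (- \<tau>) * \<beta> s)\<^sup>2)"
  text \<open>
    Measurability of \<open>\<alpha>\<close> and \<open>\<beta>\<close> is not assumed: a non-integrable integrand would have integral 0,
    contradicting minimality.
  \<close>
  have int_h: "(\<lambda>s. sqrt (h2 \<tau> s)) integrable_on {0..l}" if "\<bar>\<tau>\<bar> < \<tau>0" for \<tau>
  proof (rule ccontr)
    assume "\<not> (\<lambda>s. sqrt (h2 \<tau> s)) integrable_on {0..l}"
    then have "integral {0..l} (\<lambda>s. sqrt (h2 \<tau> s)) = 0" by (rule not_integrable_integral)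
    with min[OF that] l show False by (simp add: h2_def)
  qed
  have exp2: "(exp \<tau>)\<^sup>2 = exp (2 * \<tau>)" for \<tau> :: real
    by (simp add: exp_double)
  have h2_eq: "h2 \<tau> s = exp (2 * \<tau>) * (\<alpha> s)\<^sup>2 + exp (- (2 * \<tau>)) * (\<beta> s)\<^sup>2" for \<tau> s
    by (simp add: h2_def power_mult_distrib exp2)
  \<comment> \<open>One nonzero parameter is enough: because \<open>\<beta>\<close> squared is 1
    minus \<open>\<alpha>\<close> squared, the squared integrand at \<open>\<tau>1\<close> is affine
    in the square of \<open>\<alpha>\<close> with slope \<open>k > 0\<close>, so that square
    inherits measurability.\<close>
  define \<tau>1 where "\<tau>1 = \<tau>0 / 2"
  have \<tau>1: "0 < \<tau>1" "\<bar>\<tau>1\<bar> < \<tau>0" using \<tau>0 by (auto simp: \<tau>1_def)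
  define k where "k = exp (2 * \<tau>1) - exp (- (2 * \<tau>1))"
  have k: "k > 0" using \<tau>1 by (simp add: k_def)
  have b2: "(\<beta> s)\<^sup>2 = 1 - (\<alpha> s)\<^sup>2" if "s \<in> {0..l}" for s using unit[OF that] by simp
  have a2: "(\<alpha> s)\<^sup>2 = ((sqrt (h2 \<tau>1 s))\<^sup>2 - exp (- (2 * \<tau>1))) / k" if "s \<in> {0..l}" for s
  proof -
    have "(sqrt (h2 \<tau>1 s))\<^sup>2 = h2 \<tau>1 s" by (simp add: h2_def)
    also have "\<dots> = exp (2 * \<tau>1) * (\<alpha> s)\<^sup>2 + exp (- (2 * \<tau>1)) * (1 - (\<alpha> s)\<^sup>2)"
      by (simp add: h2_eq b2[OF that])
    finally have "(sqrt (h2 \<tau>1 s))\<^sup>2 - exp (- (2 * \<tau>1)) = k * (\<alpha> s)\<^sup>2"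
      by (simp add: k_def algebra_simps)
    then show ?thesis using k by simp
  qed
  have int_a: "(\<lambda>s. (\<alpha> s)\<^sup>2) integrable_on {0..l}"
  proof (rule measurable_bounded_by_integrable_imp_integrable)
    have "(\<lambda>s. sqrt (h2 \<tau>1 s)) \<in> borel_measurable (lebesgue_on {0..l})"
      by (rule integrable_imp_measurable[OF int_h[OF \<tau>1(2)]])
    then have "(\<lambda>s. ((sqrt (h2 \<tau>1 s))\<^sup>2 - exp (- (2 * \<tau>1))) / k) \<in> borel_measurable (lebesgue_on {0..l})"
      by (intro borel_measurable_divide borel_measurable_diff borel_measurable_power borel_measurable_const)
    then show "(\<lambda>s. (\<alpha> s)\<^sup>2) \<in> borel_measurable (lebesgue_on {0..l})"
      by (rule measurable_cong[THEN iffD1, rotated]) (simp add: a2)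
    show "norm ((\<alpha> s)\<^sup>2) \<le> 1" if "s \<in> {0..l}" for s
      using b2[OF that] zero_le_power2[of "\<beta> s"] by simp
  qed auto
  have int_b: "(\<lambda>s. (\<beta> s)\<^sup>2) integrable_on {0..l}"
    by (rule integrable_eq[OF integrable_diff[OF integrable_const_ivl[of 1] int_a]]) (simp add: b2)
  define a where "a = integral {0..l} (\<lambda>s. (\<alpha> s)\<^sup>2)"
  define b where "b = integral {0..l} (\<lambda>s. (\<beta> s)\<^sup>2)"
  have "a + b = integral {0..l} (\<lambda>s. (\<alpha> s)\<^sup>2 + (\<beta> s)\<^sup>2)"
    unfolding a_def b_def by (rule integral_add[OF int_a int_b, symmetric])
  also have "\<dots> = integral {0..l} (\<lambda>s. 1)" by (rule integral_cong) (rule unit)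
  finally have ab: "a + b = l" using l by simp
  text \<open>AM-GM in the form \<open>\<surd>z \<le> (1 + z) / 2\<close> linearizes the length.\<close>
  have key: "a + b \<le> exp (2 * \<tau>) * a + exp (- (2 * \<tau>)) * b" if \<tau>: "\<bar>\<tau>\<bar> < \<tau>0" for \<tau>
  proof -
    have "((\<lambda>s. (\<alpha> s)\<^sup>2) has_integral a) {0..l}" "((\<lambda>s. (\<beta> s)\<^sup>2) has_integral b) {0..l}"
      unfolding a_def b_def using int_a int_b by (auto intro: integrable_integral)
    then have "((\<lambda>s. exp (2 * \<tau>) * (\<alpha> s)\<^sup>2 + exp (- (2 * \<tau>)) * (\<beta> s)\<^sup>2) has_integral
        (exp (2 * \<tau>) * a + exp (- (2 * \<tau>)) * b)) {0..l}"
      by (intro has_integral_add has_integral_mult_right)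
    from has_integral_divide[OF has_integral_add[OF has_integral_const_real[of 1 0 l] this], of 2]
    have "((\<lambda>s. (1 + h2 \<tau> s) / 2) has_integral (l + (exp (2 * \<tau>) * a + exp (- (2 * \<tau>)) * b)) / 2) {0..l}"
      using l by (simp add: h2_eq)
    moreover have "((\<lambda>s. sqrt (h2 \<tau> s)) has_integral integral {0..l} (\<lambda>s. sqrt (h2 \<tau> s))) {0..l}"
      by (rule integrable_integral[OF int_h[OF \<tau>]])
    moreover have "sqrt (h2 \<tau> s) \<le> (1 + h2 \<tau> s) / 2" for s
      using arith_geo_mean_sqrt[of 1 "h2 \<tau> s"] by (simp add: h2_def)
    ultimately have "integral {0..l} (\<lambda>s. sqrt (h2 \<tau> s)) \<le> (l + (exp (2 * \<tau>) * a + exp (- (2 * \<tau>)) * b)) / 2"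
      by (blast intro: has_integral_le)
    then show ?thesis using min[OF \<tau>] ab by (simp add: h2_def)
  qed
  define \<phi> where "\<phi> = (\<lambda>\<tau>. exp (2 * \<tau>) * a + exp (- (2 * \<tau>)) * b)"
  have "DERIV \<phi> 0 :> 2 * a - 2 * b"
    unfolding \<phi>_def by (auto intro!: derivative_eq_intros)
  then have "2 * a - 2 * b = 0"
    by (rule DERIV_local_min[OF _ \<tau>0]) (use key in \<open>auto simp: \<phi>_def\<close>)
  then show ?thesis by (simp add: a_def b_def)
qed

section \<open>The frame of a special contact flow in charts\<close>

locale special_contact_flow = smooth_manifold A
  for A :: "('a::{t2_space,second_countable_topology}, real^3) chart set" +
  fixes g\<^sub>0 g :: "('a, real^3) metric"
    and f :: "real \<Rightarrow> 'a \<Rightarrow> 'a"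
    and Ess Ec Euu :: "('a, real^3) tbundle"
    and X Y Z :: "'a \<Rightarrow> ('a, real^3) tvec"
  assumes special: "special_contact_anosov_flow A g\<^sub>0 f Ess Ec Euu g X Y Z"
begin

lemma
  shows vector_fields: "Ck_vector_field A 1 X" "Ck_vector_field A 1 Y" "Ck_vector_field A 1 Z"
    and frame: "global_frame3 A X Y Z" and ortho: "orthonormal3 g X Y Z"
    and metric: "Ck_riemannian_metric A 1 g"
    and Ess: "Ess p = span {Y p}" and Euu: "Euu p = span {Z p}"
    and brackets: "lie_bracket A X Y p = Y p" "lie_bracket A Y Z p = X p" "lie_bracket A Z X p = Z p"
    and X_def: "X = flow_generator A f"
    and flow: "smooth_flow A f"
  using special unfolding special_contact_anosov_flow_def anosov_flow_def by blast+

lemma tangent_fields: "X p \<in> tangent_space A p" "Y p \<in> tangent_space A p" "Z p \<in> tangent_space A p"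
  using vector_fields unfolding Ck_vector_field_def by blast+

lemma subspace_tangent_space: "subspace (tangent_space A p)"
  using frame subspace_span unfolding global_frame3_def by metis

lemma frame_tangent: "a *\<^sub>R X p + b *\<^sub>R Y p + c *\<^sub>R Z p \<in> tangent_space A p"
  by (intro subspace_add subspace_scale subspace_tangent_space tangent_fields)

lemma frame_independent:
  assumes "a *\<^sub>R X p + b *\<^sub>R Y p + c *\<^sub>R Z p = 0"
  shows "a = 0 \<and> b = 0 \<and> c = 0"
proof -
  have fr: "distinct [X p, Y p, Z p]" "independent {X p, Y p, Z p}"
    using frame unfolding global_frame3_def by blast+
  define u where "u = (\<lambda>v. if v = X p then a else if v = Y p then b else c)"
  have "(\<Sum>v\<in>{X p, Y p, Z p}. u v *\<^sub>R v) = 0"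
    using fr(1) assms by (auto simp: u_def add.assoc)
  then have "u v = 0" if "v \<in> {X p, Y p, Z p}" for v
    using independentD[OF fr(2) _ order_refl _ that] by simp
  then have "u (X p) = 0" "u (Y p) = 0" "u (Z p) = 0" by auto
  then show ?thesis using fr(1) by (auto simp: u_def split: if_splits)
qed

text \<open>The values in all charts are images of the value in one chart under linear transition
  derivatives. This transfers independence of the frame from tangent spaces to a single
  chart.\<close>

lemma tangent_vector_eq_0:
  assumes "v \<in> tangent_space A p" "c \<in> charts_at A p" "v c = 0"
  shows "v = 0"
proof
  fix c'
  show "v c' = 0 c'"
  proof (cases "c' \<in> charts_at A p")
    case True
    have c: "c \<in> A" "c' \<in> A" "snd c p \<in> snd c ` (fst c \<inter> fst c')"
      using assms(2) True by (auto simp: charts_at_def)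
    have "linear (frechet_derivative (snd c' \<circ> chart_inv c) (at (snd c p)))"
      using Ck_on_1_blinfun(3)[OF transition_C1(1)[OF c(1,2)] c(3)] by (metis blinfun.bounded_linear_right bounded_linear.linear)
    then show ?thesis
      using tangent_vector_chart[OF assms(1,2) True] assms(3) by (simp add: linear_0)
  next
    case False
    then show ?thesis using assms(1) unfolding tangent_space_def by (simp del: split_paired_All)
  qed
qed

definition chart_field :: "('a \<Rightarrow> ('a, real^3) tvec) \<Rightarrow> ('a, real^3) chart \<Rightarrow> real^3 \<Rightarrow> real^3" where
  "chart_field V c u = V (chart_inv c u) c"

definition chart_field' :: "('a \<Rightarrow> ('a, real^3) tvec) \<Rightarrow> ('a, real^3) chart \<Rightarrow> real^3 \<Rightarrow> (real^3) \<Rightarrow>\<^sub>L (real^3)" where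
  "chart_field' V c u = Blinfun (frechet_derivative (chart_field V c) (at u))"

lemma chart_field:
  assumes "Ck_vector_field A 1 V" "c \<in> A"
  shows "\<And>u. u \<in> snd c ` fst c \<Longrightarrow> (chart_field V c has_derivative blinfun_apply (chart_field' V c u)) (at u)"
    and "continuous_on (snd c ` fst c) (chart_field' V c)"
    and "\<And>u. u \<in> snd c ` fst c \<Longrightarrow> blinfun_apply (chart_field' V c u) = frechet_derivative (chart_field V c) (at u)"
proof -
  have "Ck_on 1 (chart_field V c) (snd c ` fst c)"
    using assms unfolding Ck_vector_field_def chart_field_def[abs_def] by blast
  note * = Ck_on_1_blinfun[OF this]
  show "\<And>u. u \<in> snd c ` fst c \<Longrightarrow> (chart_field V c has_derivative blinfun_apply (chart_field' V c u)) (at u)"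
    unfolding chart_field'_def by (rule *(1))
  show "continuous_on (snd c ` fst c) (chart_field' V c)"
    unfolding chart_field'_def[abs_def] by (rule *(2))
  show "\<And>u. u \<in> snd c ` fst c \<Longrightarrow> blinfun_apply (chart_field' V c u) = frechet_derivative (chart_field V c) (at u)"
    unfolding chart_field'_def by (rule *(3))
qed

lemma lie_bracket_chart:
  assumes "Ck_vector_field A 1 V" "Ck_vector_field A 1 W" "c \<in> A" "u \<in> snd c ` fst c"
  shows "lie_bracket A V W (chart_inv c u) c
    = chart_field' W c u (chart_field V c u) - chart_field' V c u (chart_field W c u)"
proof -
  have "c \<in> charts_at A (chart_inv c u)" using assms(3,4) by (simp add: charts_at_def)
  then show ?thesis
    using assms chart_field(3)[OF assms(1,3,4)] chart_field(3)[OF assms(2-4)]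
    by (simp add: lie_bracket_def chart_field_def[abs_def])
qed

lemma chart_frame:
  assumes c: "c \<in> A"
  shows "sl2_frame (snd c ` fst c) (chart_field X c) (chart_field Y c) (chart_field Z c)
    (chart_field' X c) (chart_field' Y c) (chart_field' Z c)"
proof
  show "open (snd c ` fst c)" by (rule chart_open(2)[OF c])
  fix u assume u: "u \<in> snd c ` fst c"
  let ?p = "chart_inv c u"
  have cp: "c \<in> charts_at A ?p" using c u by (simp add: charts_at_def)
  show "a = 0 \<and> b = 0 \<and> d = 0"
    if "a *\<^sub>R chart_field X c u + b *\<^sub>R chart_field Y c u + d *\<^sub>R chart_field Z c u = 0" for a b d
    by (rule frame_independent[of _ ?p], rule tangent_vector_eq_0[OF frame_tangent cp])
      (use that in \<open>simp add: chart_field_def plus_fun_def scaleR_fun_def\<close>)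
  show "chart_field' Y c u (chart_field X c u) - chart_field' X c u (chart_field Y c u) = chart_field Y c u"
    "chart_field' Z c u (chart_field Y c u) - chart_field' Y c u (chart_field Z c u) = chart_field X c u"
    "chart_field' X c u (chart_field Z c u) - chart_field' Z c u (chart_field X c u) = chart_field Z c u"
    using lie_bracket_chart[OF _ _ c u] vector_fields brackets[of ?p] by (metis chart_field_def)+
qed (use chart_field[OF _ c] vector_fields in blast)+

lemma metric_frame: "g p (a *\<^sub>R Y p + b *\<^sub>R Z p) (a *\<^sub>R Y p + b *\<^sub>R Z p) = a\<^sup>2 + b\<^sup>2"
proof -
  note T = tangent_fields[of p]
  have sc: "r *\<^sub>R u \<in> tangent_space A p" if "u \<in> tangent_space A p" for r u
    by (rule subspace_scale[OF subspace_tangent_space that])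
  have ad: "u + v \<in> tangent_space A p" if "u \<in> tangent_space A p" "v \<in> tangent_space A p" for u v
    by (rule subspace_add[OF subspace_tangent_space that])
  have sym: "g p u v = g p v u" if "u \<in> tangent_space A p" "v \<in> tangent_space A p" for u v
    using metric that unfolding Ck_riemannian_metric_def by blast
  have add: "g p (u + v) w = g p u w + g p v w"
    if "u \<in> tangent_space A p" "v \<in> tangent_space A p" "w \<in> tangent_space A p" for u v w
    using metric that unfolding Ck_riemannian_metric_def by blast
  have scale: "g p (r *\<^sub>R u) v = r * g p u v" if "u \<in> tangent_space A p" "v \<in> tangent_space A p" for r u v
    using metric that unfolding Ck_riemannian_metric_def by blast
  have on: "g p (Y p) (Y p) = 1" "g p (Z p) (Z p) = 1" "g p (Y p) (Z p) = 0" "g p (Z p) (Y p) = 0"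
    using ortho sym[OF T(2,3)] unfolding orthonormal3_def by auto
  define w where "w = a *\<^sub>R Y p + b *\<^sub>R Z p"
  have w: "w \<in> tangent_space A p" unfolding w_def by (intro ad sc T)
  have "g p (Y p) w = a" "g p (Z p) w = b"
    using on by (simp_all add: sym[OF T(2) w] sym[OF T(3) w]) (simp_all add: w_def add scale sc T)
  moreover have "g p w w = a * g p (Y p) w + b * g p (Z p) w"
    using w by (subst (1) w_def) (simp add: add scale sc T)
  ultimately show ?thesis by (simp add: w_def power2_eq_square)
qed

lemma tnorm_frame: "tnorm g p (a *\<^sub>R Y p + b *\<^sub>R Z p) = sqrt (a\<^sup>2 + b\<^sup>2)"
  by (simp add: tnorm_def metric_frame)

lemma su_bundle_frame: "v \<in> su_bundle Ess Euu p \<longleftrightarrow> (\<exists>a b. v = a *\<^sub>R Y p + b *\<^sub>R Z p)"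
  unfolding su_bundle_def Ess Euu span_singleton by auto

lemma frame_coefficients_unique:
  assumes "a *\<^sub>R Y p + b *\<^sub>R Z p = a' *\<^sub>R Y p + b' *\<^sub>R Z p"
  shows "a = a'" "b = b'"
proof -
  have "0 *\<^sub>R X p + (a - a') *\<^sub>R Y p + (b - b') *\<^sub>R Z p = 0"
    using assms by (simp add: scaleR_diff_left algebra_simps)
  from frame_independent[OF this] show "a = a'" "b = b'" by auto
qed

lemma component_along_frame:
  "component_along Ess Euu p (a *\<^sub>R Y p + b *\<^sub>R Z p) = a *\<^sub>R Y p"
  "component_along Euu Ess p (a *\<^sub>R Y p + b *\<^sub>R Z p) = b *\<^sub>R Z p"
proof -
  show "component_along Ess Euu p (a *\<^sub>R Y p + b *\<^sub>R Z p) = a *\<^sub>R Y p"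
    unfolding component_along_def Ess Euu span_singleton
    by (rule the_equality) (auto dest: frame_coefficients_unique)
  show "component_along Euu Ess p (a *\<^sub>R Y p + b *\<^sub>R Z p) = b *\<^sub>R Z p"
    unfolding component_along_def Ess Euu span_singleton
  proof (rule the_equality)
    fix w assume "w \<in> range (\<lambda>k. k *\<^sub>R Z p) \<and> (\<exists>w'\<in>range (\<lambda>k. k *\<^sub>R Y p). a *\<^sub>R Y p + b *\<^sub>R Z p = w + w')"
    then obtain r s where "w = r *\<^sub>R Z p" "a *\<^sub>R Y p + b *\<^sub>R Z p = s *\<^sub>R Y p + r *\<^sub>R Z p"
      by (auto simp: add.commute)
    then show "w = b *\<^sub>R Z p" by (auto dest: frame_coefficients_unique)
  qed (auto simp: add.commute intro!: exI[of _ a])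
qed

text \<open>The generator is a derivative at time 0 only; the group law carries it to time
  \<open>t\<close>. Differentiability must be extracted first, from joint smoothness restricted to a
  slice, because \<open>velocity\<close> is meaningful only for differentiable paths.\<close>

lemma flow_has_vector_derivative:
  assumes c: "c \<in> A" "f t x \<in> fst c"
  shows "((\<lambda>t. snd c (f t x)) has_vector_derivative X (f t x) c) (at t)"
proof -
  have d: "(\<lambda>t. snd c (f t y)) differentiable (at t)" if "f t y \<in> fst c" for t y
  proof -
    obtain c' where c': "c' \<in> A" "y \<in> fst c'" by (rule chart_at_exists)
    let ?F = "\<lambda>(t, u). snd c (f t (chart_inv c' u))"
    let ?S = "{(t, u). u \<in> snd c' ` fst c' \<and> f t (chart_inv c' u) \<in> fst c}"
    have "Ck_on (Suc 0) ?F ?S"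
      using flow c c' unfolding smooth_flow_def smooth_map_on_def by blast
    moreover have "(t, snd c' y) \<in> ?S" using that c' by simp
    ultimately have "?F differentiable (at (t, snd c' y))" by simp
    moreover have "(\<lambda>t. (t, snd c' y)) differentiable (at t)"
      by (intro differentiable_Pair) auto
    ultimately have "(\<lambda>t. ?F (t, snd c' y)) differentiable (at t)"
      by (rule differentiable_compose)
    then show ?thesis using c' by simp
  qed
  have "((\<lambda>s. snd c (f s (f t x))) has_vector_derivative X (f t x) c) (at 0)"
    using d[of 0 "f t x"] c flow
    by (simp add: X_def flow_generator_def velocity_def charts_at_def smooth_flow_def vector_derivative_works o_def)
  moreover have "f s (f t x) = f (t + s) x" for s
    using flow unfolding smooth_flow_def by (metis add.commute)
  ultimately have "((\<lambda>s. snd c (f (t + s) x)) has_vector_derivative X (f t x) c) (at 0)" by simp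
  from vector_diff_chain_at[of "\<lambda>s. s - t" 1 t "\<lambda>s. snd c (f (t + s) x)" "X (f t x) c"] this
  show ?thesis by (simp add: o_def has_vector_derivative_diff_const)
qed

lemma unit_speed_controls:
  assumes hp: "horizontal_path A Ess Euu 0 l \<gamma>" and us: "unit_speed A g l \<gamma>"
  obtains N \<alpha> \<beta> where "negligible N" "\<And>s. (\<alpha> s)\<^sup>2 + (\<beta> s)\<^sup>2 = (1::real)"
    "\<forall>s\<in>{0..l} - N. path_differentiable A {0..l} \<gamma> s"
    "\<forall>s\<in>{0..l} - N. velocity A {0..l} \<gamma> s = \<alpha> s *\<^sub>R Y (\<gamma> s) + \<beta> s *\<^sub>R Z (\<gamma> s)"
proof -
  let ?v = "velocity A {0..l} \<gamma>"
  define P where "P = (\<lambda>s. path_differentiable A {0..l} \<gamma> s \<and> ?v s \<in> su_bundle Ess Euu (\<gamma> s) \<and> tnorm g (\<gamma> s) (?v s) = 1)"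
  have "AE s in lebesgue_on {0..l}. path_differentiable A {0..l} \<gamma> s \<and> ?v s \<in> su_bundle Ess Euu (\<gamma> s)"
    "AE s in lebesgue_on {0..l}. tnorm g (\<gamma> s) (?v s) = 1"
    using hp us by (simp_all add: horizontal_path_def unit_speed_def)
  then have "AE s in lebesgue_on {0..l}. P s"
    unfolding P_def by eventually_elim blast
  then have N: "negligible {s \<in> {0..l}. \<not> P s}" by (simp add: AE_lebesgue_on_interval_iff)
  define Q where "Q = (\<lambda>s a b. a\<^sup>2 + b\<^sup>2 = 1 \<and> (P s \<longrightarrow> ?v s = a *\<^sub>R Y (\<gamma> s) + b *\<^sub>R Z (\<gamma> s)))"
  have "\<exists>a b. Q s a b" for s
  proof (cases "P s")
    case True
    then obtain a b where v: "?v s = a *\<^sub>R Y (\<gamma> s) + b *\<^sub>R Z (\<gamma> s)"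
      unfolding P_def su_bundle_frame by blast
    have "sqrt (a\<^sup>2 + b\<^sup>2) = 1" using True tnorm_frame[of "\<gamma> s" a b] v unfolding P_def by metis
    then show ?thesis using v unfolding Q_def by (metis real_sqrt_eq_1_iff)
  next
    case False
    \<comment> \<open>Default controls (1, 0) at parameters where \<open>P\<close> fails, so that
      the unit length identity holds everywhere and not only off the null set.\<close>
    then show ?thesis by (intro exI[of _ 1] exI[of _ 0]) (simp add: Q_def)
  qed
  then obtain \<alpha> \<beta> where Q: "\<And>s. Q s (\<alpha> s) (\<beta> s)" by metis
  show ?thesis
    by (rule that[OF N, of \<alpha> \<beta>]) (use Q in \<open>auto simp: Q_def P_def\<close>)
qed

end

section \<open>Developing paths into SL_2 and lifting them back\<close>

locale developed_chart = special_contact_flow A g\<^sub>0 g f Ess Ec Euu X Y Z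
  for A :: "('a::{t2_space,second_countable_topology}, real^3) chart set"
    and g\<^sub>0 g :: "('a, real^3) metric" and f :: "real \<Rightarrow> 'a \<Rightarrow> 'a"
    and Ess Ec Euu :: "('a, real^3) tbundle"
    and X Y Z :: "'a \<Rightarrow> ('a, real^3) tvec" +
  fixes c :: "('a, real^3) chart" and W :: "(real^3) set" and V :: "(real^2^2) set"
    and D :: "real^3 \<Rightarrow> real^2^2" and D' :: "real^3 \<Rightarrow> (real^3) \<Rightarrow>\<^sub>L (real^2^2)"
    and \<Phi> :: "real^2^2 \<Rightarrow> real^3" and \<Phi>' :: "real^2^2 \<Rightarrow> (real^2^2) \<Rightarrow>\<^sub>L (real^3)"
  assumes c: "c \<in> A"
    and W: "open W" "W \<subseteq> snd c ` fst c" and V: "open V"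
    and D: "\<And>u. u \<in> W \<Longrightarrow> (D has_derivative blinfun_apply (D' u)) (at u)" "continuous_on W D'"
    and D'_frame: "\<And>u a. u \<in> W \<Longrightarrow>
      D' u (a$1 *\<^sub>R chart_field X c u + a$2 *\<^sub>R chart_field Y c u + a$3 *\<^sub>R chart_field Z c u) = D u ** sl2_elem a"
    and D_W: "\<And>u. u \<in> W \<Longrightarrow> det (D u) = 1 \<and> D u \<in> V \<and> \<Phi> (D u) = u"
    and \<Phi>: "\<And>m. m \<in> V \<Longrightarrow> (\<Phi> has_derivative blinfun_apply (\<Phi>' m)) (at m)" "continuous_on V \<Phi>'"
    and \<Phi>_V: "\<And>m. m \<in> V \<Longrightarrow> \<Phi> m \<in> W"
    and D_\<Phi>: "\<And>m. \<lbrakk>m \<in> V; det m = 1\<rbrakk> \<Longrightarrow> D (\<Phi> m) = m"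
begin

text \<open>Differentiating \<open>\<Phi> (D u) = u\<close> shows that the derivative of
  \<open>\<Phi>\<close> undoes that of \<open>D\<close>, so left-invariant matrix fields return to
  the frame with the same coefficients.\<close>

lemma \<Phi>'_frame:
  assumes u: "u \<in> W"
  shows "\<Phi>' (D u) (D u ** sl2_elem a)
    = a$1 *\<^sub>R chart_field X c u + a$2 *\<^sub>R chart_field Y c u + a$3 *\<^sub>R chart_field Z c u"
proof -
  have DV: "D u \<in> V" using D_W[OF u] by blast
  have "((\<lambda>u. \<Phi> (D u)) has_derivative (\<lambda>v. \<Phi>' (D u) (D' u v))) (at u)"
    by (rule has_derivative_compose[OF D(1)[OF u] \<Phi>(1)[OF DV]])
  then have "((\<lambda>u. u) has_derivative (\<lambda>v. \<Phi>' (D u) (D' u v))) (at u)"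
    by (rule has_derivative_transform_within_open[OF _ W(1) u]) (use D_W in blast)
  then have "(\<lambda>v. \<Phi>' (D u) (D' u v)) = (\<lambda>v. v)"
    by (rule has_derivative_unique[OF _ has_derivative_ident])
  from fun_cong[OF this] show ?thesis
    by (simp flip: D'_frame[OF u])
qed

definition lift_path :: "(real \<Rightarrow> real^2^2) \<Rightarrow> real \<Rightarrow> 'a" where
  "lift_path \<sigma> s = chart_inv c (\<Phi> (\<sigma> s))"

text \<open>The source of all competitors in the minimality arguments: a matrix path with velocity
  in the span of Y and Z becomes a horizontal path in M with the same controls, and orthonormality
  of the frame expresses its length through them.\<close>

lemma lift_path_horizontal:
  assumes ab: "a < b" and lip: "L-lipschitz_on {a..b} \<sigma>"
    and \<sigma>V: "\<forall>s\<in>{a..b}. \<sigma> s \<in> V \<and> det (\<sigma> s) = 1" and N: "negligible N"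
    and der: "\<forall>s\<in>{a..b} - N.
      (\<sigma> has_vector_derivative \<sigma> s ** sl2_elem (vector [0, \<alpha> s, \<beta> s])) (at s within {a..b})"
  shows "horizontal_path A Ess Euu a b (lift_path \<sigma>)"
    and "path_len A g a b (lift_path \<sigma>) = integral {a..b} (\<lambda>s. sqrt ((\<alpha> s)\<^sup>2 + (\<beta> s)\<^sup>2))"
proof -
  let ?\<eta> = "lift_path \<sigma>" and ?\<xi> = "\<lambda>s. \<Phi> (\<sigma> s)"
  note \<sigma>V = bspec[OF \<sigma>V] and der = bspec[OF der]
  have \<xi>W: "?\<xi> s \<in> W" if "s \<in> {a..b}" for s using \<Phi>_V \<sigma>V[OF that] by blast
  have "\<sigma> ` {a..b} \<subseteq> V" using \<sigma>V by blast
  then obtain L' where L': "L'-lipschitz_on {a..b} ?\<xi>"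
    by (rule lipschitz_on_C1_compose[OF lip V _ \<Phi>])
  have ac: "abs_continuous_path A a b ?\<eta>"
    unfolding lift_path_def[abs_def]
    by (rule abs_continuous_path_chart_inv[OF c L']) (use \<xi>W W(2) in blast)
  have main: "path_differentiable A {a..b} ?\<eta> s \<and>
      velocity A {a..b} ?\<eta> s = \<alpha> s *\<^sub>R Y (?\<eta> s) + \<beta> s *\<^sub>R Z (?\<eta> s)" if s: "s \<in> {a..b} - N" for s
  proof -
    have s': "s \<in> {a..b}" using s by blast
    define v where "v = 0 *\<^sub>R X (?\<eta> s) + \<alpha> s *\<^sub>R Y (?\<eta> s) + \<beta> s *\<^sub>R Z (?\<eta> s)"
    have v: "v \<in> tangent_space A (?\<eta> s)" unfolding v_def by (rule frame_tangent)
    have \<eta>: "snd c (?\<eta> s) = ?\<xi> s" "?\<eta> s \<in> fst c" if "s \<in> {a..b}" for s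
      using \<xi>W[OF that] W(2) c by (auto simp: lift_path_def)
    have "D (?\<xi> s) = \<sigma> s" using D_\<Phi> \<sigma>V[OF s'] by blast
    then have *: "\<Phi>' (\<sigma> s) (\<sigma> s ** sl2_elem (vector [0, \<alpha> s, \<beta> s])) = v c"
      using \<Phi>'_frame[OF \<xi>W[OF s'], of "vector [0, \<alpha> s, \<beta> s]"]
      by (simp add: v_def plus_fun_def scaleR_fun_def chart_field_def lift_path_def)
    have "(?\<xi> has_derivative (\<lambda>h. \<Phi>' (\<sigma> s) (h *\<^sub>R (\<sigma> s ** sl2_elem (vector [0, \<alpha> s, \<beta> s]))))) (at s within {a..b})"
      by (rule has_derivative_compose[OF der[OF s, unfolded has_vector_derivative_def] \<Phi>(1)]) (use \<sigma>V[OF s'] in blast)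
    then have "(?\<xi> has_vector_derivative v c) (at s within {a..b})"
      unfolding has_vector_derivative_def by (simp add: blinfun.scaleR_right *)
    then have d: "((snd c \<circ> ?\<eta>) has_vector_derivative v c) (at s within {a..b})"
      by (rule has_vector_derivative_transform[OF s', rotated]) (simp add: \<eta>)
    have cs: "c \<in> charts_at A (?\<eta> s)" using c \<eta>(2)[OF s'] by (simp add: charts_at_def)
    have "continuous_on {a..b} ?\<eta>" using ac by (simp add: abs_continuous_path_def)
    from velocity_eqI[OF ab s' cs this v d] show ?thesis by (simp add: v_def plus_fun_def)
  qed
  have "{s \<in> {a..b}. \<not> (path_differentiable A {a..b} ?\<eta> s \<and> velocity A {a..b} ?\<eta> s \<in> su_bundle Ess Euu (?\<eta> s))} \<subseteq> N"
    using main su_bundle_frame by blast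
  then have "AE s in lebesgue_on {a..b}. path_differentiable A {a..b} ?\<eta> s \<and> velocity A {a..b} ?\<eta> s \<in> su_bundle Ess Euu (?\<eta> s)"
    unfolding AE_lebesgue_on_interval_iff by (rule negligible_subset[OF N])
  with ac ab show "horizontal_path A Ess Euu a b ?\<eta>" by (simp add: horizontal_path_def)
  show "path_len A g a b ?\<eta> = integral {a..b} (\<lambda>s. sqrt ((\<alpha> s)\<^sup>2 + (\<beta> s)\<^sup>2))"
    unfolding path_len_def by (rule integral_spike[OF N]) (simp add: main tnorm_frame)
qed

lemma develop_has_vector_derivative:
  assumes "(\<xi> has_vector_derivative v) (at s within S)" "\<xi> s \<in> W"
    and "v = a$1 *\<^sub>R chart_field X c (\<xi> s) + a$2 *\<^sub>R chart_field Y c (\<xi> s) + a$3 *\<^sub>R chart_field Z c (\<xi> s)"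
  shows "((\<lambda>s. D (\<xi> s)) has_vector_derivative D (\<xi> s) ** sl2_elem a) (at s within S)"
  using has_derivative_compose[OF assms(1)[unfolded has_vector_derivative_def] D(1)[OF assms(2)]]
  unfolding has_vector_derivative_def D'_frame[OF assms(2), symmetric] assms(3)[symmetric]
  by (simp add: blinfun.scaleR_right)

text \<open>Uniqueness for the linear equation satisfied by the developed orbit: its product with
  \<open>diag2 (- t)\<close> has zero derivative on an interval and is therefore constant.\<close>

lemma develop_flow:
  assumes T: "0 < T" and in_W: "\<And>t. \<bar>t\<bar> < T \<Longrightarrow> f t x \<in> fst c \<and> snd c (f t x) \<in> W" and t: "\<bar>t\<bar> < T"
  shows "D (snd c (f t x)) = D (snd c x) ** diag2 t"
proof -
  define y where "y = (\<lambda>t. D (snd c (f t x)))"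
  have dy: "(y has_vector_derivative y t ** sl2_elem (vector [1, 0, 0])) (at t within S)" if "\<bar>t\<bar> < T" for t S
  proof -
    have "((\<lambda>t. snd c (f t x)) has_vector_derivative X (f t x) c) (at t within S)"
      using flow_has_vector_derivative[OF c] in_W[OF that] by (blast intro: has_vector_derivative_at_within)
    then show ?thesis
      unfolding y_def
      by (rule develop_has_vector_derivative)
        (use in_W[OF that] c in \<open>auto simp: chart_field_def\<close>)
  qed
  have d0: "((\<lambda>t. y t ** diag2 (- t)) has_derivative (\<lambda>h. 0)) (at t within {-T<..<T})" if "t \<in> {-T<..<T}" for t
  proof -
    have "((\<lambda>t. diag2 (- t)) has_vector_derivative (- 1) *\<^sub>R (diag2 (- t) ** sl2_elem (vector [1, 0, 0]))) (at t within {-T<..<T})"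
      using vector_diff_chain_within[of uminus "- 1" t "{-T<..<T}" diag2, OF _ diag2_has_vector_derivative]
      by (simp add: o_def has_vector_derivative_minus)
    from matmul2.has_vector_derivative[OF dy this]
    have "((\<lambda>t. y t ** diag2 (- t)) has_vector_derivative
        y t ** ((- 1) *\<^sub>R (diag2 (- t) ** sl2_elem (vector [1, 0, 0]))) + y t ** sl2_elem (vector [1, 0, 0]) ** diag2 (- t))
        (at t within {-T<..<T})"
      using that by auto
    also have "y t ** ((- 1) *\<^sub>R (diag2 (- t) ** sl2_elem (vector [1, 0, 0]))) + y t ** sl2_elem (vector [1, 0, 0]) ** diag2 (- t) = 0"
      by (simp add: mat2_eq_iff diag2_def sl2_elem_def algebra_simps)
    finally show ?thesis by (simp add: has_vector_derivative_def)
  qed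
  have "convex {-T<..<T}" by (rule convex_real_interval)
  moreover have "t \<in> {-T<..<T}" "0 \<in> {-T<..<T}" using t T by auto
  ultimately have "y t ** diag2 (- t) = y 0 ** diag2 (- 0)"
    using has_derivative_zero_unique[OF _ d0] by blast
  then have "y t ** diag2 (- t) ** diag2 t = y 0 ** diag2 t" by (simp add: diag2_simps)
  then have "y t = y 0 ** diag2 t" by (simp add: matrix_mul_assoc[symmetric] diag2_simps)
  moreover have "f 0 x = x" using flow by (simp add: smooth_flow_def)
  ultimately show ?thesis by (simp add: y_def)
qed

text \<open>A confinement argument: while the path stays in the chart ball of radius
  \<open>r\<close>, its coordinates move with speed at most \<open>2 * C\<close>, which in total is
  too little to reach the boundary.\<close>

lemma unit_speed_path_in_chart:
  assumes l: "0 \<le> l" and ac: "abs_continuous_path A 0 l \<gamma>" and N: "negligible N"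
    and unit: "\<And>s. (\<alpha> s)\<^sup>2 + (\<beta> s)\<^sup>2 = (1::real)"
    and pd: "\<forall>s\<in>{0..l} - N. path_differentiable A {0..l} \<gamma> s"
    and vel: "\<forall>s\<in>{0..l} - N. velocity A {0..l} \<gamma> s = \<alpha> s *\<^sub>R Y (\<gamma> s) + \<beta> s *\<^sub>R Z (\<gamma> s)"
    and x: "\<gamma> 0 \<in> fst c" and r: "cball (snd c (\<gamma> 0)) r \<subseteq> W" and C: "0 < C"
    and bound: "\<forall>u\<in>cball (snd c (\<gamma> 0)) r. norm (chart_field Y c u) \<le> C \<and> norm (chart_field Z c u) \<le> C"
    and short: "2 * C * l < r"
  shows "\<And>s. s \<in> {0..l} \<Longrightarrow> \<gamma> s \<in> fst c \<and> snd c (\<gamma> s) \<in> W"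
    and "(2 * C)-lipschitz_on {0..l} (\<lambda>s. snd c (\<gamma> s))"
    and "\<And>s. s \<in> {0..l} - N \<Longrightarrow> ((\<lambda>s. snd c (\<gamma> s)) has_vector_derivative
        \<alpha> s *\<^sub>R chart_field Y c (snd c (\<gamma> s)) + \<beta> s *\<^sub>R chart_field Z c (snd c (\<gamma> s))) (at s within {0..l})"
proof -
  let ?u = "snd c (\<gamma> 0)"
  note pd = bspec[OF pd] and vel = bspec[OF vel] and bound = bspec[OF bound]
  have cont: "continuous_on {0..l} \<gamma>" using ac by (simp add: abs_continuous_path_def)
  have r0: "0 < r" using short l C by (smt (verit) mult_nonneg_nonneg)
  have der: "((\<lambda>s. snd c (\<gamma> s)) has_vector_derivative
        \<alpha> s *\<^sub>R chart_field Y c (snd c (\<gamma> s)) + \<beta> s *\<^sub>R chart_field Z c (snd c (\<gamma> s))) (at s within {0..l})"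
    if s: "s \<in> {0..l} - N" and in_c: "\<gamma> s \<in> fst c" for s
  proof -
    have "c \<in> charts_at A (\<gamma> s)" using in_c c by (simp add: charts_at_def)
    from velocity_chart[OF pd[OF s] this] show ?thesis
      using vel[OF s] in_c c by (simp add: o_def chart_field_def plus_fun_def scaleR_fun_def)
  qed
  have inc: "norm (snd c (\<gamma> s2) - snd c (\<gamma> s1)) \<le> 2 * C * (s2 - s1)"
    if s12: "0 \<le> s1" "s1 \<le> s2" "s2 \<le> l"
      and good: "\<And>s. s \<in> {s1..s2} \<Longrightarrow> \<gamma> s \<in> fst c \<and> snd c (\<gamma> s) \<in> cball ?u r" for s1 s2
  proof (rule abs_continuous_on_increment_le[OF s12(2) _ N])
    have "\<gamma> ` {s1..s2} \<subseteq> fst c" "{s1..s2} \<subseteq> {0..l}" using good s12 by auto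
    then have "abs_continuous_on s1 s2 (snd c \<circ> \<gamma>)" using ac c unfolding abs_continuous_path_def by blast
    then show "abs_continuous_on s1 s2 (\<lambda>s. snd c (\<gamma> s))" by (simp add: o_def)
    fix s assume s: "s \<in> {s1..s2} - N"
    then have s': "s \<in> {0..l} - N" and g: "\<gamma> s \<in> fst c" "snd c (\<gamma> s) \<in> cball ?u r" using s12 good[of s] by auto
    show "((\<lambda>s. snd c (\<gamma> s)) has_vector_derivative
        \<alpha> s *\<^sub>R chart_field Y c (snd c (\<gamma> s)) + \<beta> s *\<^sub>R chart_field Z c (snd c (\<gamma> s))) (at s within {s1..s2})"
      by (rule has_vector_derivative_within_subset[OF der[OF s' g(1)]]) (use s12 in auto)
    have "\<bar>\<alpha> s\<bar> \<le> 1" "\<bar>\<beta> s\<bar> \<le> 1"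
      using unit[of s] zero_le_power2[of "\<alpha> s"] zero_le_power2[of "\<beta> s"]
      unfolding abs_square_le_1[symmetric] by linarith+
    then have "norm (\<alpha> s *\<^sub>R chart_field Y c (snd c (\<gamma> s))) \<le> 1 * C" "norm (\<beta> s *\<^sub>R chart_field Z c (snd c (\<gamma> s))) \<le> 1 * C"
      unfolding norm_scaleR using bound[OF g(2)] by (intro mult_mono; simp)+
    then show "norm (\<alpha> s *\<^sub>R chart_field Y c (snd c (\<gamma> s)) + \<beta> s *\<^sub>R chart_field Z c (snd c (\<gamma> s))) \<le> 2 * C"
      by (intro order_trans[OF norm_triangle_ineq]) simp
  qed (use C in simp)
  \<comment> \<open>\<open>B\<close> is the open coordinate ball pulled back to M, and
    \<open>K\<close> its closed counterpart. Compactness makes \<open>K\<close> closed in M, so a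
    limit of points of \<open>B\<close> cannot leave the chart.\<close>
  define B where "B = {p \<in> fst c. snd c p \<in> ball ?u r}"
  define K where "K = chart_inv c ` cball ?u r"
  have sub: "cball ?u r \<subseteq> snd c ` fst c" using r W(2) by blast
  have "open (fst c \<inter> snd c -` ball ?u r)"
    by (rule continuous_open_preimage[OF continuous_on_chart[OF c] chart_open(1)[OF c] open_ball])
  moreover have "B = fst c \<inter> snd c -` ball ?u r" by (auto simp: B_def)
  ultimately have openB: "open B" by simp
  have "compact K" unfolding K_def
    by (rule compact_continuous_image[OF continuous_on_subset[OF continuous_on_chart_inv[OF c] sub] compact_cball])
  then have closedK: "closed K" by (rule compact_imp_closed)
  have BK: "B \<subseteq> K"
  proof
    fix p assume p: "p \<in> B"
    then have "p = chart_inv c (snd c p)" "snd c p \<in> cball ?u r" using c by (auto simp: B_def)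
    then show "p \<in> K" unfolding K_def by blast
  qed
  have K: "p \<in> fst c \<and> snd c p \<in> cball ?u r" if pK: "p \<in> K" for p
  proof -
    obtain u where u: "p = chart_inv c u" "u \<in> cball ?u r" using pK unfolding K_def by blast
    then have "u \<in> snd c ` fst c" using sub by blast
    with u c show ?thesis by simp
  qed
  have inB: "\<gamma> s \<in> B" if s: "s \<in> {0..l}" for s
  proof (rule ccontr)
    assume "\<gamma> s \<notin> B"
    \<comment> \<open>The first exit time \<open>s1 = Inf T\<close> is attained because
      \<open>B\<close> is open. On the closed interval up to \<open>s1\<close> the path lies in
      \<open>K\<close>, where the increment estimate applies and contradicts the exit.\<close>
    define T where "T = {s \<in> {0..l}. \<gamma> s \<in> - B}"
    have "closed T"
      using continuous_closed_preimage[OF cont closed_atLeastAtMost, of "- B"] openB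
      by (simp add: T_def closed_Compl vimage_def Int_def)
    moreover have "T \<noteq> {}" "bdd_below T" using s \<open>\<gamma> s \<notin> B\<close> by (auto simp: T_def bdd_below_def)
    ultimately have inf: "Inf T \<in> T" by (intro closed_contains_Inf)
    define s1 where "s1 = Inf T"
    have s1: "s1 \<in> {0..l}" "\<gamma> s1 \<notin> B" using inf by (auto simp: T_def s1_def)
    have less: "\<gamma> s \<in> B" if "0 \<le> s" "s < s1" for s
    proof (rule ccontr)
      assume "\<gamma> s \<notin> B"
      then have "s \<in> T" using that s1 by (simp add: T_def)
      then have "s1 \<le> s" unfolding s1_def using \<open>bdd_below T\<close> by (rule cInf_lower)
      with that show False by simp
    qed
    have "\<gamma> 0 \<in> B" using x r0 by (simp add: B_def)
    then have s1_pos: "0 < s1" using s1 by (cases "s1 = 0") auto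
    have "closed ({0..l} \<inter> \<gamma> -` K)"
      by (rule continuous_closed_preimage[OF cont closed_atLeastAtMost closedK])
    moreover have "{0..<s1} \<subseteq> {0..l} \<inter> \<gamma> -` K"
    proof
      fix s assume s: "s \<in> {0..<s1}"
      then have "\<gamma> s \<in> K" using less[of s] BK by auto
      then show "s \<in> {0..l} \<inter> \<gamma> -` K" using s s1 by auto
    qed
    ultimately have "closure {0..<s1} \<subseteq> {0..l} \<inter> \<gamma> -` K" by (intro closure_minimal)
    then have *: "\<gamma> s \<in> K" if "s \<in> {0..s1}" for s using s1_pos that by auto
    have "norm (snd c (\<gamma> s1) - ?u) \<le> 2 * C * (s1 - 0)"
      by (rule inc) (use s1 * K in auto)
    also have "\<dots> \<le> 2 * C * l" using s1 C by simp
    finally have "snd c (\<gamma> s1) \<in> ball ?u r" using short by (simp add: dist_norm norm_minus_commute)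
    moreover have "\<gamma> s1 \<in> fst c" using K *[of s1] s1_pos by auto
    ultimately show False using s1(2) by (simp add: B_def)
  qed
  show in_W: "\<gamma> s \<in> fst c \<and> snd c (\<gamma> s) \<in> W" if "s \<in> {0..l}" for s
    using inB[OF that] subsetD[OF r, of "snd c (\<gamma> s)"] by (auto simp: B_def)
  show "(2 * C)-lipschitz_on {0..l} (\<lambda>s. snd c (\<gamma> s))"
  proof (rule lipschitz_on_leI)
    fix s1 s2 assume s: "s1 \<in> {0..l}" "s2 \<in> {0..l}" "s1 \<le> s2"
    have "norm (snd c (\<gamma> s2) - snd c (\<gamma> s1)) \<le> 2 * C * (s2 - s1)"
    proof (rule inc)
      fix s assume "s \<in> {s1..s2}"
      then have "\<gamma> s \<in> B" using s inB[of s] by auto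
      then show "\<gamma> s \<in> fst c \<and> snd c (\<gamma> s) \<in> cball ?u r" by (auto simp: B_def)
    qed (use s in auto)
    then show "dist (snd c (\<gamma> s1)) (snd c (\<gamma> s2)) \<le> 2 * C * dist s1 s2"
      using s by (simp add: dist_norm norm_minus_commute)
  qed (use C in simp)
  show "((\<lambda>s. snd c (\<gamma> s)) has_vector_derivative
        \<alpha> s *\<^sub>R chart_field Y c (snd c (\<gamma> s)) + \<beta> s *\<^sub>R chart_field Z c (snd c (\<gamma> s))) (at s within {0..l})"
    if "s \<in> {0..l} - N" for s
    using der[OF that] in_W[of s] that by blast
qed

text \<open>The bound \<open>2 * C * l < r\<close> confines the geodesic to the chart, so it can be
  developed. Its conjugates are lifted over the same interval \<open>{0..l}\<close>, and their
  lengths are the integrals required by \<open>equal_energies_of_variation\<close>.\<close>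

lemma short_geodesic_balanced:
  assumes geo: "su_geodesic A g Ess Euu x y 0 l \<gamma>" and us: "unit_speed A g l \<gamma>"
    and x: "x \<in> fst c" and r: "cball (snd c x) r \<subseteq> W" and C: "0 < C"
    and bound: "\<forall>u\<in>cball (snd c x) r. norm (chart_field Y c u) \<le> C \<and> norm (chart_field Z c u) \<le> C"
    and short: "2 * C * l < r"
    and y: "y \<in> fst c" "snd c y \<in> W" "D (snd c y) = D (snd c x) ** diag2 t"
  shows "su_balanced A g Ess Euu l \<gamma>"
proof -
  have l: "0 < l" and len: "path_len A g 0 l \<gamma> = l" using us by (auto simp: unit_speed_def)
  have hp: "horizontal_path A Ess Euu 0 l \<gamma>" and ends: "\<gamma> 0 = x" "\<gamma> l = y"
    and minimal: "\<And>\<eta>. \<lbrakk>horizontal_path A Ess Euu 0 l \<eta>; \<eta> 0 = x; \<eta> l = y\<rbrakk>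
      \<Longrightarrow> l \<le> path_len A g 0 l \<eta>"
    using geo len by (auto simp: su_geodesic_def)
  obtain N \<alpha> \<beta> where N: "negligible N" and unit: "\<And>s. (\<alpha> s)\<^sup>2 + (\<beta> s)\<^sup>2 = (1::real)"
    and pd: "\<forall>s\<in>{0..l} - N. path_differentiable A {0..l} \<gamma> s"
    and vel: "\<forall>s\<in>{0..l} - N. velocity A {0..l} \<gamma> s = \<alpha> s *\<^sub>R Y (\<gamma> s) + \<beta> s *\<^sub>R Z (\<gamma> s)"
    using unit_speed_controls[OF hp us] by blast
  have ac: "abs_continuous_path A 0 l \<gamma>" using hp by (simp add: horizontal_path_def)
  note in_chart = unit_speed_path_in_chart[OF less_imp_le[OF l] ac N unit pd vel, unfolded ends, OF x r C bound short]
  have in_W: "\<gamma> s \<in> fst c" "snd c (\<gamma> s) \<in> W" if "s \<in> {0..l}" for s using in_chart(1) that by blast+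
  define \<sigma> where "\<sigma> = (\<lambda>s. D (snd c (\<gamma> s)))"
  have "(\<lambda>s. snd c (\<gamma> s)) ` {0..l} \<subseteq> W" using in_W by blast
  then obtain L where L: "L-lipschitz_on {0..l} \<sigma>"
    unfolding \<sigma>_def by (rule lipschitz_on_C1_compose[OF in_chart(2) W(1) _ D])
  have \<sigma>V: "\<sigma> s \<in> V" "det (\<sigma> s) = 1" if "s \<in> {0..l}" for s
    using D_W[OF in_W(2)[OF that]] by (auto simp: \<sigma>_def)
  have d\<sigma>: "(\<sigma> has_vector_derivative \<sigma> s ** sl2_elem (vector [0, \<alpha> s, \<beta> s])) (at s within {0..l})"
    if s: "s \<in> {0..l} - N" for s
    unfolding \<sigma>_def by (rule develop_has_vector_derivative[OF in_chart(3)[OF s]]) (use in_W s in auto)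
  define M where "M = D (snd c x)"
  have M: "\<sigma> 0 = M" "\<sigma> l = M ** diag2 t" using y(3) by (simp_all add: \<sigma>_def M_def ends)
  have "det M \<noteq> 0" using \<sigma>V(2)[of 0] l M(1) by simp
  then obtain B where B: "M ** B = mat 1" "B ** M = mat 1"
    unfolding invertible_det_nz[symmetric] invertible_def by blast
  \<comment> \<open>Conjugation by \<open>diag2 \<tau>\<close> based at \<open>M\<close>, as the
    chart is normalized at its centre and not at \<open>x\<close>. The left factor preserves
    left-invariant fields, the right factor rescales the controls, and \<open>M ** diag2 t\<close>
    is fixed because diagonal matrices commute.\<close>
  define F where "F = (\<lambda>\<tau> m. M ** diag2 \<tau> ** B ** m ** diag2 (- \<tau>))"
  have cont_diag: "continuous_on UNIV diag2"
    using diag2_has_vector_derivative by (intro continuous_at_imp_continuous_on ballI has_vector_derivative_continuous)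
  \<comment> \<open>Only matrices in \<open>V\<close> can be lifted. At \<tau> = 0 the curve lies in
    \<open>V\<close> with a uniform margin by compactness, and uniform continuity preserves this for
    small \<tau>.\<close>
  have "\<exists>\<tau>0>0. \<forall>\<tau>. \<bar>\<tau>\<bar> < \<tau>0 \<longrightarrow> (\<forall>s\<in>{0..l}. F \<tau> (\<sigma> s) \<in> V)"
  proof -
    have comp: "compact (\<sigma> ` {0..l})"
      by (rule compact_continuous_image[OF lipschitz_on_continuous_on[OF L] compact_Icc])
    obtain e where e: "e > 0" "(\<Union>m\<in>\<sigma> ` {0..l}. ball m e) \<subseteq> V"
      using compact_subset_open_imp_ball_epsilon_subset[OF comp V] \<sigma>V(1) by blast
    have "continuous_on ({-1..1} \<times> \<sigma> ` {0..l}) (\<lambda>(\<tau>, m). F \<tau> m)"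
      unfolding F_def split_def
      by (intro matmul2.continuous_on continuous_on_const continuous_on_compose2[OF cont_diag] continuous_intros) auto
    then have "uniformly_continuous_on ({-1..1} \<times> \<sigma> ` {0..l}) (\<lambda>(\<tau>, m). F \<tau> m)"
      by (rule compact_uniformly_continuous) (intro compact_Times compact_Icc comp)
    then obtain d where d: "d > 0" "\<And>p q. \<lbrakk>p \<in> {-1..1} \<times> \<sigma> ` {0..l}; q \<in> {-1..1} \<times> \<sigma> ` {0..l}; dist q p < d\<rbrakk>
        \<Longrightarrow> dist ((\<lambda>(\<tau>, m). F \<tau> m) q) ((\<lambda>(\<tau>, m). F \<tau> m) p) < e"
      unfolding uniformly_continuous_on_def using e(1) by metis
    have F0: "F 0 m = m" for m by (simp add: F_def diag2_simps B)
    show ?thesis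
    proof (intro exI[of _ "min 1 d"] conjI allI impI ballI)
      fix \<tau> s :: real assume \<tau>: "\<bar>\<tau>\<bar> < min 1 d" and s: "s \<in> {0..l}"
      have "- 1 \<le> \<tau>" "\<tau> \<le> 1" using \<tau> by linarith+
      then have "dist (F \<tau> (\<sigma> s)) (F 0 (\<sigma> s)) < e"
        using d(2)[of "(0, \<sigma> s)" "(\<tau>, \<sigma> s)"] \<tau> s by (auto simp: dist_Pair_Pair)
      then have "F \<tau> (\<sigma> s) \<in> ball (\<sigma> s) e" by (simp add: F0 dist_commute)
      then show "F \<tau> (\<sigma> s) \<in> V" using e(2) s by blast
    qed (use d in simp)
  qed
  then obtain \<tau>0 where \<tau>0: "\<tau>0 > 0" "\<And>\<tau> s. \<lbrakk>\<bar>\<tau>\<bar> < \<tau>0; s \<in> {0..l}\<rbrakk> \<Longrightarrow> F \<tau> (\<sigma> s) \<in> V" by blast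
  have "integral {0..l} (\<lambda>s. (\<alpha> s)\<^sup>2) = integral {0..l} (\<lambda>s. (\<beta> s)\<^sup>2)"
  proof (rule equal_energies_of_variation[OF l \<tau>0(1) unit])
    fix \<tau> assume \<tau>: "\<bar>\<tau>\<bar> < \<tau>0"
    let ?\<eta> = "lift_path (\<lambda>s. F \<tau> (\<sigma> s))"
    have blF: "bounded_linear (F \<tau>)"
      unfolding F_def
      by (intro bounded_linear_compose[OF matmul2.bounded_linear_left] matmul2.bounded_linear_right)
    then obtain L1 where "L1-lipschitz_on (\<sigma> ` {0..l}) (F \<tau>)" by (rule bounded_linear.lipschitz_boundE)
    from lipschitz_on_compose[OF L this] have lip: "(L1 * L)-lipschitz_on {0..l} (\<lambda>s. F \<tau> (\<sigma> s))"
      by (simp add: o_def)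
    have "det B = 1"
      using B(1) \<sigma>V(2)[of 0] l M(1) det_mul[of M B] by simp
    then have FV: "\<forall>s\<in>{0..l}. F \<tau> (\<sigma> s) \<in> V \<and> det (F \<tau> (\<sigma> s)) = 1"
      using \<tau>0(2)[OF \<tau>] \<sigma>V(2) \<sigma>V(2)[of 0] l M(1) by (simp add: F_def det_mul diag2_simps)
    have dF: "\<forall>s\<in>{0..l} - N. ((\<lambda>s. F \<tau> (\<sigma> s)) has_vector_derivative
        F \<tau> (\<sigma> s) ** sl2_elem (vector [0, exp \<tau> * \<alpha> s, exp (- \<tau>) * \<beta> s])) (at s within {0..l})"
    proof
      fix s assume s: "s \<in> {0..l} - N"
      have "F \<tau> (\<sigma> s ** sl2_elem (vector [0, \<alpha> s, \<beta> s]))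
          = F \<tau> (\<sigma> s) ** sl2_elem (vector [0, exp \<tau> * \<alpha> s, exp (- \<tau>) * \<beta> s])"
        by (simp add: F_def matrix_mul_assoc[symmetric] diag2_conjugate)
      then show "((\<lambda>s. F \<tau> (\<sigma> s)) has_vector_derivative
        F \<tau> (\<sigma> s) ** sl2_elem (vector [0, exp \<tau> * \<alpha> s, exp (- \<tau>) * \<beta> s])) (at s within {0..l})"
        using bounded_linear.has_vector_derivative[OF blF d\<sigma>[OF s]] by simp
    qed
    have FM: "F \<tau> (M ** diag2 t) = M ** diag2 t" for t
    proof -
      have "F \<tau> (M ** diag2 t) = M ** (diag2 \<tau> ** ((B ** M) ** (diag2 t ** diag2 (- \<tau>))))"
        by (simp add: F_def matrix_mul_assoc)
      then show ?thesis by (simp add: B diag2_simps)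
    qed
    from FM[of 0] have "F \<tau> M = M" by (simp add: diag2_simps)
    then have "?\<eta> 0 = x"
      using D_W[OF in_W(2)[of 0]] l x c by (simp add: lift_path_def M(1) M_def ends)
    moreover have "?\<eta> l = y"
      using D_W[OF y(2)] y(1,3) c by (simp add: lift_path_def M(2) FM) (simp add: M_def)
    moreover note lift_path_horizontal[OF l lip FV N dF]
    ultimately show "l \<le> integral {0..l} (\<lambda>s. sqrt ((exp \<tau> * \<alpha> s)\<^sup>2 + (exp (- \<tau>) * \<beta> s)\<^sup>2))"
      using minimal[of ?\<eta>] by simp
  qed
  moreover have "integral {0..l} (\<lambda>s. (tnorm g (\<gamma> s) (component_along Ess Euu (\<gamma> s) (velocity A {0..l} \<gamma> s)))\<^sup>2)
      = integral {0..l} (\<lambda>s. (\<alpha> s)\<^sup>2)"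
  proof (rule integral_spike[OF N])
    fix s assume s: "s \<in> {0..l} - N"
    have "tnorm g (\<gamma> s) (\<alpha> s *\<^sub>R Y (\<gamma> s)) = \<bar>\<alpha> s\<bar>" using tnorm_frame[of "\<gamma> s" "\<alpha> s" 0] by simp
    then show "(\<alpha> s)\<^sup>2 = (tnorm g (\<gamma> s) (component_along Ess Euu (\<gamma> s) (velocity A {0..l} \<gamma> s)))\<^sup>2"
      by (simp add: bspec[OF vel s] component_along_frame)
  qed
  moreover have "integral {0..l} (\<lambda>s. (tnorm g (\<gamma> s) (component_along Euu Ess (\<gamma> s) (velocity A {0..l} \<gamma> s)))\<^sup>2)
      = integral {0..l} (\<lambda>s. (\<beta> s)\<^sup>2)"
  proof (rule integral_spike[OF N])
    fix s assume s: "s \<in> {0..l} - N"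
    have "tnorm g (\<gamma> s) (\<beta> s *\<^sub>R Z (\<gamma> s)) = \<bar>\<beta> s\<bar>" using tnorm_frame[of "\<gamma> s" 0 "\<beta> s"] by simp
    then show "(\<beta> s)\<^sup>2 = (tnorm g (\<gamma> s) (component_along Euu Ess (\<gamma> s) (velocity A {0..l} \<gamma> s)))\<^sup>2"
      by (simp add: bspec[OF vel s] component_along_frame)
  qed
  ultimately show ?thesis by (simp add: su_balanced_def component_energy_def)
qed

text \<open>Left translation by the development of \<open>x\<close> makes the explicit matrix path
  start at the right point; its lift is a competitor over the unit interval with both controls
  bounded by \<open>e\<close>.\<close>

lemma lifted_path_short:
  assumes x: "x \<in> fst c" "snd c x \<in> W" and y: "y \<in> fst c" "snd c y \<in> W"
    and \<sigma>0: "\<sigma> 0 = mat 1" and \<sigma>1: "D (snd c y) = D (snd c x) ** \<sigma> 1"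
    and cont: "continuous_on {0..1} \<alpha>" "continuous_on {0..1} \<beta>"
    and \<sigma>: "\<And>s. s \<in> {0..1} \<Longrightarrow>
      (\<sigma> has_vector_derivative \<sigma> s ** sl2_elem (vector [0, \<alpha> s, \<beta> s])) (at s within {0..1})"
    and det: "\<And>s. s \<in> {0..1} \<Longrightarrow> det (\<sigma> s) = 1"
    and inV: "\<And>s. s \<in> {0..1} \<Longrightarrow> D (snd c x) ** \<sigma> s \<in> V"
    and bd: "\<And>s. s \<in> {0..1} \<Longrightarrow> \<bar>\<alpha> s\<bar> \<le> e \<and> \<bar>\<beta> s\<bar> \<le> e"
    and geo: "su_geodesic A g Ess Euu x y 0 l \<gamma>" and us: "unit_speed A g l \<gamma>"
  shows "l \<le> 2 * e"
proof -
  define M where "M = D (snd c x)"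
  have sl2_eq: "sl2_elem (vector [0, a, b]) = a *\<^sub>R mat2 0 1 0 0 + b *\<^sub>R mat2 0 0 (1/2) 0" for a b
    by (simp add: sl2_elem_def mat2_eq_iff)
  have cont\<sigma>: "continuous_on {0..1} \<sigma>"
    unfolding continuous_on_eq_continuous_within using has_vector_derivative_continuous[OF \<sigma>] by blast
  have "compact ((\<lambda>s. \<sigma> s ** sl2_elem (vector [0, \<alpha> s, \<beta> s])) ` {0..1})"
    unfolding sl2_eq by (intro compact_continuous_image matmul2.continuous_on continuous_intros cont\<sigma> cont compact_Icc)
  then obtain K where K: "K > 0" "\<And>s. s \<in> {0..1} \<Longrightarrow> norm (\<sigma> s ** sl2_elem (vector [0, \<alpha> s, \<beta> s])) \<le> K"
    using compact_imp_bounded[of "(\<lambda>s. \<sigma> s ** sl2_elem (vector [0, \<alpha> s, \<beta> s])) ` {0..1}"]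
    unfolding bounded_pos by auto
  have "K-lipschitz_on {0..1} \<sigma>"
  proof (rule bounded_derivative_imp_lipschitz)
    fix s :: real assume s: "s \<in> {0..1}"
    show "(\<sigma> has_derivative (\<lambda>h. h *\<^sub>R (\<sigma> s ** sl2_elem (vector [0, \<alpha> s, \<beta> s])))) (at s within {0..1})"
      using \<sigma>[OF s] by (simp add: has_vector_derivative_def)
    show "onorm (\<lambda>h. h *\<^sub>R (\<sigma> s ** sl2_elem (vector [0, \<alpha> s, \<beta> s]))) \<le> K"
    proof (rule onorm_bound)
      show "norm (h *\<^sub>R (\<sigma> s ** sl2_elem (vector [0, \<alpha> s, \<beta> s]))) \<le> K * norm h" for h :: real
        using mult_right_mono[OF K(2)[OF s], of "\<bar>h\<bar>"] by (simp add: mult.commute)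
    qed (use K in simp)
  qed (use K in auto)
  moreover obtain L1 where "L1-lipschitz_on (\<sigma> ` {0..1}) ((**) M)"
    by (rule bounded_linear.lipschitz_boundE[OF matmul2.bounded_linear_right])
  ultimately have "(L1 * K)-lipschitz_on {0..1} ((**) M \<circ> \<sigma>)" by (intro lipschitz_on_compose)
  then have lip: "(L1 * K)-lipschitz_on {0..1} (\<lambda>s. M ** \<sigma> s)" by (simp add: o_def)
  have MV: "\<forall>s\<in>{0..1}. M ** \<sigma> s \<in> V \<and> det (M ** \<sigma> s) = 1"
    using inV det D_W[OF x(2)] by (simp add: M_def det_mul)
  have der: "\<forall>s\<in>{0..1} - {}. ((\<lambda>s. M ** \<sigma> s) has_vector_derivative M ** \<sigma> s ** sl2_elem (vector [0, \<alpha> s, \<beta> s])) (at s within {0..1})"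
    using bounded_linear.has_vector_derivative[OF matmul2.bounded_linear_right \<sigma>, of _ M]
    by (simp add: matrix_mul_assoc)
  let ?\<eta> = "lift_path (\<lambda>s. M ** \<sigma> s)"
  note lift = lift_path_horizontal[OF zero_less_one lip MV negligible_empty der]
  have "?\<eta> 0 = x" using D_W[OF x(2)] x(1) c by (simp add: lift_path_def \<sigma>0 M_def)
  moreover have "?\<eta> 1 = y" using D_W[OF y(2)] y(1) c \<sigma>1 by (simp add: lift_path_def M_def)
  ultimately have "path_len A g 0 l \<gamma> \<le> path_len A g 0 1 ?\<eta>"
    using geo lift(1) unfolding su_geodesic_def by blast
  also have "\<dots> = integral {0..1} (\<lambda>s. sqrt ((\<alpha> s)\<^sup>2 + (\<beta> s)\<^sup>2))" by (rule lift(2))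
  also have "\<dots> \<le> integral {0..1} (\<lambda>s::real. 2 * e)"
  proof (rule integral_le)
    show "(\<lambda>s. sqrt ((\<alpha> s)\<^sup>2 + (\<beta> s)\<^sup>2)) integrable_on {0..1}"
      by (intro integrable_continuous_interval continuous_intros cont)
    show "sqrt ((\<alpha> s)\<^sup>2 + (\<beta> s)\<^sup>2) \<le> 2 * e" if "s \<in> {0..1}" for s
      using bd[OF that] sqrt_sum_squares_le_sum_abs[of "\<alpha> s" "\<beta> s"] by linarith
  qed auto
  finally show ?thesis using us by (simp add: unit_speed_def)
qed

text \<open>All thresholds have to be chosen before \<open>x\<close>. One developed chart serves
  every \<open>x\<close> near its centre, where the development of \<open>x\<close> is merely close
  to 1.\<close>

lemma geodesics_near_balanced:
  assumes u0: "snd c x0 \<in> W" "D (snd c x0) = mat 1" and x0: "x0 \<in> fst c"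
  obtains S \<delta> where "open S" "x0 \<in> S" "0 < \<delta>"
    "\<And>x t l \<gamma>. \<lbrakk>x \<in> S; \<bar>t\<bar> < \<delta>; su_geodesic A g Ess Euu x (f t x) 0 l \<gamma>; unit_speed A g l \<gamma>\<rbrakk>
      \<Longrightarrow> su_balanced A g Ess Euu l \<gamma>"
proof -
  interpret fr: sl2_frame "snd c ` fst c" "chart_field X c" "chart_field Y c" "chart_field Z c"
    "chart_field' X c" "chart_field' Y c" "chart_field' Z c"
    by (rule chart_frame[OF c])
  obtain \<rho> where \<rho>: "0 < \<rho>" "cball (snd c x0) (2 * \<rho>) \<subseteq> W"
  proof -
    obtain e where "0 < e" "cball (snd c x0) e \<subseteq> W" using W(1) u0(1) open_contains_cball by blast
    then show ?thesis using that[of "e / 2"] by simp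
  qed
  have contYZ: "continuous_on (cball (snd c x0) (2 * \<rho>)) (chart_field Y c)"
    "continuous_on (cball (snd c x0) (2 * \<rho>)) (chart_field Z c)"
    by (intro continuous_at_imp_continuous_on ballI has_derivative_continuous[OF fr.Y(1)]
        has_derivative_continuous[OF fr.Z(1)] subsetD[OF subset_trans[OF \<rho>(2) W(2)]]; assumption)+
  obtain C1 where C1: "C1 > 0" "\<And>u. u \<in> cball (snd c x0) (2 * \<rho>) \<Longrightarrow> norm (chart_field Y c u) \<le> C1"
    using compact_imp_bounded[OF compact_continuous_image[OF contYZ(1) compact_cball]]
    unfolding bounded_pos by blast
  obtain C2 where C2: "C2 > 0" "\<And>u. u \<in> cball (snd c x0) (2 * \<rho>) \<Longrightarrow> norm (chart_field Z c u) \<le> C2"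
    using compact_imp_bounded[OF compact_continuous_image[OF contYZ(2) compact_cball]]
    unfolding bounded_pos by blast
  define C where "C = max C1 C2"
  have C: "C > 0" using C1(1) by (simp add: C_def)
  have bound: "norm (chart_field Y c u) \<le> C \<and> norm (chart_field Z c u) \<le> C"
    if "u \<in> cball (snd c x0) (2 * \<rho>)" for u
    using C1(2)[OF that] C2(2)[OF that] by (simp add: C_def le_max_iff_disj)
  have "mat 1 \<in> V" using D_W[OF u0(1)] u0(2) by simp
  \<comment> \<open>Continuity of multiplication at (1, 1) separates the two requirements:
    \<open>x\<close> develops into \<open>O1\<close>, the explicit path stays in \<open>O2\<close>,
    and the products then lie in \<open>V\<close> for all such \<open>x\<close> at once.\<close>
  have "open ((\<lambda>p :: (real^2^2) \<times> (real^2^2). fst p ** snd p) -` V)"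
    by (intro open_vimage V matmul2.continuous_on continuous_intros)
  moreover have "(mat 1, mat 1) \<in> (\<lambda>p :: (real^2^2) \<times> (real^2^2). fst p ** snd p) -` V" using \<open>mat 1 \<in> V\<close> by simp
  ultimately obtain O1 O2 where O1: "open O1" "mat 1 \<in> O1" and O2: "open O2" "mat 1 \<in> O2"
    and O12: "O1 \<times> O2 \<subseteq> (\<lambda>p :: (real^2^2) \<times> (real^2^2). fst p ** snd p) -` V"
    by (rule open_prod_elim) auto
  obtain e1 where e1: "e1 > 0" "ball (mat 1) e1 \<subseteq> O2"
    using O2 open_contains_ball by blast
  \<comment> \<open>The first bound keeps the explicit path in \<open>O2\<close>. The second turns
    \<open>l \<le> 2 * e\<close> into \<open>2 * C * l \<le> \<rho> / 2\<close>, so a geodesic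
    starting within \<open>\<rho>\<close> of the centre stays within
    \<open>2 * \<rho>\<close>.\<close>
  define e where "e = min (e1 / 2) (\<rho> / (8 * C))"
  have e: "e > 0" "e < e1" "8 * C * e \<le> \<rho>" using e1(1) \<rho>(1) C by (auto simp: e_def min_def field_simps)
  obtain \<delta>1 where \<delta>1: "\<delta>1 > 0"
    "\<And>t. \<bar>t\<bar> < \<delta>1 \<Longrightarrow> \<exists>\<sigma> \<alpha> \<beta>. \<sigma> 0 = mat 1 \<and> \<sigma> 1 = diag2 t \<and>
       continuous_on {0..1} \<alpha> \<and> continuous_on {0..1} \<beta> \<and>
       (\<forall>s\<in>{0..1}. (\<sigma> has_vector_derivative \<sigma> s ** sl2_elem (vector [0, \<alpha> s, \<beta> s])) (at s within {0..1}) \<and>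
          det (\<sigma> s) = 1 \<and> norm (\<sigma> s - mat 1) \<le> e \<and> \<bar>\<alpha> s\<bar> \<le> e \<and> \<bar>\<beta> s\<bar> \<le> e)"
    using horizontal_matrix_path_to_diag2[OF e(1)] by blast
  have pre: "open (fst c \<inter> snd c -` G)" if "open G" for G
    by (rule continuous_open_preimage[OF continuous_on_chart[OF c] chart_open(1)[OF c] that])
  define G where "G = W \<inter> D -` O1 \<inter> ball (snd c x0) \<rho>"
  have "continuous_on W D"
    by (intro continuous_at_imp_continuous_on ballI has_derivative_continuous[OF D(1)])
  then have "open G" unfolding G_def
    by (intro open_Int continuous_open_preimage W O1 open_ball)
  define S1 where "S1 = fst c \<inter> snd c -` G"
  define S2 where "S2 = fst c \<inter> snd c -` W"
  have S1: "open S1" "x0 \<in> S1" using pre[OF \<open>open G\<close>] x0 u0 O1(2) \<rho>(1) by (auto simp: S1_def G_def)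
  have S2: "open S2" "x0 \<in> S2" using pre[OF W(1)] x0 u0 by (auto simp: S2_def)
  \<comment> \<open>Joint continuity of the flow provides one time bound for all starting points
    near \<open>x0\<close>, so that whole orbit segments remain in the developed chart.\<close>
  have "open ((\<lambda>(t, p). f t p) -` S2)"
    using flow S2(1) by (intro open_vimage) (auto simp: smooth_flow_def)
  moreover have "(0, x0) \<in> (\<lambda>(t, p). f t p) -` S2"
    using flow S2(2) by (simp add: smooth_flow_def)
  ultimately obtain I S3 where S3: "open I" "open S3" "0 \<in> I" "x0 \<in> S3" "I \<times> S3 \<subseteq> (\<lambda>(t, p). f t p) -` S2"
    by (rule open_prod_elim) auto
  obtain \<delta>2 where \<delta>2: "\<delta>2 > 0" "ball 0 \<delta>2 \<subseteq> I" using S3(1,3) open_contains_ball by blast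
  have flow_in: "f t x \<in> fst c \<and> snd c (f t x) \<in> W" if "x \<in> S3" "\<bar>t\<bar> < \<delta>2" for x t
  proof -
    have "t \<in> ball 0 \<delta>2" using that(2) by simp
    then have "(t, x) \<in> (\<lambda>(t, p). f t p) -` S2" using \<delta>2(2) S3(5) that(1) by blast
    then show ?thesis by (simp add: S2_def)
  qed
  show ?thesis
  proof (rule that[of "S1 \<inter> S3" "min \<delta>1 \<delta>2"])
    show "open (S1 \<inter> S3)" using S1 S3 by blast
    show "x0 \<in> S1 \<inter> S3" using S1 S3 by blast
    show "0 < min \<delta>1 \<delta>2" using \<delta>1 \<delta>2 by simp
    fix x t l \<gamma>
    assume x: "x \<in> S1 \<inter> S3" and t: "\<bar>t\<bar> < min \<delta>1 \<delta>2"
      and geo: "su_geodesic A g Ess Euu x (f t x) 0 l \<gamma>" and us: "unit_speed A g l \<gamma>"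
    have xc: "x \<in> fst c" "snd c x \<in> W" "D (snd c x) \<in> O1" "snd c x \<in> ball (snd c x0) \<rho>"
      using x by (auto simp: S1_def G_def)
    have y: "f t x \<in> fst c" "snd c (f t x) \<in> W" using flow_in[of x t] x t by auto
    have Dy: "D (snd c (f t x)) = D (snd c x) ** diag2 t"
      by (rule develop_flow[OF \<delta>2(1)]) (use flow_in x t in auto)
    obtain \<sigma> \<alpha> \<beta> where \<sigma>: "\<sigma> 0 = mat 1" "\<sigma> 1 = diag2 t"
       "continuous_on {0..1} \<alpha>" "continuous_on {0..1} \<beta>"
       "\<And>s. s \<in> {0..1} \<Longrightarrow> (\<sigma> has_vector_derivative \<sigma> s ** sl2_elem (vector [0, \<alpha> s, \<beta> s])) (at s within {0..1})"
       "\<And>s. s \<in> {0..1} \<Longrightarrow> det (\<sigma> s) = 1"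
       "\<And>s. s \<in> {0..1} \<Longrightarrow> norm (\<sigma> s - mat 1) \<le> e"
       "\<And>s. s \<in> {0..1} \<Longrightarrow> \<bar>\<alpha> s\<bar> \<le> e \<and> \<bar>\<beta> s\<bar> \<le> e"
      using \<delta>1(2)[of t] t unfolding min_less_iff_conj by blast
    have "l \<le> 2 * e"
    proof (rule lifted_path_short[OF xc(1,2) y \<sigma>(1) _ \<sigma>(3-6) _ \<sigma>(8) geo us])
      show "D (snd c (f t x)) = D (snd c x) ** \<sigma> 1" using Dy \<sigma>(2) by simp
      show "D (snd c x) ** \<sigma> s \<in> V" if "s \<in> {0..1}" for s
      proof -
        have "\<sigma> s \<in> ball (mat 1) e1" using \<sigma>(7)[OF that] e(2) by (simp add: dist_norm norm_minus_commute)
        then have "(D (snd c x), \<sigma> s) \<in> (\<lambda>p. fst p ** snd p) -` V" using xc(3) e1(2) O12 by blast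
        then show ?thesis by simp
      qed
    qed
    then have "2 * C * l \<le> 2 * C * (2 * e)" using C by (intro mult_left_mono) auto
    also have "\<dots> < \<rho>" using e(3) C \<rho>(1) by linarith
    finally have short: "2 * C * l < \<rho>" .
    have sub: "cball (snd c x) \<rho> \<subseteq> cball (snd c x0) (2 * \<rho>)"
    proof
      fix u assume "u \<in> cball (snd c x) \<rho>"
      then show "u \<in> cball (snd c x0) (2 * \<rho>)"
        using xc(4) dist_triangle[of "snd c x0" u "snd c x"] by simp
    qed
    show "su_balanced A g Ess Euu l \<gamma>"
      by (rule short_geodesic_balanced[OF geo us xc(1) _ C _ short y Dy])
        (use sub \<rho>(2) bound in blast)+
  qed
qed

end

section \<open>From local to global by compactness\<close>

lemma (in special_contact_flow) geodesics_locally_balanced: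
  obtains S \<delta> where "open S" "x0 \<in> S" "0 < \<delta>"
    "\<And>x t l \<gamma>. \<lbrakk>x \<in> S; \<bar>t\<bar> < \<delta>; su_geodesic A g Ess Euu x (f t x) 0 l \<gamma>; unit_speed A g l \<gamma>\<rbrakk>
      \<Longrightarrow> su_balanced A g Ess Euu l \<gamma>"
proof -
  obtain c where cA: "c \<in> A" "x0 \<in> fst c" by (rule chart_at_exists)
  interpret fr: sl2_frame "snd c ` fst c" "chart_field X c" "chart_field Y c" "chart_field Z c"
    "chart_field' X c" "chart_field' Y c" "chart_field' Z c"
    by (rule chart_frame[OF cA(1)])
  have u0: "snd c x0 \<in> snd c ` fst c" using cA(2) by blast
  obtain W V D D' \<Phi> \<Phi>' where dc:
    "open W" "snd c x0 \<in> W" "W \<subseteq> snd c ` fst c" "open V" "D (snd c x0) = mat 1"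
    "\<And>u. u \<in> W \<Longrightarrow> (D has_derivative blinfun_apply (D' u)) (at u)"
    "continuous_on W D'"
    "\<And>u a. u \<in> W \<Longrightarrow> D' u (fr.frame u a) = D u ** sl2_elem a"
    "\<And>u. u \<in> W \<Longrightarrow> det (D u) = 1 \<and> D u \<in> V \<and> \<Phi> (D u) = u"
    "\<And>m. m \<in> V \<Longrightarrow> (\<Phi> has_derivative blinfun_apply (\<Phi>' m)) (at m)"
    "continuous_on V \<Phi>'"
    "\<And>m. m \<in> V \<Longrightarrow> \<Phi> m \<in> W"
    "\<And>m. \<lbrakk>m \<in> V; det m = 1\<rbrakk> \<Longrightarrow> D (\<Phi> m) = m"
    by (rule fr.developing_chart[OF u0]) (assumption | rule that)+
  interpret developed_chart A g\<^sub>0 g f Ess Ec Euu X Y Z c W V D D' \<Phi> \<Phi>'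
    by unfold_locales (use cA dc in \<open>simp_all add: fr.frame_apply\<close>)
  show ?thesis
    by (rule geodesics_near_balanced[OF dc(2,5) cA(2)]) (rule that)
qed

theorem theoremA:
  fixes A :: "('a::{t2_space,second_countable_topology}, real^3) chart set"
    and g\<^sub>0 g :: "('a, real^3) metric"
    and f :: "real \<Rightarrow> 'a \<Rightarrow> 'a"
    and Ess Ec Euu :: "('a, real^3) tbundle"
    and X Y Z :: "'a \<Rightarrow> ('a, real^3) tvec"
  assumes "closed_connected_manifold A"
    and "smooth_riemannian_metric A g\<^sub>0"
    and "special_contact_anosov_flow A g\<^sub>0 f Ess Ec Euu g X Y Z"
  shows "\<exists>\<delta>>0. \<forall>x t. \<bar>t\<bar> < \<delta> \<longrightarrow>
    (\<forall>l \<gamma>. su_geodesic A g Ess Euu x (f t x) 0 l \<gamma> \<and> unit_speed A g l \<gamma> \<longrightarrow>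
       su_balanced A g Ess Euu l \<gamma>)"
proof -
  interpret special_contact_flow A g\<^sub>0 g f Ess Ec Euu X Y Z
    by unfold_locales (use assms in \<open>simp_all add: closed_connected_manifold_def\<close>)
  define ok where "ok = (\<lambda>S \<delta>. open S \<and> 0 < \<delta> \<and> (\<forall>x\<in>S. \<forall>t l \<gamma>. \<bar>t\<bar> < \<delta> \<longrightarrow>
    su_geodesic A g Ess Euu x (f t x) 0 l \<gamma> \<longrightarrow> unit_speed A g l \<gamma> \<longrightarrow> su_balanced A g Ess Euu l \<gamma>))"
  define \<S> where "\<S> = {S. \<exists>\<delta>. ok S \<delta>}"
  have "x \<in> \<Union>\<S>" for x
  proof -
    obtain S \<delta> where "x \<in> S" "ok S \<delta>"
      by (rule geodesics_locally_balanced[of x]) (unfold ok_def, blast)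
    then show ?thesis unfolding \<S>_def by blast
  qed
  then have "UNIV \<subseteq> \<Union>\<S>" by blast
  moreover have "compact (UNIV :: 'a set)" using assms(1) by (simp add: closed_connected_manifold_def)
  ultimately obtain \<F> where \<F>: "\<F> \<subseteq> \<S>" "finite \<F>" "UNIV \<subseteq> \<Union>\<F>"
    by (rule_tac compactE[of UNIV \<S>]) (auto simp: \<S>_def ok_def)
  have "\<forall>S\<in>\<F>. \<exists>\<delta>. ok S \<delta>" using \<F>(1) by (auto simp: \<S>_def)
  then obtain d where d: "\<And>S. S \<in> \<F> \<Longrightarrow> ok S (d S)" by metis
  \<comment> \<open>Inserting 1 ensures that the minimum is taken over a nonempty set.\<close>
  define \<delta> where "\<delta> = Min (insert 1 (d ` \<F>))"
  have "0 < \<delta>" unfolding \<delta>_def using \<F>(2) d by (auto simp: ok_def)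
  moreover have "su_balanced A g Ess Euu l \<gamma>"
    if "\<bar>t\<bar> < \<delta>" "su_geodesic A g Ess Euu x (f t x) 0 l \<gamma>" "unit_speed A g l \<gamma>" for x t l \<gamma>
  proof -
    obtain S where S: "S \<in> \<F>" "x \<in> S" using \<F>(3) by blast
    have "\<delta> \<le> d S" unfolding \<delta>_def using \<F>(2) S(1) by simp
    with that(1) have "\<bar>t\<bar> < d S" by linarith
    then show ?thesis using d[OF S(1)] S(2) that(2,3) unfolding ok_def by blast
  qed
  ultimately show ?thesis by blast
qed

end
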